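(* Let $m\ge2$ be an integer and $\delta>-m$. Let $(\xi_t)_{t\ge0}$ be the embedding birth process defined by the sequence $(k+1+\delta/m)_{k\in\mathbb{N}}$, let $\boldsymbol{\xi}$ be the corresponding continuous-time branching process and $(\mathrm{CBP}^{(m)}_t)_{t\ge0}$ the corresponding collapsed branching process. Then: (i) The collapsed branching process embeds in continuous time the preferential attachment model with out-degree $m$ and attachment function $f(k)=k+\delta$: the sequence $(\mathrm{CBP}^{(m)}_{\tau_{(n,j)}})_{n\ge1,\,1\le j\le m}$ has the law of that model. (ii) $(\xi_t)_{t\ge0}$ is supercritical and Malthusian and satisfies the Lipschitz condition, and, with $\alpha^*$ its Malthusian parameter and $\mu,\Theta$ as in the context, as $t\to\infty$: $m e^{-\alpha^* t}N^{(m)}(t)\to \frac{1}{\mu\alpha^*}\Theta$ almost surely, and for every $k\in\mathbb{N}$, $m e^{-\alpha^* t}N^{(m)}_k(t)\to\frac{1}{\mu\alpha^*}p^{(m)}_k\Theta$ in probability and $N^{(m)}_k(t)/N^{(m)}(t)\to p^{(m)}_k$ in probability, where $N^{(m)}(t)$ is the number of vertices of $\mathrm{CBP}^{(m)}_t$ and $N^{(m)}_k(t)$ the number of its vertices with (in-)degree $k$. (iii) The limiting degree distribution is, for $k\in\mathbb{N}$, $$p_k^{(m)}=\left(2+\delta/m\right)\frac{\Gamma(2+\delta/m+m+\delta)}{\Gamma(m+\delta)}\,\frac{\Gamma(k+m+\delta)}{\Gamma(k+m+\delta+3+\delta/m)}.$$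
   Context: Degrees $k$ range over $\mathbb{N}=\{0,1,2,\dots\}$; individuals and vertices are numbered from $1$. Birth process: a point process $\xi$ on $\mathbb{R}^+=[0,\infty)$; $\xi_t=\xi([0,t])$ for $t\ge 0$, $\xi_t=0$ for $t<0$; $\mathbb{E}\xi(dt)$ is the mean measure. $\xi$ is supercritical if there is $\alpha^*>0$ with $\int_0^\infty e^{-\alpha^* t}\,\mathbb{E}\xi(dt)=1$, and it is then Malthusian with Malthusian parameter $\alpha^*$ if $\mu:=\int_0^\infty t e^{-\alpha^* t}\,\mathbb{E}\xi(dt)<\infty$. Lipschitz condition: for every $k\in\mathbb{N}$ there is $0<L(k)<\infty$ such that $t\mapsto \mathbb{P}(\xi_t=k)$ is Lipschitz on $\mathbb{R}^+$ with constant $L(k)$. Embedding birth process defined by positive numbers $(\lambda_k)_{k\in\mathbb{N}}$: let $(E_k)_{k\in\mathbb{N}}$ be independent, $E_k$ exponential with parameter $\lambda_k$, $E_{-1}=0$; then $\xi_t=k$ if $t\in[E_{-1}+\cdots+E_{k-1},\,E_{-1}+\cdots+E_k)$. Continuous-time branching process $\boldsymbol{\xi}$: it starts with one individual born at time $0$; each individual $x$, born at time $\tau_x$, carries an i.i.d. copy $\xi^x$ of $\xi$ and gives birth to a child at time $\tau_x+s$ for each point $s$ of $\xi^x$; individuals never die. Individuals are labelled $1,2,\ldots$ in order of birth, with birth times $\tau_1\le\tau_2\le\cdots$. The associated tree has a directed edge from each individual other than the first to its parent. $\boldsymbol{\xi}^{\mathbf{1}_{\mathbb{R}^+}}_t$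 denotes the number of individuals born up to time $t$, and $\Theta$ is the almost sure limit $\Theta=\lim_{t\to\infty}\mu\alpha^*e^{-\alpha^*t}\boldsymbol{\xi}^{\mathbf{1}_{\mathbb{R}^+}}_t$, given by classical theory. Collapsed branching process: write $(n,j)=m(n-1)+j$ for $n\ge1$, $j=1,\ldots,m$. $\mathrm{CBP}^{(m)}_t$ is the directed multigraph whose vertex $n$ is obtained by merging individuals $(n,1),\ldots,(n,m)$; vertex $n$ is present at time $t$ when $\tau_{(n,1)}\le t$; the number of directed edges from vertex $x$ to vertex $y$ is the number of $j\in\{1,\dots,m\}$ such that $\tau_{(x,j)}\le t$ and the parent of individual $(x,j)$ is one of $(y,1),\ldots,(y,m)$. The (in-)degree of vertex $n$ at time $t$ is $D^{(\mathrm{in})}_n(t)=\sum_{j=1}^m\xi^{(n,j)}_{t-\tau_{(n,j)}}$. Preferential attachment model with out-degree $m$ and affine attachment function $f(k)=k+\delta$: it is defined from the tree case (out-degree $1$). In the tree, nodes $1,2,3,\ldots$ arrive one at a time, and each new node attaches by a directed edge to an already present node $x$ with conditional probability proportional to (current in-degree of $x$)$+1+\delta/m$. The model with out-degree $m$ is obtained by merging tree nodes $(n,1),\ldots,(n,m)$ into vertex $n$, for every $n$. Thus, when the $(j+1)$-st edge of vertex $n$ is added ($0\le j\le m-1$), it attaches to a vertex $i<n$ with conditional probability proportional to $D_i+\delta$ and to $n$ itself with conditional probability proportional to $D_n+j\delta/m$, where $D_i$ is the current in-degree of $i$ plus the number of tree nodes of $i$ already present; in particular the first edge of a vertex is never a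 self-loop. *)

theory Defs
  imports "HOL-Probability.Probability"
begin

section \<open>Birth processes\<close>

text \<open>
  A realisation of a birth process is the sequence of its points, so a birth process on a
  probability space \<open>N\<close> is a map \<open>\<xi>\<close> sending an outcome to a sequence of reals.  Points are listed
  with multiplicity; the encoding covers processes with infinitely many points, as embedding birth
  processes are.  \<open>points_upto s t\<close> is \<open>\<xi>\<^sub>t = \<xi>([0,t])\<close>; it is \<open>0\<close> for negative \<open>t\<close>, and also (by the
  convention for \<open>card\<close>) in case of explosion, which almost surely does not occur below.
\<close>

definition points_upto :: "(nat \<Rightarrow> real) \<Rightarrow> real \<Rightarrow> nat" where
  "points_upto s t = card {k. s k \<in> {0..t}}"

text \<open>\<open>mean_measure N \<xi> A\<close> is the expected number of points in \<open>A\<close>.\<close>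

definition mean_measure :: "'b measure \<Rightarrow> ('b \<Rightarrow> nat \<Rightarrow> real) \<Rightarrow> real measure" where
  "mean_measure N \<xi> = measure_of UNIV (sets borel)
     (\<lambda>A. \<integral>\<^sup>+\<omega>. emeasure (count_space UNIV) {k. \<xi> \<omega> k \<in> A} \<partial>N)"

lemma emeasure_mean_measure:
  assumes [measurable]: "\<xi> \<in> N \<rightarrow>\<^sub>M (\<Pi>\<^sub>M k\<in>UNIV. borel)" and A: "A \<in> sets borel"
  shows "emeasure (mean_measure N \<xi>) A
    = (\<integral>\<^sup>+\<omega>. emeasure (count_space UNIV) {k. \<xi> \<omega> k \<in> A} \<partial>N)"
proof -
  have [measurable]: "(\<lambda>\<omega>. \<xi> \<omega> k) \<in> borel_measurable N" for k
    using measurable_compose[OF assms(1) measurable_component_singleton[of k UNIV "\<lambda>_. borel"]]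
    by simp
  have cnt: "emeasure (count_space UNIV) {k. \<xi> \<omega> k \<in> B}
      = (\<Sum>k. indicator B (\<xi> \<omega> k))" for \<omega> B
  proof -
    have "emeasure (count_space UNIV) {k. \<xi> \<omega> k \<in> B}
        = (\<integral>\<^sup>+k. indicator {k. \<xi> \<omega> k \<in> B} k \<partial>count_space UNIV)"
      by simp
    also have "\<dots> = (\<Sum>k. indicator {k. \<xi> \<omega> k \<in> B} k)"
      by (rule nn_integral_count_space_nat)
    also have "\<dots> = (\<Sum>k. indicator B (\<xi> \<omega> k))"
      by (simp add: indicator_def)
    finally show ?thesis .
  qed
  show ?thesis
    unfolding mean_measure_def
  proof (rule emeasure_measure_of_sigma[OF _ _ _ A])
    show "sigma_algebra UNIV (sets (borel :: real measure))"
      using sets.sigma_algebra_axioms[of "borel :: real measure"] by simp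
    show "positive (sets borel) (\<lambda>A. \<integral>\<^sup>+\<omega>. emeasure (count_space UNIV) {k. \<xi> \<omega> k \<in> A} \<partial>N)"
      by (simp add: positive_def)
    show "countably_additive (sets borel)
        (\<lambda>A. \<integral>\<^sup>+\<omega>. emeasure (count_space UNIV) {k. \<xi> \<omega> k \<in> A} \<partial>N)"
    proof (rule countably_additiveI)
      fix B :: "nat \<Rightarrow> real set"
      assume B: "range B \<subseteq> sets borel" "disjoint_family B"
      then have [measurable]: "B i \<in> sets borel" for i by auto
      have "emeasure (count_space UNIV) {k. \<xi> \<omega> k \<in> (\<Union>i. B i)}
          = (\<Sum>i. emeasure (count_space UNIV) {k. \<xi> \<omega> k \<in> B i})" for \<omega>
      proof -
        have "{k. \<xi> \<omega> k \<in> (\<Union>i. B i)} = (\<Union>i. {k. \<xi> \<omega> k \<in> B i})" by auto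
        moreover have "disjoint_family (\<lambda>i. {k. \<xi> \<omega> k \<in> B i})"
          using B(2) by (auto simp: disjoint_family_on_def)
        ultimately show ?thesis
          by (simp add: suminf_emeasure)
      qed
      moreover have "(\<Sum>i. \<integral>\<^sup>+\<omega>. emeasure (count_space UNIV) {k. \<xi> \<omega> k \<in> B i} \<partial>N)
          = (\<integral>\<^sup>+\<omega>. (\<Sum>i. emeasure (count_space UNIV) {k. \<xi> \<omega> k \<in> B i}) \<partial>N)"
        unfolding cnt by (rule nn_integral_suminf[symmetric]) measurable
      ultimately show "(\<Sum>i. \<integral>\<^sup>+\<omega>. emeasure (count_space UNIV) {k. \<xi> \<omega> k \<in> B i} \<partial>N)
          = (\<integral>\<^sup>+\<omega>. emeasure (count_space UNIV) {k. \<xi> \<omega> k \<in> (\<Union>i. B i)} \<partial>N)"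
        by simp
    qed
  qed
qed

definition is_malthusian_parameter :: "'b measure \<Rightarrow> ('b \<Rightarrow> nat \<Rightarrow> real) \<Rightarrow> real \<Rightarrow> bool" where
  "is_malthusian_parameter N \<xi> \<alpha> \<longleftrightarrow>
     \<alpha> > 0 \<and> (\<integral>\<^sup>+t\<in>{0..}. ennreal (exp (- \<alpha> * t)) \<partial>mean_measure N \<xi>) = 1"

definition supercritical :: "'b measure \<Rightarrow> ('b \<Rightarrow> nat \<Rightarrow> real) \<Rightarrow> bool" where
  "supercritical N \<xi> \<longleftrightarrow> (\<exists>\<alpha>. is_malthusian_parameter N \<xi> \<alpha>)"

text \<open>The parameter is unique when it exists, since the integral is strictly decreasing in \<open>\<alpha>\<close>
  where it is finite and positive, except for a process with all its points at \<open>0\<close>.\<close>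

definition malthusian_parameter :: "'b measure \<Rightarrow> ('b \<Rightarrow> nat \<Rightarrow> real) \<Rightarrow> real" where
  "malthusian_parameter N \<xi> = (THE \<alpha>. is_malthusian_parameter N \<xi> \<alpha>)"

definition malthusian_mu :: "'b measure \<Rightarrow> ('b \<Rightarrow> nat \<Rightarrow> real) \<Rightarrow> ennreal" where
  "malthusian_mu N \<xi> =
     (\<integral>\<^sup>+t\<in>{0..}. ennreal (t * exp (- malthusian_parameter N \<xi> * t)) \<partial>mean_measure N \<xi>)"

definition malthusian :: "'b measure \<Rightarrow> ('b \<Rightarrow> nat \<Rightarrow> real) \<Rightarrow> bool" where
  "malthusian N \<xi> \<longleftrightarrow> supercritical N \<xi> \<and> malthusian_mu N \<xi> < \<infinity>"

definition lipschitz_condition :: "'b measure \<Rightarrow> ('b \<Rightarrow> nat \<Rightarrow> real) \<Rightarrow> bool" where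
  "lipschitz_condition N \<xi> \<longleftrightarrow>
     (\<forall>k. \<exists>L>0. L-lipschitz_on {0..} (\<lambda>t. \<P>(\<omega> in N. points_upto (\<xi> \<omega>) t = k)))"

text \<open>The points are the jump times \<open>E\<^sub>0 + \<dots> + E\<^sub>k\<close>; the lemma after the definition is the description
  of \<open>\<xi>\<^sub>t\<close> by the intervals between them.\<close>

definition embedding_birth_process ::
    "'b measure \<Rightarrow> (nat \<Rightarrow> real) \<Rightarrow> ('b \<Rightarrow> nat \<Rightarrow> real) \<Rightarrow> bool" where
  "embedding_birth_process N lam \<xi> \<longleftrightarrow>
     (\<exists>E :: nat \<Rightarrow> 'b \<Rightarrow> real.
        prob_space.indep_vars N (\<lambda>_. borel) E UNIV \<and>
        (\<forall>k. distributed N lborel (E k) (exponential_density (lam k))) \<and>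
        (\<forall>\<omega>\<in>space N. \<forall>k. \<xi> \<omega> k = (\<Sum>i\<le>k. E i \<omega>)))"

lemma points_upto_partial_sums:
  fixes e :: "nat \<Rightarrow> real"
  assumes pos: "\<And>i. 0 \<le> e i" and t: "t \<in> {(\<Sum>i<k. e i)..<(\<Sum>i<Suc k. e i)}"
  shows "points_upto (\<lambda>k. \<Sum>i\<le>k. e i) t = k"
proof -
  have mono: "(\<Sum>i<a. e i) \<le> (\<Sum>i<b. e i)" if "a \<le> b" for a b
    using that pos by (intro sum_mono2) auto
  have "{j. (\<Sum>i\<le>j. e i) \<in> {0..t}} = {..<k}"
  proof (intro set_eqI iffI)
    fix j assume "j \<in> {j. (\<Sum>i\<le>j. e i) \<in> {0..t}}"
    then have "(\<Sum>i<Suc j. e i) < (\<Sum>i<Suc k. e i)"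
      using t by (auto simp: lessThan_Suc_atMost)
    then show "j \<in> {..<k}"
      using mono[of "Suc k" "Suc j"] by force
  next
    fix j assume "j \<in> {..<k}"
    then have "(\<Sum>i<Suc j. e i) \<le> t"
      using mono[of "Suc j" k] t by auto
    then show "j \<in> {j. (\<Sum>i\<le>j. e i) \<in> {0..t}}"
      using pos by (simp add: lessThan_Suc_atMost sum_nonneg)
  qed
  then show ?thesis
    by (simp add: points_upto_def)
qed

section \<open>Continuous-time branching processes\<close>

text \<open>
  The population is indexed by family history: \<open>[]\<close> is the first individual and \<open>k # u\<close> is the child
  of \<open>u\<close> corresponding to the \<open>k\<close>-th point of the process of \<open>u\<close> (most recent generation at the head,
  so \<open>tl\<close> is the parent).  The branching process of \<open>\<xi>\<close> is carried by a family \<open>X\<close> of independent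
  copies of \<open>\<xi>\<close>, one for every potential individual.
\<close>

definition iid_copies ::
    "'a measure \<Rightarrow> (nat list \<Rightarrow> 'a \<Rightarrow> nat \<Rightarrow> real) \<Rightarrow> 'b measure \<Rightarrow> ('b \<Rightarrow> nat \<Rightarrow> real) \<Rightarrow> bool" where
  "iid_copies M X N \<xi> \<longleftrightarrow>
     prob_space.indep_vars M (\<lambda>_. \<Pi>\<^sub>M k\<in>UNIV. borel) X UNIV \<and>
     (\<forall>u. distr M (\<Pi>\<^sub>M k\<in>UNIV. borel) (X u) = distr N (\<Pi>\<^sub>M k\<in>UNIV. borel) \<xi>)"

text \<open>In the following definitions \<open>x\<close> is one realisation of the family \<open>X\<close>.\<close>

fun birth_time :: "(nat list \<Rightarrow> nat \<Rightarrow> real) \<Rightarrow> nat list \<Rightarrow> real" where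
  "birth_time x [] = 0"
| "birth_time x (k # u) = birth_time x u + x u k"

definition population :: "(nat list \<Rightarrow> nat \<Rightarrow> real) \<Rightarrow> real \<Rightarrow> nat" where
  "population x t = card {u. birth_time x u \<le> t}"

text \<open>
  Numbering in order of birth, from 1.  Almost surely the birth times are distinct and finitely many
  lie in any bounded interval; then \<open>birth_rank\<close> is a bijection onto the positive integers and
  \<open>individual\<close> is its inverse.
\<close>

definition birth_rank :: "(nat list \<Rightarrow> nat \<Rightarrow> real) \<Rightarrow> nat list \<Rightarrow> nat" where
  "birth_rank x u = card {v. birth_time x v \<le> birth_time x u}"

definition individual :: "(nat list \<Rightarrow> nat \<Rightarrow> real) \<Rightarrow> nat \<Rightarrow> nat list" where
  "individual x i = (THE u. birth_rank x u = i)"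

definition tau :: "(nat list \<Rightarrow> nat \<Rightarrow> real) \<Rightarrow> nat \<Rightarrow> real" where
  "tau x i = birth_time x (individual x i)"

definition ctbp_parent :: "(nat list \<Rightarrow> nat \<Rightarrow> real) \<Rightarrow> nat \<Rightarrow> nat option" where
  "ctbp_parent x i =
     (if individual x i = [] then None else Some (birth_rank x (tl (individual x i))))"

section \<open>Collapsing trees to multigraphs\<close>

datatype multigraph = Multigraph (vertices: "nat set") (edge_count: "nat \<Rightarrow> nat \<Rightarrow> nat")

text \<open>The \<open>\<sigma>\<close>-algebra generated by the vertex set and the numbers of edges; on finite multigraphs it
  separates points, so it determines their laws.\<close>

definition multigraph_space :: "multigraph measure" where
  "multigraph_space = sigma UNIV
     ({{G. n \<in> vertices G} |n. True} \<union> {{G. edge_count G a b = k} |a b k. True})"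

definition node :: "nat \<Rightarrow> nat \<Rightarrow> nat \<Rightarrow> nat" where
  "node m n j = m * (n - 1) + j"

text \<open>Merge the nodes \<open>(n,1), \<dots>, (n,m)\<close> of the tree given by \<open>par\<close>, restricted to the nodes that are
  present.\<close>

definition collapse :: "nat \<Rightarrow> (nat \<Rightarrow> bool) \<Rightarrow> (nat \<Rightarrow> nat option) \<Rightarrow> multigraph" where
  "collapse m present par = Multigraph
     {n. n \<ge> 1 \<and> present (node m n 1)}
     (\<lambda>a b. if a \<ge> 1 \<and> b \<ge> 1
        then card {j\<in>{1..m}. present (node m a j) \<and> (\<exists>i\<in>{1..m}. par (node m a j) = Some (node m b i))}
        else 0)"

definition CBP :: "nat \<Rightarrow> (nat list \<Rightarrow> nat \<Rightarrow> real) \<Rightarrow> real \<Rightarrow> multigraph" where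
  "CBP m x t = collapse m (\<lambda>i. tau x i \<le> t) (ctbp_parent x)"

definition CBP_degree :: "nat \<Rightarrow> (nat list \<Rightarrow> nat \<Rightarrow> real) \<Rightarrow> nat \<Rightarrow> real \<Rightarrow> nat" where
  "CBP_degree m x n t =
     (\<Sum>j=1..m. points_upto (x (individual x (node m n j))) (t - tau x (node m n j)))"

definition num_vertices :: "nat \<Rightarrow> (nat list \<Rightarrow> nat \<Rightarrow> real) \<Rightarrow> real \<Rightarrow> nat" where
  "num_vertices m x t = card (vertices (CBP m x t))"

definition num_vertices_deg :: "nat \<Rightarrow> (nat list \<Rightarrow> nat \<Rightarrow> real) \<Rightarrow> nat \<Rightarrow> real \<Rightarrow> nat" where
  "num_vertices_deg m x k t = card {n \<in> vertices (CBP m x t). CBP_degree m x n t = k}"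

section \<open>Preferential attachment\<close>

text \<open>
  The preferential attachment tree is a random sequence \<open>(p i)\<^sub>i\<^sub>\<ge>\<^sub>2\<close>, node \<open>i\<close> being attached to \<open>p i\<close>.
  \<open>pa_weight m \<delta> n h y\<close> is the weight of node \<open>y\<close> in the tree on \<open>1, \<dots>, n\<close> given by \<open>h\<close>.  The predicate
  \<open>pa_tree_law\<close> determines \<open>P\<close> uniquely.
\<close>

definition pa_weight :: "nat \<Rightarrow> real \<Rightarrow> nat \<Rightarrow> (nat \<Rightarrow> nat) \<Rightarrow> nat \<Rightarrow> real" where
  "pa_weight m \<delta> n h y = real (card {i\<in>{2..n}. h i = y}) + 1 + \<delta> / real m"

definition pa_tree_law :: "nat \<Rightarrow> real \<Rightarrow> (nat \<Rightarrow> nat) measure \<Rightarrow> bool" where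
  "pa_tree_law m \<delta> P \<longleftrightarrow>
     prob_space P \<and> sets P = sets (\<Pi>\<^sub>M i\<in>{2..}. count_space UNIV) \<and>
     (\<forall>n\<ge>1. \<forall>h. \<P>(p in P. \<forall>i\<in>{2..n}. p i = h i) > 0 \<longrightarrow>
        (\<forall>y\<in>{1..n}. \<P>(p in P. p (Suc n) = y \<bar> \<forall>i\<in>{2..n}. p i = h i)
           = pa_weight m \<delta> n h y / (\<Sum>z=1..n. pa_weight m \<delta> n h z)))"

text \<open>The model with out-degree \<open>m\<close> after the arrival of \<open>i\<close> tree nodes.\<close>

definition PA :: "nat \<Rightarrow> (nat \<Rightarrow> nat) \<Rightarrow> nat \<Rightarrow> multigraph" where
  "PA m p i = collapse m (\<lambda>l. l \<le> i) (\<lambda>l. if l \<ge> 2 then Some (p l) else None)"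

definition steps :: "nat \<Rightarrow> (nat \<times> nat) set" where
  "steps m = {1..} \<times> {1..m}"

definition CBP_sequence :: "nat \<Rightarrow> (nat list \<Rightarrow> nat \<Rightarrow> real) \<Rightarrow> nat \<times> nat \<Rightarrow> multigraph" where
  "CBP_sequence m x = (\<lambda>(n, j)\<in>steps m. CBP m x (tau x (node m n j)))"

definition PA_sequence :: "nat \<Rightarrow> (nat \<Rightarrow> nat) \<Rightarrow> nat \<times> nat \<Rightarrow> multigraph" where
  "PA_sequence m p = (\<lambda>(n, j)\<in>steps m. PA m p (node m n j))"

definition has_PA_law :: "nat \<Rightarrow> real \<Rightarrow> 'a measure \<Rightarrow> ('a \<Rightarrow> nat \<times> nat \<Rightarrow> multigraph) \<Rightarrow> bool" where
  "has_PA_law m \<delta> M G \<longleftrightarrow>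
     G \<in> M \<rightarrow>\<^sub>M (\<Pi>\<^sub>M s\<in>steps m. multigraph_space) \<and>
     (\<exists>P. pa_tree_law m \<delta> P \<and>
        distr M (\<Pi>\<^sub>M s\<in>steps m. multigraph_space) G
          = distr P (\<Pi>\<^sub>M s\<in>steps m. multigraph_space) (PA_sequence m))"

section \<open>Limits\<close>

text \<open>Measurability is part of the definition because \<open>measure\<close> is \<open>0\<close> on non-measurable sets.\<close>

definition tendsto_in_probability ::
    "'a measure \<Rightarrow> ('i \<Rightarrow> 'a \<Rightarrow> real) \<Rightarrow> ('a \<Rightarrow> real) \<Rightarrow> 'i filter \<Rightarrow> bool" where
  "tendsto_in_probability M Y Z F \<longleftrightarrow>
     (\<forall>t. Y t \<in> borel_measurable M) \<and> Z \<in> borel_measurable M \<and>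
     (\<forall>\<epsilon>>0. ((\<lambda>t. \<P>(\<omega> in M. \<bar>Y t \<omega> - Z \<omega>\<bar> > \<epsilon>)) \<longlongrightarrow> 0) F)"

end

theory Submission
  imports Defs "HOL-Real_Asymp.Real_Asymp"
begin

text \<open>
  Every individual has one running clock, for its next child, and by memorylessness the residual clocks
  are, whenever one of them rings, again independent exponentials, independent of the past.  So the
  probability that the first births are given ones and the gaps between them lie in given sets is a
  product: the parents form the preferential attachment tree, and the gap after the \<open>n\<close>-th birth is
  exponential with rate \<open>n \<alpha> - 1\<close>, where \<open>\<alpha> = 2 + \<delta>/m\<close>, independently of the tree and of the other gaps.

  The sum of the centred gaps has summable variances, hence converges almost surely along the cubes;
  as birth times are monotone, \<open>\<tau>\<^sub>n - ln n / \<alpha>\<close> converges, which gives the limit \<open>\<Theta>\<close>.  In the tree, a vertex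
  of degree \<open>k\<close> attracts the next edge with probability \<open>(k + m + \<delta>) / (n \<alpha> - 1)\<close>, up to an error of order
  \<open>1 / n\<close> for the single incomplete vertex.  Hence the second moment of the deviation of the number of
  vertices of degree \<open>k\<close> from \<open>p\<^sub>k n / m\<close> is \<open>O(n)\<close>, so the fractions converge almost surely along the
  cubes, and along all \<open>n\<close> because one birth changes the counts by a bounded amount.  All limits in
  probability thus hold almost surely.
\<close>

section \<open>Competing exponential clocks\<close>

text \<open>An individual with \<open>k\<close> children rings at rate \<open>k + a\<close>,
  \<open>a = 1 + \<delta>/m\<close>, and \<open>n\<close> individuals have \<open>n - 1\<close>
  children in all, so the total rate \<open>n a + n - 1 = n (1 + a) - 1\<close> depends on the
  number of births only. This makes gaps and tree independent. The obstacle is the numbering: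
  \<open>individual\<close> and \<open>tau\<close> mean what they should only if births are distinct
  and do not accumulate. So laws are computed first for histories, finite lists described by races
  between finitely many clocks; non-explosion comes out of the asymptotics of the birth times, and
  only then are the numbered objects identified with histories. Cubes are dense enough for
  interpolation, consecutive ones having ratio tending to 1, and sparse enough for sums: the block
  of gaps after the \<open>j\<close>-th cube has variance of order \<open>j^-4\<close>, which
  survives a weight \<open>j^2\<close>, and the squared error of a degree fraction has mean of order
  \<open>j^-3\<close>. The second moments stay linear because the drift pulls each error back
  towards zero and feeds it only from the next lower degree, so that induction on the degree
  works.\<close>

abbreviation expo :: "real \<Rightarrow> real measure" where
  "expo r \<equiv> density lborel (\<lambda>x. ennreal (exponential_density r x))"

lemma nn_integral_expo:
  assumes [measurable]: "f \<in> borel_measurable borel"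
  shows "(\<integral>\<^sup>+x. f x \<partial>expo r) = (\<integral>\<^sup>+x. ennreal (exponential_density r x) * f x \<partial>lborel)"
  by (subst nn_integral_density) auto

lemma AE_expo_pos: "AE y in expo r. 0 < y"
proof -
  have "AE y in lborel. y \<noteq> (0::real)" by (rule AE_lborel_singleton)
  then show ?thesis
    by (subst AE_density) (auto simp: exponential_density_def elim!: eventually_mono)
qed

text \<open>Shifting the variable by \<open>s\<close> turns the density at \<open>s + y\<close> into
  \<open>exp (- r * s)\<close> times the density at \<open>y\<close>; the indicator removes exactly
  what the shift moves below zero.\<close>

lemma expo_memoryless:
  fixes f :: "real \<Rightarrow> ennreal"
  assumes [measurable]: "f \<in> borel_measurable borel" and s: "0 \<le> s" and r: "0 < r"
  shows "(\<integral>\<^sup>+y. (if s < y then f (y - s) else 0) \<partial>expo r) = ennreal (exp (- r * s)) * (\<integral>\<^sup>+y. f y \<partial>expo r)"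
proof -
  have "(\<integral>\<^sup>+y. (if s < y then f (y - s) else 0) \<partial>expo r)
      = (\<integral>\<^sup>+y. ennreal (exponential_density r y) * (if s < y then f (y - s) else 0) \<partial>lborel)"
    by (rule nn_integral_expo) measurable
  also have "\<dots> = (\<integral>\<^sup>+y. ennreal (exponential_density r (s + 1 * y)) * (if s < s + 1 * y then f (s + 1 * y - s) else 0) \<partial>lborel)"
    using nn_integral_real_affine[of "\<lambda>y. ennreal (exponential_density r y) * (if s < y then f (y - s) else 0)" 1 s]
    by (simp only: assms abs_one ennreal_1 mult_1) measurable
  also have "\<dots> = (\<integral>\<^sup>+y. ennreal (exp (- r * s)) * (ennreal (exponential_density r y) * f y) \<partial>lborel)"
  proof (rule nn_integral_cong_AE)
    \<comment> \<open>At \<open>y = 0\<close> the strict inequality fails although the density there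
      is \<open>r\<close>, so the integrands agree only almost everywhere.\<close>
    have "AE y in lborel. y \<noteq> (0::real)" by (rule AE_lborel_singleton)
    then show "AE y in lborel. ennreal (exponential_density r (s + 1 * y)) * (if s < s + 1 * y then f (s + 1 * y - s) else 0)
        = ennreal (exp (- r * s)) * (ennreal (exponential_density r y) * f y)"
    proof eventually_elim
      case (elim y)
      show ?case
      proof (cases "0 < y")
        case True
        then have "exponential_density r (s + y) = exp (- r * s) * exponential_density r y"
          using s by (simp add: exponential_density_def algebra_simps exp_add[symmetric])
        then show ?thesis
          using True r by (simp add: ennreal_mult mult.assoc exponential_density_def)
      next
        case False
        with elim have "y < 0" by simp
        then show ?thesis by (simp add: exponential_density_def)
      qed
    qed
  qed
  also have "\<dots> = ennreal (exp (- r * s)) * (\<integral>\<^sup>+y. f y \<partial>expo r)"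
    by (subst nn_integral_cmult) (auto simp: nn_integral_expo)
  finally show ?thesis .
qed

text \<open>\<open>I\<close> will be an infinite set of potential individuals, so one coordinate has
  to be split off an infinite product. The first order of integration serves the race, where the
  winning time is fixed first; the second serves ageing, where one clock is integrated with the
  others fixed.\<close>

lemma nn_integral_PiM_split:
  assumes "v \<in> I" and p: "\<And>i. prob_space (Q i)" and [measurable]: "H \<in> borel_measurable (PiM I Q)"
  shows "(\<integral>\<^sup>+r. H r \<partial>PiM I Q) = (\<integral>\<^sup>+s. (\<integral>\<^sup>+r. H (r(v := s)) \<partial>PiM (I - {v}) Q) \<partial>Q v)"
    and "(\<integral>\<^sup>+r. H r \<partial>PiM I Q) = (\<integral>\<^sup>+r. (\<integral>\<^sup>+s. H (r(v := s)) \<partial>Q v) \<partial>PiM (I - {v}) Q)"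
proof -
  have I: "insert v (I - {v}) = I" using assms by auto
  interpret v: prob_space "Q v" by (rule p)
  interpret PJ: prob_space "PiM (I - {v}) Q" by (intro prob_space_PiM p)
  interpret pair_sigma_finite "Q v" "PiM (I - {v}) Q" ..
  have m[measurable]: "(\<lambda>(x, X). X(v := x)) \<in> Q v \<Otimes>\<^sub>M PiM (I - {v}) Q \<rightarrow>\<^sub>M PiM I Q"
    using measurable_fun_upd[of I "I - {v}" v "\<lambda>z. snd z" "Q v \<Otimes>\<^sub>M PiM (I - {v}) Q" Q "\<lambda>z. fst z"] I
    by (simp add: case_prod_beta Un_commute)
  have eq: "PiM I Q = distr (Q v \<Otimes>\<^sub>M PiM (I - {v}) Q) (PiM I Q) (\<lambda>(x, X). X(v := x))"
    using distr_pair_PiM_eq_PiM[of "I - {v}" Q v] p I by simp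
  define K where "K z = H ((snd z)(v := fst z))" for z
  have K[measurable]: "K \<in> borel_measurable (Q v \<Otimes>\<^sub>M PiM (I - {v}) Q)"
    using measurable_compose[OF m assms(3)] by (simp add: K_def[abs_def] case_prod_beta)
  have "(\<integral>\<^sup>+r. H r \<partial>PiM I Q) = (\<integral>\<^sup>+z. K z \<partial>(Q v \<Otimes>\<^sub>M PiM (I - {v}) Q))"
    by (subst eq, subst nn_integral_distr) (auto simp: case_prod_beta K_def[abs_def])
  also have "\<dots> = (\<integral>\<^sup>+s. (\<integral>\<^sup>+r. K (s, r) \<partial>PiM (I - {v}) Q) \<partial>Q v)"
    using PJ.nn_integral_fst[OF K] by simp
  finally have 1: "(\<integral>\<^sup>+r. H r \<partial>PiM I Q) = (\<integral>\<^sup>+s. (\<integral>\<^sup>+r. K (s, r) \<partial>PiM (I - {v}) Q) \<partial>Q v)" .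
  then show "(\<integral>\<^sup>+r. H r \<partial>PiM I Q) = (\<integral>\<^sup>+s. (\<integral>\<^sup>+r. H (r(v := s)) \<partial>PiM (I - {v}) Q) \<partial>Q v)"
    by (simp add: K_def)
  show "(\<integral>\<^sup>+r. H r \<partial>PiM I Q) = (\<integral>\<^sup>+r. (\<integral>\<^sup>+s. H (r(v := s)) \<partial>Q v) \<partial>PiM (I - {v}) Q)"
    using Fubini[OF K] 1 by (simp add: K_def)
qed

text \<open>The clocks in \<open>D\<close> have been running for time \<open>s\<close>; those in
  \<open>J - D\<close> have not been started. The restriction keeps the result in the space of the
  product over \<open>J\<close>.\<close>

definition age :: "'i set \<Rightarrow> 'i set \<Rightarrow> real \<Rightarrow> ('i \<Rightarrow> real) \<Rightarrow> 'i \<Rightarrow> real" where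
  "age J D s r = (\<lambda>w\<in>J. if w \<in> D then r w - s else r w)"

lemma measurable_age[measurable]:
  "(\<lambda>r. age J D s r) \<in> PiM J (\<lambda>i. expo (q i)) \<rightarrow>\<^sub>M PiM J (\<lambda>i. expo (q i))"
proof -
  have "(\<lambda>r. r i) \<in> PiM J (\<lambda>i. expo (q i)) \<rightarrow>\<^sub>M borel" if "i \<in> J" for i
    using measurable_component_singleton[OF that, of "\<lambda>i. expo (q i)"] by simp
  then show ?thesis
    unfolding age_def by (intro measurable_restrict) auto
qed

text \<open>The clocks age one at a time: each application of \<open>expo_memoryless\<close> to a
  single coordinate contributes its factor, and the exponents add up.\<close>

lemma PiM_expo_memoryless:
  fixes H :: "('i \<Rightarrow> real) \<Rightarrow> ennreal"
  assumes "finite D" "D \<subseteq> J" and q: "\<And>i. 0 < q i" and s: "0 \<le> s"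
    and "H \<in> borel_measurable (PiM J (\<lambda>i. expo (q i)))"
  shows "(\<integral>\<^sup>+r. (if \<forall>w\<in>D. s < r w then H (age J D s r) else 0) \<partial>PiM J (\<lambda>i. expo (q i)))
    = ennreal (exp (- s * (\<Sum>w\<in>D. q w))) * (\<integral>\<^sup>+r. H r \<partial>PiM J (\<lambda>i. expo (q i)))"
  using assms(1,2,5)
proof (induction D arbitrary: H)
  case empty
  then show ?case
    by (auto intro!: nn_integral_cong simp: age_def space_PiM PiE_def extensional_restrict)
next
  case (insert d D)
  note [measurable] = insert.prems(2)
  let ?Q = "\<lambda>i. expo (q i)"
  have pq: "prob_space (?Q i)" for i using prob_space_exponential_density q by simp
  have d: "d \<in> J" using insert by auto
  have md[measurable]: "(\<lambda>r. r d) \<in> PiM J ?Q \<rightarrow>\<^sub>M borel"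
    using measurable_component_singleton[OF d, of ?Q] by simp
  \<comment> \<open>\<open>G\<close> carries the condition and the ageing for the clock
    \<open>d\<close>, so that the induction hypothesis for \<open>D\<close> applies to it in place
    of \<open>H\<close>.\<close>
  define G where "G r = (if s < r d then H (age J {d} s r) else 0)" for r
  have G[measurable]: "G \<in> borel_measurable (PiM J ?Q)"
    unfolding G_def by measurable
  have "(\<integral>\<^sup>+r. (if \<forall>w\<in>insert d D. s < r w then H (age J (insert d D) s r) else 0) \<partial>PiM J ?Q)
      = (\<integral>\<^sup>+r. (if \<forall>w\<in>D. s < r w then G (age J D s r) else 0) \<partial>PiM J ?Q)"
  proof (rule nn_integral_cong)
    fix r
    have "age J {d} s (age J D s r) = age J (insert d D) s r"
      using insert.hyps by (auto simp: age_def fun_eq_iff)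
    moreover have "age J D s r d = r d"
      using insert.hyps d by (simp add: age_def)
    ultimately show "(if \<forall>w\<in>insert d D. s < r w then H (age J (insert d D) s r) else 0)
      = (if \<forall>w\<in>D. s < r w then G (age J D s r) else 0)"
      by (auto simp: G_def)
  qed
  also have "\<dots> = ennreal (exp (- s * (\<Sum>w\<in>D. q w))) * (\<integral>\<^sup>+r. G r \<partial>PiM J ?Q)"
    using insert by (intro insert.IH) auto
  also have "(\<integral>\<^sup>+r. G r \<partial>PiM J ?Q) = (\<integral>\<^sup>+r. (\<integral>\<^sup>+y. G (r(d := y)) \<partial>?Q d) \<partial>PiM (J - {d}) ?Q)"
    by (rule nn_integral_PiM_split[OF d pq G])
  also have "\<dots> = (\<integral>\<^sup>+r. ennreal (exp (- q d * s)) * (\<integral>\<^sup>+y. H (r(d := y)) \<partial>?Q d) \<partial>PiM (J - {d}) ?Q)"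
  proof (rule nn_integral_cong)
    fix r assume r: "r \<in> space (PiM (J - {d}) ?Q)"
    have upd: "(\<lambda>y. r(d := y)) \<in> borel \<rightarrow>\<^sub>M PiM J ?Q"
      using r d by (intro measurable_PiM_single') (auto simp: space_PiM PiE_def Pi_def extensional_def)
    have "(\<lambda>y. H (r(d := y))) \<in> borel_measurable borel"
      using measurable_compose[OF upd insert.prems(2)] .
    then have "(\<integral>\<^sup>+y. (if s < y then H (r(d := y - s)) else 0) \<partial>?Q d)
        = ennreal (exp (- q d * s)) * (\<integral>\<^sup>+y. H (r(d := y)) \<partial>?Q d)"
      using expo_memoryless[of "\<lambda>y. H (r(d := y))" s "q d"] s q by simp
    moreover have "age J {d} s (r(d := y)) = r(d := y - s)" for y
      using r d by (auto simp: age_def fun_eq_iff space_PiM PiE_def extensional_def)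
    ultimately show "(\<integral>\<^sup>+y. G (r(d := y)) \<partial>?Q d)
        = ennreal (exp (- q d * s)) * (\<integral>\<^sup>+y. H (r(d := y)) \<partial>?Q d)"
      by (simp add: G_def cong: if_cong)
  qed
  also have "\<dots> = ennreal (exp (- q d * s)) * (\<integral>\<^sup>+r. (\<integral>\<^sup>+y. H (r(d := y)) \<partial>?Q d) \<partial>PiM (J - {d}) ?Q)"
  proof (rule nn_integral_cmult)
    interpret prob_space "?Q d" by (rule pq)
    have "(\<lambda>(r, y). r(d := y)) \<in> PiM (J - {d}) ?Q \<Otimes>\<^sub>M ?Q d \<rightarrow>\<^sub>M PiM J ?Q"
      using measurable_fun_upd[of J "J - {d}" d "\<lambda>z. fst z" "PiM (J - {d}) ?Q \<Otimes>\<^sub>M ?Q d" ?Q "\<lambda>z. snd z"] d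
      by (simp add: case_prod_beta insert_absorb)
    from measurable_compose[OF this insert.prems(2)]
    show "(\<lambda>r. \<integral>\<^sup>+y. H (r(d := y)) \<partial>?Q d) \<in> borel_measurable (PiM (J - {d}) ?Q)"
      by (intro borel_measurable_nn_integral) (simp add: split_def fun_upd_def)
  qed
  also have "(\<integral>\<^sup>+r. (\<integral>\<^sup>+y. H (r(d := y)) \<partial>?Q d) \<partial>PiM (J - {d}) ?Q) = (\<integral>\<^sup>+r. H r \<partial>PiM J ?Q)"
    by (rule nn_integral_PiM_split[OF d pq insert.prems(2), symmetric])
  also have "ennreal (exp (- s * (\<Sum>w\<in>D. q w))) * (ennreal (exp (- q d * s)) * (\<integral>\<^sup>+r. H r \<partial>PiM J ?Q))
      = ennreal (exp (- s * (\<Sum>w\<in>insert d D. q w))) * (\<integral>\<^sup>+r. H r \<partial>PiM J ?Q)"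
    using insert.hyps
    by (simp add: mult.assoc[symmetric] ennreal_mult[symmetric] exp_add[symmetric] algebra_simps)
  finally show ?case .
qed

text \<open>Stated apart because the induction over histories uses the measurability of this
  integrand as well.\<close>

lemma measurable_first_clock:
  fixes H :: "('i \<Rightarrow> real) \<Rightarrow> ennreal" and g :: "real \<Rightarrow> ennreal"
  assumes C: "finite C" "C \<subseteq> I" and v: "v \<in> I"
    and [measurable]: "g \<in> borel_measurable borel"
    and H[measurable]: "H \<in> borel_measurable (PiM (I - {v}) (\<lambda>i. expo (q i)))"
  shows "(\<lambda>r. if \<forall>w\<in>C - {v}. r v < r w then g (r v) * H (age (I - {v}) C (r v) r) else 0)
    \<in> borel_measurable (PiM I (\<lambda>i. expo (q i)))"
proof -
  let ?Q = "\<lambda>i. expo (q i)"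
  let ?J = "I - {v}"
  let ?D = "C - {v}"
  have co[measurable]: "(\<lambda>r. r i) \<in> PiM I ?Q \<rightarrow>\<^sub>M borel" if "i \<in> I" for i
    using measurable_component_singleton[OF that, of ?Q] by simp
  have age: "(\<lambda>r. age ?J C (r v) r) \<in> PiM I ?Q \<rightarrow>\<^sub>M PiM ?J ?Q"
    unfolding age_def
  proof (intro measurable_restrict)
    fix i assume "i \<in> ?J"
    then have [measurable]: "(\<lambda>r. r i) \<in> PiM I ?Q \<rightarrow>\<^sub>M borel" using co by auto
    note [measurable] = co[OF v]
    show "(\<lambda>x. if i \<in> C then x i - x v else x i) \<in> PiM I ?Q \<rightarrow>\<^sub>M ?Q i"
      by (cases "i \<in> C") auto
  qed
    note [measurable] = co[OF v] measurable_compose[OF age H]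
    have [measurable]: "Measurable.pred (PiM I ?Q) (\<lambda>r. \<forall>w\<in>?D. r v < r w)"
    proof (intro pred_intros_finite)
      fix w assume "w \<in> ?D"
      then have [measurable]: "(\<lambda>r. r w) \<in> PiM I ?Q \<rightarrow>\<^sub>M borel" using C co by auto
      show "Measurable.pred (PiM I ?Q) (\<lambda>r. r v < r w)" by measurable
    qed (use C in auto)
    show ?thesis by measurable
qed

text \<open>Given that \<open>v\<close> rings at time \<open>s\<close>, the rivals outlast
  \<open>s\<close> with probability \<open>exp (- s * (\<Sum>w\<in>C - {v}. q w))\<close> and are
  memoryless afterwards. Multiplied with the density of \<open>v\<close> this is
  \<open>q v / L\<close> times the density of an exponential of rate \<open>L\<close>, the sum of
  the rates over \<open>C\<close>: winner, winning time and remaining clocks are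
  independent.\<close>

lemma PiM_expo_first_clock:
  fixes H :: "('i \<Rightarrow> real) \<Rightarrow> ennreal" and g :: "real \<Rightarrow> ennreal"
  assumes C: "finite C" "C \<subseteq> I" "v \<in> C" and q: "\<And>i. 0 < q i"
    and [measurable]: "g \<in> borel_measurable borel"
    and H[measurable]: "H \<in> borel_measurable (PiM (I - {v}) (\<lambda>i. expo (q i)))"
  shows "(\<integral>\<^sup>+r. (if \<forall>w\<in>C - {v}. r v < r w then g (r v) * H (age (I - {v}) C (r v) r) else 0)
            \<partial>PiM I (\<lambda>i. expo (q i)))
    = ennreal (q v / (\<Sum>w\<in>C. q w)) * (\<integral>\<^sup>+s. g s \<partial>expo (\<Sum>w\<in>C. q w))
        * (\<integral>\<^sup>+r. H r \<partial>PiM (I - {v}) (\<lambda>i. expo (q i)))"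
proof -
  let ?Q = "\<lambda>i. expo (q i)"
  let ?J = "I - {v}"
  let ?D = "C - {v}"
  let ?h = "\<integral>\<^sup>+r. H r \<partial>PiM ?J ?Q"
  let ?L = "\<Sum>w\<in>C. q w"
  have L: "?L = q v + (\<Sum>w\<in>?D. q w)"
    using C by (simp add: sum.remove)
  have Lpos: "0 < ?L" unfolding L using q by (simp add: add_pos_nonneg sum_nonneg less_imp_le)
  have pq: "prob_space (?Q i)" for i using prob_space_exponential_density q by simp
  have v: "v \<in> I" using C by auto
  note m = measurable_first_clock[OF C(1,2) v assms(5) H]
  have "(\<integral>\<^sup>+r. (if \<forall>w\<in>?D. r v < r w then g (r v) * H (age ?J C (r v) r) else 0) \<partial>PiM I ?Q)
      = (\<integral>\<^sup>+s. (\<integral>\<^sup>+r. g s * (if \<forall>w\<in>?D. s < r w then H (age ?J ?D s r) else 0) \<partial>PiM ?J ?Q) \<partial>?Q v)"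
  proof (subst nn_integral_PiM_split(1)[OF v pq m], intro nn_integral_cong)
    fix s r
    have "age ?J C s (r(v := s)) = age ?J ?D s r"
      by (auto simp: age_def fun_eq_iff)
    then show "(if \<forall>w\<in>?D. (r(v := s)) v < (r(v := s)) w
          then g ((r(v := s)) v) * H (age ?J C ((r(v := s)) v) (r(v := s))) else 0)
        = g s * (if \<forall>w\<in>?D. s < r w then H (age ?J ?D s r) else 0)"
      by auto
  qed
  also have "\<dots> = (\<integral>\<^sup>+s. ennreal (exponential_density (q v) s) * (g s * (ennreal (exp (- s * (\<Sum>w\<in>?D. q w))) * ?h)) \<partial>lborel)"
  proof -
    have "(\<integral>\<^sup>+r. g s * (if \<forall>w\<in>?D. s < r w then H (age ?J ?D s r) else 0) \<partial>PiM ?J ?Q)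
        = g s * (ennreal (exp (- s * (\<Sum>w\<in>?D. q w))) * ?h)" if "0 \<le> s" for s
    proof (subst nn_integral_cmult)
      have [measurable]: "Measurable.pred (PiM ?J ?Q) (\<lambda>r. \<forall>w\<in>?D. s < r w)"
      proof (intro pred_intros_finite)
        fix w assume "w \<in> ?D"
        then have "(\<lambda>r. r w) \<in> PiM ?J ?Q \<rightarrow>\<^sub>M borel"
          using C measurable_component_singleton[of w ?J ?Q] by auto
        then show "Measurable.pred (PiM ?J ?Q) (\<lambda>r. s < r w)" by measurable
      qed (use C in auto)
      show "(\<lambda>r. if \<forall>w\<in>?D. s < r w then H (age ?J ?D s r) else 0) \<in> borel_measurable (PiM ?J ?Q)"
        by measurable
      show "g s * (\<integral>\<^sup>+r. (if \<forall>w\<in>?D. s < r w then H (age ?J ?D s r) else 0) \<partial>PiM ?J ?Q)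
          = g s * (ennreal (exp (- s * (\<Sum>w\<in>?D. q w))) * ?h)"
        using C q that H by (subst PiM_expo_memoryless) auto
    qed
    \<comment> \<open>Memorylessness was shown for nonnegative \<open>s\<close>; under the
      exponential law of the winner this holds almost surely.\<close>
    then have "AE s in ?Q v. (\<integral>\<^sup>+r. g s * (if \<forall>w\<in>?D. s < r w then H (age ?J ?D s r) else 0) \<partial>PiM ?J ?Q)
        = g s * (ennreal (exp (- s * (\<Sum>w\<in>?D. q w))) * ?h)"
      by (subst AE_density) (auto simp: exponential_density_def not_less split: if_splits)
    from nn_integral_cong_AE[OF this] show ?thesis
      by (simp add: nn_integral_expo)
  qed
  also have "\<dots> = (\<integral>\<^sup>+s. (ennreal (q v / ?L) * ?h) * (ennreal (exponential_density ?L s) * g s) \<partial>lborel)"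
  proof (rule nn_integral_cong)
    fix s
    have "exp (- s * q v) * exp (- s * (\<Sum>w\<in>?D. q w)) = exp (- s * ?L)"
      by (simp add: L exp_add[symmetric] algebra_simps)
    then have "exponential_density (q v) s * exp (- s * (\<Sum>w\<in>?D. q w)) = q v / ?L * exponential_density ?L s"
      using Lpos by (simp add: exponential_density_def mult.assoc)
    then have "ennreal (exponential_density (q v) s) * ennreal (exp (- s * (\<Sum>w\<in>?D. q w)))
        = ennreal (q v / ?L) * ennreal (exponential_density ?L s)"
      using q[of v] Lpos by (simp add: ennreal_mult[symmetric] exponential_density_nonneg)
    then have "(ennreal (exponential_density (q v) s) * ennreal (exp (- s * (\<Sum>w\<in>?D. q w)))) * (g s * ?h)
        = (ennreal (q v / ?L) * ennreal (exponential_density ?L s)) * (g s * ?h)"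
      by simp
    then show "ennreal (exponential_density (q v) s) * (g s * (ennreal (exp (- s * (\<Sum>w\<in>?D. q w))) * ?h))
        = (ennreal (q v / ?L) * ?h) * (ennreal (exponential_density ?L s) * g s)"
      by (simp only: mult_ac)
  qed
  also have "\<dots> = (ennreal (q v / ?L) * ?h) * (\<integral>\<^sup>+s. g s \<partial>expo ?L)"
    by (subst nn_integral_cmult) (auto simp: nn_integral_expo)
  finally show ?thesis by (simp add: mult_ac)
qed

section \<open>Birth histories\<close>

text \<open>
  A history lists the individuals born so far, newest first and without the root \<open>[]\<close>.  Everyone alive
  has exactly one candidate, the next child to be born to it.  A clock belongs to the individual at
  whose birth it rings: the waiting time since the birth of the elder sibling or, for a first child,
  of the parent.
\<close>

fun candidates :: "nat list list \<Rightarrow> nat list set" where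
  "candidates [] = {[0]}"
| "candidates (v # vs) = (candidates vs - {v}) \<union> {0 # v, Suc (hd v) # tl v}"

fun history :: "nat list list \<Rightarrow> bool" where
  "history [] \<longleftrightarrow> True"
| "history (v # vs) \<longleftrightarrow> history vs \<and> v \<in> candidates vs"

abbreviation alive :: "nat list list \<Rightarrow> nat list set" where
  "alive vs \<equiv> insert [] (set vs)"

lemma finite_candidates[simp]: "finite (candidates vs)"
  by (induction vs) auto

lemma candidates_nonempty: "w \<in> candidates vs \<Longrightarrow> w \<noteq> []"
  by (induction vs) auto

text \<open>The second clause says that siblings are born without gaps, so the head of a candidate
  is the number of children its parent has already. Its induction step uses the first clause, to see
  that the newborn has no children yet, and the step of the first clause uses the second; hence one
  joint induction.\<close>

lemma history_structure_aux:
  "history vs \<Longrightarrow> (\<forall>w\<in>set vs. w \<noteq> [] \<and> tl w \<in> alive vs) \<and>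
    (\<forall>k u j. k # u \<in> candidates vs \<longrightarrow> u \<in> alive vs \<and> (j # u \<in> set vs \<longleftrightarrow> j < k)) \<and>
    alive vs \<subseteq> tl ` candidates vs"
proof (induction vs)
  case Nil
  then show ?case by simp
next
  case (Cons v vs)
  then have h: "history vs" and v: "v \<in> candidates vs" by auto
  obtain k0 u0 where v0: "v = k0 # u0" using candidates_nonempty[OF v] by (cases v) auto
  have IH1: "\<And>w. w \<in> set vs \<Longrightarrow> w \<noteq> [] \<and> tl w \<in> alive vs"
    and IH2: "\<And>k u j. k # u \<in> candidates vs \<Longrightarrow> u \<in> alive vs \<and> (j # u \<in> set vs \<longleftrightarrow> j < k)"
    and IH3: "alive vs \<subseteq> tl ` candidates vs"
    using Cons.IH[OF h] by blast+
  have u0: "u0 \<in> alive vs" "\<And>j. j # u0 \<in> set vs \<longleftrightarrow> j < k0" using IH2 v v0 by auto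
  have vn: "v \<notin> alive vs" using u0(2)[of k0] v0 by simp
  \<comment> \<open>A child in the history would have its parent alive, but \<open>v\<close> was
    not.\<close>
  have ch: "j # v \<notin> set vs" for j using IH1[of "j # v"] vn by auto
  have 1: "w \<noteq> [] \<and> tl w \<in> alive (v # vs)" if "w \<in> set (v # vs)" for w
  proof (cases "w = v")
    case True
    then show ?thesis using u0(1) v0 by auto
  next
    case False
    then show ?thesis using that IH1[of w] by auto
  qed
  have 2: "u \<in> alive (v # vs) \<and> (j # u \<in> set (v # vs) \<longleftrightarrow> j < k)" if ku: "k # u \<in> candidates (v # vs)" for k u j
  proof -
    have cyc: "j # v \<noteq> v" for j
      by (metis length_Cons n_not_Suc_n)
    from ku consider "k # u \<in> candidates vs" "k # u \<noteq> v" | "k = 0" "u = v" | "k = Suc k0" "u = u0"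
      using v0 by auto
    then show ?thesis
    proof cases
      case 1
      have u: "u \<in> alive vs" "\<And>j. j # u \<in> set vs \<longleftrightarrow> j < k" using IH2[OF 1(1)] by auto
      moreover have "j # u \<noteq> v"
      proof
        assume "j # u = v"
        then have "u = u0" using v0 by simp
        then have "k = k0" using u u0 by (metis linorder_neqE_nat less_irrefl)
        with \<open>u = u0\<close> 1 v0 show False by simp
      qed
      ultimately show ?thesis by simp blast
    next
      case 2
      then show ?thesis using ch[of j] cyc[of j] by simp
    next
      case 3
      have "j # u0 \<in> set (v # vs) \<longleftrightarrow> j = k0 \<or> j < k0"
        using u0(2)[of j] by (simp add: v0)
      then show ?thesis using u0(1) 3 by (simp add: less_Suc_eq) blast
    qed
  qed
  have "tl ` candidates vs \<subseteq> tl ` candidates (v # vs)"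
  proof (intro image_subsetI)
    fix w assume "w \<in> candidates vs"
    then show "tl w \<in> tl ` candidates (v # vs)"
      by (cases "w = v") (auto intro: rev_image_eqI[of "Suc (hd v) # tl v"] rev_image_eqI[of w])
  qed
  moreover have "v \<in> tl ` candidates (v # vs)" by (auto intro: rev_image_eqI[of "0 # v"])
  ultimately have 3: "alive (v # vs) \<subseteq> tl ` candidates (v # vs)" using IH3 by auto
  show ?case using 1 2 3 by blast
qed

lemma history_structure:
  assumes "history vs"
  shows "\<And>w. w \<in> set vs \<Longrightarrow> w \<noteq> [] \<and> tl w \<in> alive vs"
    and "\<And>k u j. k # u \<in> candidates vs \<Longrightarrow> u \<in> alive vs \<and> (j # u \<in> set vs \<longleftrightarrow> j < k)"
    and "alive vs \<subseteq> tl ` candidates vs"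
  using history_structure_aux[OF assms] by blast+

lemma candidates_not_alive: "history vs \<Longrightarrow> w \<in> candidates vs \<Longrightarrow> w \<notin> alive vs"
  using history_structure(2)[of vs "hd w" "tl w" "hd w"] candidates_nonempty[of w vs] by (cases w) auto

lemma candidates_inj: "history vs \<Longrightarrow> inj_on tl (candidates vs)"
proof (rule inj_onI)
  fix w w' assume h: "history vs" "w \<in> candidates vs" "w' \<in> candidates vs" "tl w = tl w'"
  obtain k k' u where "w = k # u" "w' = k' # u"
    using h candidates_nonempty by (metis list.exhaust_sel)
  then show "w = w'"
    using history_structure(2)[of vs k u] history_structure(2)[of vs k' u] h
    by (metis linorder_neqE_nat less_irrefl)
qed

text \<open>Together with \<open>candidates_inj\<close> this matches candidates with living
  individuals, one next child for each; attaching a node to an individual becomes the birth of its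
  candidate.\<close>

lemma tl_candidates: "history vs \<Longrightarrow> tl ` candidates vs = alive vs"
proof
  assume h: "history vs"
  show "tl ` candidates vs \<subseteq> alive vs"
    using history_structure(2)[OF h] candidates_nonempty by (metis image_subsetI list.exhaust_sel)
qed (rule history_structure(3))

text \<open>The head of a candidate is the number of earlier children of its parent, so this is the
  current birth rate of the parent, with \<open>a = 1 + \<delta>/m\<close>.\<close>

definition rate :: "real \<Rightarrow> nat list \<Rightarrow> real" where
  "rate a v = real (hd v) + a"

text \<open>\<open>n\<close> counts the births after the root, so \<open>Suc n\<close> individuals
  are alive; each contributes \<open>a\<close>, and each birth contributes 1 through the
  parent.\<close>

definition total_rate :: "real \<Rightarrow> nat \<Rightarrow> real" where
  "total_rate a n = real (Suc n) * (1 + a) - 1"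

lemma rate_pos: "0 < a \<Longrightarrow> 0 < rate a v"
  by (simp add: rate_def)

lemma total_rate_pos: "0 < a \<Longrightarrow> 0 < total_rate a n"
  by (simp add: total_rate_def algebra_simps add_pos_nonneg)

text \<open>The two new candidates are fresh: the newborn was not alive before and so had no
  candidate, and its parent had only the one that is removed. The lost term is written as a
  difference, hence the group.\<close>

lemma sum_candidates_Cons:
  fixes f :: "nat list \<Rightarrow> 'b::ab_group_add"
  assumes "history (v # vs)"
  shows "(\<Sum>w\<in>candidates (v # vs). f w) = (\<Sum>w\<in>candidates vs. f w) - f v + f (0 # v) + f (Suc (hd v) # tl v)"
proof -
  have h: "history vs" and v: "v \<in> candidates vs" using assms by auto
  obtain k0 u0 where v0: "v = k0 # u0" using candidates_nonempty[OF v] by (cases v) auto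
  have 1: "0 # v \<notin> candidates vs"
    using history_structure(2)[OF h, of 0 v] candidates_not_alive[OF h v] by auto
  have 2: "Suc k0 # u0 \<notin> candidates vs"
    using candidates_inj[OF h] v v0 by (auto dest!: inj_onD[of tl _ v "Suc k0 # u0"])
  have 3: "0 # v \<noteq> Suc k0 # u0" by simp
  show ?thesis
    using 1 2 3 v v0 by (simp add: sum_diff1 algebra_simps)
qed

text \<open>The candidate \<open>k # u\<close> of rate \<open>k + a\<close> gives way to candidates
  of rates \<open>a\<close> and \<open>k + 1 + a\<close>, so every birth raises the total by
  \<open>1 + a\<close>.\<close>

lemma sum_rate_candidates: "history vs \<Longrightarrow> (\<Sum>w\<in>candidates vs. rate a w) = total_rate a (length vs)"
proof (induction vs)
  case (Cons v vs)
  then show ?case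
    by (subst sum_candidates_Cons) (auto simp: rate_def total_rate_def algebra_simps)
qed (simp add: rate_def total_rate_def)

section \<open>The joint law of the first births and of the gaps between them\<close>

fun clock_time :: "(nat list \<Rightarrow> real) \<Rightarrow> nat list \<Rightarrow> real" where
  "clock_time e [] = 0"
| "clock_time e (k # u) = clock_time e u + (\<Sum>j\<le>k. e (j # u))"

fun newest :: "nat list list \<Rightarrow> nat list" where
  "newest [] = []"
| "newest (v # vs) = v"

text \<open>Strict inequalities make the followed history of each length unique; the ties lost in
  this way will form a null set.\<close>

fun births_follow :: "(nat list \<Rightarrow> real) \<Rightarrow> nat list list \<Rightarrow> bool" where
  "births_follow b [] \<longleftrightarrow> True"
| "births_follow b (v # vs) \<longleftrightarrow> births_follow b vs \<and> (\<forall>w\<in>candidates vs - {v}. b v < b w)"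

text \<open>Test functions for the joint law of the gaps. The factor for the birth of
  \<open>v\<close> carries the index \<open>length vs\<close>, the same as the total rate during
  that gap.\<close>

fun gap_prod :: "(nat \<Rightarrow> real \<Rightarrow> ennreal) \<Rightarrow> (nat list \<Rightarrow> real) \<Rightarrow> nat list list \<Rightarrow> ennreal" where
  "gap_prod g b [] = 1"
| "gap_prod g b (v # vs) = gap_prod g b vs * g (length vs) (b v - b (newest vs))"

fun history_prob :: "real \<Rightarrow> nat list list \<Rightarrow> real" where
  "history_prob a [] = 1"
| "history_prob a (v # vs) = history_prob a vs * (rate a v / total_rate a (length vs))"

text \<open>The clocks as they stand right after the birth of \<open>newest vs\<close>: what is left
  of the running ones, the full value of those not yet started. The clocks of living individuals
  have rung and leave the index set.\<close>

definition residual :: "nat list list \<Rightarrow> (nat list \<Rightarrow> real) \<Rightarrow> nat list \<Rightarrow> real" where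
  "residual vs e = (\<lambda>w\<in>- alive vs.
     if w \<in> candidates vs then clock_time e w - clock_time e (newest vs) else e w)"

lemma history_prob_nonneg: "0 < a \<Longrightarrow> 0 \<le> history_prob a vs"
  by (induction vs) (auto simp: less_imp_le rate_pos total_rate_pos)

text \<open>The strong Markov property at the birth times, integrated: the residual clocks are again
  independent with their original laws. Keeping the function \<open>H\<close> of these clocks
  arbitrary lets the induction hypothesis absorb the last race.\<close>

lemma nn_integral_history:
  fixes H :: "(nat list \<Rightarrow> real) \<Rightarrow> ennreal"
  assumes a: "0 < a" and "history vs" and g: "\<And>l. g l \<in> borel_measurable borel"
    and "H \<in> borel_measurable (PiM (- alive vs) (\<lambda>v. expo (rate a v)))"
  shows "(\<integral>\<^sup>+e. (if births_follow (clock_time e) vs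
            then gap_prod g (clock_time e) vs * H (residual vs e) else 0)
          \<partial>PiM (- {[]}) (\<lambda>v. expo (rate a v)))
    = ennreal (history_prob a vs) * (\<Prod>l<length vs. \<integral>\<^sup>+s. g l s \<partial>expo (total_rate a l))
        * (\<integral>\<^sup>+r. H r \<partial>PiM (- alive vs) (\<lambda>v. expo (rate a v)))"
  using assms(2,4)
proof (induction vs arbitrary: H)
  case Nil
  have "residual [] e = e" if "e \<in> space (PiM (- {[]}) (\<lambda>v. expo (rate a v)))" for e
    using that by (auto simp: residual_def fun_eq_iff space_PiM PiE_def extensional_def)
  then show ?case by (auto intro!: nn_integral_cong)
next
  case (Cons v vs)
  let ?Q = "\<lambda>v. expo (rate a v)"
  have h: "history vs" and v: "v \<in> candidates vs" using Cons.prems by auto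
  have J: "- alive (v # vs) = - alive vs - {v}" by auto
  have F: "candidates vs \<subseteq> - alive vs" using candidates_not_alive[OF h] by auto
  \<comment> \<open>Seen from just before the last birth, the rest of the integrand is one race
    between the residual clocks, won by \<open>v\<close>.\<close>
  define H2 where "H2 r = (if \<forall>w\<in>candidates vs - {v}. r v < r w
      then g (length vs) (r v) * H (age (- alive vs - {v}) (candidates vs) (r v) r) else 0)" for r
  have H: "H \<in> borel_measurable (PiM (- alive vs - {v}) ?Q)" using Cons.prems(2) unfolding J .
  have H2: "H2 \<in> borel_measurable (PiM (- alive vs) ?Q)"
    unfolding H2_def using F v H g by (intro measurable_first_clock) auto
  have "(\<integral>\<^sup>+e. (if births_follow (clock_time e) (v # vs)
            then gap_prod g (clock_time e) (v # vs) * H (residual (v # vs) e) else 0) \<partial>PiM (- {[]}) ?Q)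
      = (\<integral>\<^sup>+e. (if births_follow (clock_time e) vs
            then gap_prod g (clock_time e) vs * H2 (residual vs e) else 0) \<partial>PiM (- {[]}) ?Q)"
  proof (rule nn_integral_cong)
    fix e
    have r: "residual vs e w = clock_time e w - clock_time e (newest vs)" if "w \<in> candidates vs" for w
      using that F by (auto simp: residual_def)
    \<comment> \<open>Letting the winning time elapse turns the residual clocks before the birth of
      \<open>v\<close> into those after it.\<close>
    have "age (- alive vs - {v}) (candidates vs) (residual vs e v) (residual vs e) = residual (v # vs) e"
    proof
      fix w
      obtain k0 u0 where v0: "v = k0 # u0" using candidates_nonempty[OF v] by (cases v) auto
      consider "w \<in> alive (v # vs)" | "w \<notin> alive (v # vs)" "w \<in> candidates vs"
        | "w \<notin> alive (v # vs)" "w \<notin> candidates vs" "w \<in> candidates (v # vs)"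
        | "w \<notin> alive (v # vs)" "w \<notin> candidates vs" "w \<notin> candidates (v # vs)" by auto
      then show "age (- alive vs - {v}) (candidates vs) (residual vs e v) (residual vs e) w = residual (v # vs) e w"
      proof cases
        case 1
        then show ?thesis by (auto simp: age_def residual_def)
      next
        case 2
        then have "w \<in> candidates (v # vs)" by auto
        with 2 show ?thesis using r[OF v] r[OF 2(2)] by (simp add: age_def) (simp add: residual_def)
      next
        case 3
        then have "w = 0 # v \<or> w = Suc k0 # u0" using v0 by auto
        \<comment> \<open>The two new candidates start their clocks at the birth of
          \<open>v\<close>, so their residual time is the whole clock.\<close>
        then have "clock_time e w = clock_time e v + e w"
        by (elim disjE) (simp_all add: v0)
        with 3 show ?thesis by (auto simp: age_def residual_def)
      next
        case 4
        then show ?thesis by (simp add: age_def residual_def)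
      qed
    qed
    then show "(if births_follow (clock_time e) (v # vs)
            then gap_prod g (clock_time e) (v # vs) * H (residual (v # vs) e) else 0)
        = (if births_follow (clock_time e) vs then gap_prod g (clock_time e) vs * H2 (residual vs e) else 0)"
      using r v by (auto simp: H2_def mult.assoc)
  qed
  also have "\<dots> = ennreal (history_prob a vs) * (\<Prod>l<length vs. \<integral>\<^sup>+s. g l s \<partial>expo (total_rate a l))
        * (\<integral>\<^sup>+r. H2 r \<partial>PiM (- alive vs) ?Q)"
    by (rule Cons.IH[OF h H2])
  also have "(\<integral>\<^sup>+r. H2 r \<partial>PiM (- alive vs) ?Q)
      = ennreal (rate a v / total_rate a (length vs)) * (\<integral>\<^sup>+s. g (length vs) s \<partial>expo (total_rate a (length vs)))
        * (\<integral>\<^sup>+r. H r \<partial>PiM (- alive vs - {v}) ?Q)"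
    unfolding H2_def sum_rate_candidates[OF h, symmetric]
    using F v H g rate_pos[OF a] by (intro PiM_expo_first_clock) auto
  finally have "(\<integral>\<^sup>+e. (if births_follow (clock_time e) (v # vs)
            then gap_prod g (clock_time e) (v # vs) * H (residual (v # vs) e) else 0) \<partial>PiM (- {[]}) ?Q)
      = (ennreal (history_prob a vs) * ennreal (rate a v / total_rate a (length vs)))
        * (\<Prod>l<length (v # vs). \<integral>\<^sup>+s. g l s \<partial>expo (total_rate a l))
        * (\<integral>\<^sup>+r. H r \<partial>PiM (- alive (v # vs)) ?Q)"
    by (simp only: J length_Cons prod.lessThan_Suc mult_ac)
  then show ?case
    using rate_pos[OF a, of v] total_rate_pos[OF a, of "length vs"] history_prob_nonneg[OF a, of vs]
    by (simp add: ennreal_mult[symmetric])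
qed

section \<open>Expectations over the histories of a given length\<close>

definition histories :: "nat \<Rightarrow> nat list list set" where
  "histories n = {vs. history vs \<and> length vs = n}"

lemma histories_0[simp]: "histories 0 = {[]}"
  by (auto simp: histories_def)

lemma histories_Suc: "histories (Suc n) = (\<lambda>(vs, w). w # vs) ` (SIGMA vs:histories n. candidates vs)"
  by (force simp: histories_def length_Suc_conv image_iff)

lemma finite_histories[simp]: "finite (histories n)"
  by (induction n) (auto simp: histories_Suc)

text \<open>The expectation of a function of the first \<open>n\<close> births; a finite sum, so the
  tree can be studied without integrals.\<close>

definition history_mean :: "real \<Rightarrow> nat \<Rightarrow> (nat list list \<Rightarrow> real) \<Rightarrow> real" where
  "history_mean a n f = (\<Sum>vs\<in>histories n. history_prob a vs * f vs)"

text \<open>The tower property: the inner sum is the conditional expectation given the first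
  \<open>n\<close> births.\<close>

lemma history_mean_Suc:
  "history_mean a (Suc n) f
    = history_mean a n (\<lambda>vs. \<Sum>w\<in>candidates vs. rate a w / total_rate a n * f (w # vs))"
proof -
  have "history_mean a (Suc n) f
      = (\<Sum>(vs, w)\<in>(SIGMA vs:histories n. candidates vs). history_prob a (w # vs) * f (w # vs))"
    unfolding history_mean_def histories_Suc
    by (subst sum.reindex) (auto simp: inj_on_def case_prod_beta)
  also have "\<dots> = (\<Sum>vs\<in>histories n. \<Sum>w\<in>candidates vs. history_prob a (w # vs) * f (w # vs))"
    by (rule sum.Sigma[symmetric]) auto
  also have "\<dots> = (\<Sum>vs\<in>histories n. history_prob a vs * (\<Sum>w\<in>candidates vs. rate a w / total_rate a n * f (w # vs)))"
    by (intro sum.cong refl) (auto simp: sum_distrib_left histories_def mult_ac intro!: sum.cong)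
  finally show ?thesis by (simp add: history_mean_def)
qed

lemma sum_rate_ratio:
  "0 < a \<Longrightarrow> vs \<in> histories n \<Longrightarrow> (\<Sum>w\<in>candidates vs. rate a w / total_rate a n) = 1"
  using sum_rate_candidates[of vs a] total_rate_pos[of a n]
  by (auto simp: histories_def sum_divide_distrib[symmetric])

lemma history_mean_const: "0 < a \<Longrightarrow> history_mean a n (\<lambda>_. c) = c"
proof (induction n)
  case (Suc n)
  have "history_mean a (Suc n) (\<lambda>_. c) = history_mean a n (\<lambda>_. c)"
    unfolding history_mean_Suc unfolding history_mean_def sum_distrib_right[symmetric, of _ c "candidates _"]
    by (intro sum.cong refl) (simp only: sum_rate_ratio[OF Suc.prems] mult_1)
  then show ?case using Suc by simp
qed (simp add: history_mean_def)

lemma history_mean_mono: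
  "0 < a \<Longrightarrow> (\<And>vs. vs \<in> histories n \<Longrightarrow> f vs \<le> g vs) \<Longrightarrow> history_mean a n f \<le> history_mean a n g"
  unfolding history_mean_def by (intro sum_mono mult_left_mono history_prob_nonneg) auto

lemma history_mean_add: "history_mean a n (\<lambda>vs. f vs + g vs) = history_mean a n f + history_mean a n g"
  by (simp add: history_mean_def distrib_left sum.distrib)

lemma history_mean_cmult: "history_mean a n (\<lambda>vs. c * f vs) = c * history_mean a n f"
  by (simp add: history_mean_def sum_distrib_left mult_ac)

section \<open>Degrees in the collapsed tree\<close>

text \<open>\<open>v\<close> is born after the root and \<open>length vs\<close> others, hence its
  number. Individuals outside the history get the number of the root, a default that keeps
  \<open>label\<close> total and bounded.\<close>

fun label :: "nat list list \<Rightarrow> nat list \<Rightarrow> nat" where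
  "label [] u = 1"
| "label (v # vs) u = (if u = v then length vs + 2 else label vs u)"

text \<open>Inverts \<open>node\<close>, see \<open>block_eq_iff\<close>; nodes and vertices both
  count from 1, hence the two shifts.\<close>

definition block :: "nat \<Rightarrow> nat \<Rightarrow> nat" where
  "block m i = Suc ((i - 1) div m)"

definition block_size :: "nat \<Rightarrow> nat \<Rightarrow> nat \<Rightarrow> nat" where
  "block_size m n b = card {i\<in>{1..n}. block m i = b}"

fun block_degree :: "nat \<Rightarrow> nat list list \<Rightarrow> nat \<Rightarrow> nat" where
  "block_degree m [] b = 0"
| "block_degree m (v # vs) b = block_degree m vs b + (if block m (label vs (tl v)) = b then 1 else 0)"

text \<open>After \<open>l\<close> births there are \<open>Suc l\<close> tree nodes, and vertex
  \<open>b\<close> is present once node \<open>m * (b - 1) + 1\<close> is; this gives the range up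
  to \<open>Suc (l div m)\<close>.\<close>

definition degree_count :: "nat \<Rightarrow> nat \<Rightarrow> nat list list \<Rightarrow> real" where
  "degree_count m k vs = (\<Sum>b=1..Suc (length vs div m). of_bool (block_degree m vs b = k))"

lemma label_bounds: "1 \<le> label vs u \<and> label vs u \<le> Suc (length vs)"
  by (induction vs) auto

lemma block_label: "block m (label vs u) \<in> {1..Suc (length vs div m)}"
  using label_bounds[of vs u] by (auto simp: block_def intro!: div_le_mono)

text \<open>Parents are already numbered, so a vertex that has not opened yet cannot have received
  an edge.\<close>

lemma block_degree_future: "Suc (length vs div m) < b \<Longrightarrow> block_degree m vs b = 0"
proof (induction vs)
  case (Cons v vs)
  have le: "length vs div m \<le> length (v # vs) div m" by (intro div_le_mono) auto
  then have "Suc (length vs div m) < b" using Cons.prems by linarith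
  then have "block_degree m vs b = 0" "block m (label vs (tl v)) \<noteq> b"
    using Cons.IH block_label[of m vs "tl v"] by auto
  then show ?case by simp
qed simp

text \<open>Each living individual has one candidate, whose rate is its number of children plus
  \<open>a\<close>; over a block these add up to the degree and \<open>a\<close> per member present.
  For a complete block this is the degree plus \<open>m + \<delta>\<close>, the weight in the merged
  model.\<close>

lemma block_weight:
  assumes "history vs"
  shows "(\<Sum>w\<in>candidates vs. of_bool (block m (label vs (tl w)) = b) * rate a w)
    = real (block_degree m vs b) + a * real (block_size m (Suc (length vs)) b)"
  using assms
proof (induction vs)
  case Nil
  have "{i \<in> {Suc 0..Suc 0}. block m i = b} = (if block m 1 = b then {1} else {})"
    by auto
  then show ?case by (auto simp: rate_def block_size_def)
next
  case (Cons v vs)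
  then have h: "history vs" and v: "v \<in> candidates vs" by auto
  \<comment> \<open>No earlier candidate is a child of the newborn, so giving the newborn a label
    changes none of the old terms.\<close>
  have ne: "tl w \<noteq> v" if "w \<in> candidates vs" for w
    using tl_candidates[OF h] that candidates_not_alive[OF h v] by blast
  let ?f = "\<lambda>w. of_bool (block m (label (v # vs) (tl w)) = b) * rate a w"
  have "(\<Sum>w\<in>candidates (v # vs). ?f w)
      = (\<Sum>w\<in>candidates vs. ?f w) - ?f v + ?f (0 # v) + ?f (Suc (hd v) # tl v)"
    by (rule sum_candidates_Cons) fact
  also have "(\<Sum>w\<in>candidates vs. ?f w) = (\<Sum>w\<in>candidates vs. of_bool (block m (label vs (tl w)) = b) * rate a w)"
    using ne by (intro sum.cong) auto
  also have "\<dots> = real (block_degree m vs b) + a * real (block_size m (Suc (length vs)) b)"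
    by (rule Cons.IH[OF h])
  finally have 1: "(\<Sum>w\<in>candidates (v # vs). ?f w)
      = real (block_degree m vs b) + a * real (block_size m (Suc (length vs)) b)
        + of_bool (block m (length vs + 2) = b) * a + of_bool (block m (label vs (tl v)) = b)"
    using ne[OF v] by (simp add: rate_def algebra_simps)
  have "{i\<in>{1..Suc (Suc n)}. block m i = b}
      = (if block m (n + 2) = b then insert (Suc (Suc n)) {i\<in>{1..Suc n}. block m i = b} else {i\<in>{1..Suc n}. block m i = b})" for n
    by (auto simp: le_Suc_eq)
  then have "block_size m (Suc (length (v # vs))) b
      = block_size m (Suc (length vs)) b + of_bool (block m (length vs + 2) = b)"
    by (simp add: block_size_def)
  then show ?case unfolding 1 by (simp add: algebra_simps)
qed

lemma block_size_le:
  assumes "1 \<le> m"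
  shows "block_size m n b \<le> m"
proof -
  have "{i\<in>{1..n}. block m i = b} \<subseteq> {(b - 1) * m + 1..(b - 1) * m + m}"
  proof
    fix i assume "i \<in> {i\<in>{1..n}. block m i = b}"
    then have "1 \<le> i" "(i - 1) div m = b - 1" by (auto simp: block_def)
    moreover have "(i - 1) div m * m + (i - 1) mod m = i - 1" by simp
    moreover have "(i - 1) mod m < m" using assms by simp
    ultimately show "i \<in> {(b - 1) * m + 1..(b - 1) * m + m}" by auto
  qed
  from card_mono[OF _ this] show ?thesis by (simp add: block_size_def)
qed

lemma block_size_full:
  assumes "1 \<le> m" "1 \<le> b" "b \<le> n div m"
  shows "block_size m n b = m"
proof -
  have "{(b - 1) * m + 1..(b - 1) * m + m} \<subseteq> {i\<in>{1..n}. block m i = b}"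
  proof
    fix i assume i: "i \<in> {(b - 1) * m + 1..(b - 1) * m + m}"
    have "(b - 1) * m + m = b * m" using assms by (cases b) auto
    moreover have "b * m \<le> n" using assms(3) div_times_less_eq_dividend[of n m] mult_le_mono1[OF assms(3), of m] by linarith
    moreover have "(i - 1) div m = b - 1"
      using i assms(1) by (intro div_nat_eqI) (auto simp: mult.commute)
    ultimately show "i \<in> {i\<in>{1..n}. block m i = b}" using i assms by (auto simp: block_def)
  qed
  from card_mono[OF _ this] show ?thesis using block_size_le[OF assms(1), of n b]
    by (simp add: block_size_def)
qed

text \<open>All vertices but the last are complete and attract with weight \<open>j + m * a\<close>;
  the last one may lack members, which costs between 0 and \<open>m * a\<close>.\<close>

lemma degree_weight:
  fixes j :: nat
  assumes m: "1 \<le> m" and a: "0 < a" and h: "history vs"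
  defines "T \<equiv> (\<Sum>w\<in>candidates vs. of_bool (block_degree m vs (block m (label vs (tl w))) = j) * rate a w)"
  shows "(real j + real m * a) * degree_count m j vs - real m * a \<le> T"
    and "T \<le> (real j + real m * a) * degree_count m j vs"
proof -
  let ?B = "Suc (length vs div m)"
  let ?n = "Suc (length vs)"
  let ?I = "\<lambda>b. of_bool (block_degree m vs b = j) :: real"
  let ?d = "\<lambda>b. ?I b * (a * (real m - real (block_size m ?n b)))"
  have "T = (\<Sum>b=1..?B. \<Sum>w | w \<in> candidates vs \<and> block m (label vs (tl w)) = b.
      ?I (block m (label vs (tl w))) * rate a w)"
    unfolding T_def using block_label[of m vs] by (intro sum.group[symmetric]) auto
  also have "\<dots> = (\<Sum>b=1..?B. ?I b * (\<Sum>w\<in>candidates vs. of_bool (block m (label vs (tl w)) = b) * rate a w))"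
  proof (intro sum.cong refl)
    fix b
    have "(\<Sum>w | w \<in> candidates vs \<and> block m (label vs (tl w)) = b. ?I (block m (label vs (tl w))) * rate a w)
        = (\<Sum>w\<in>candidates vs. if block m (label vs (tl w)) = b then ?I (block m (label vs (tl w))) * rate a w else 0)"
      by (subst sum.inter_filter[symmetric]) auto
    also have "\<dots> = (\<Sum>w\<in>candidates vs. ?I b * (of_bool (block m (label vs (tl w)) = b) * rate a w))"
      by (intro sum.cong) auto
    finally show "(\<Sum>w | w \<in> candidates vs \<and> block m (label vs (tl w)) = b. ?I (block m (label vs (tl w))) * rate a w)
        = ?I b * (\<Sum>w\<in>candidates vs. of_bool (block m (label vs (tl w)) = b) * rate a w)"
      by (simp add: sum_distrib_left)
  qed
  also have "\<dots> = (\<Sum>b=1..?B. (real j + real m * a) * ?I b - ?d b)"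
    unfolding block_weight[OF h] by (intro sum.cong) (auto simp: algebra_simps)
  also have "\<dots> = (real j + real m * a) * degree_count m j vs - (\<Sum>b=1..?B. ?d b)"
    by (simp only: sum_subtractf sum_distrib_left degree_count_def)
  also have "(\<Sum>b=1..?B. ?d b) = ?d ?B"
  proof -
    \<comment> \<open>The blocks up to \<open>length vs div m\<close> are complete, so the
      deficiency \<open>?d\<close> vanishes on them.\<close>
    have le: "length vs div m \<le> ?n div m" by (intro div_le_mono) auto
    have "?d b = 0" if "b \<in> {1..length vs div m}" for b
    proof -
      have "b \<le> ?n div m" using that le by (meson atLeastAtMost_iff le_trans)
      then show ?thesis using that block_size_full[OF m, of b ?n] by simp
    qed
    then have "(\<Sum>b=1..length vs div m. ?d b) = 0" by (intro sum.neutral) blast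
    then show ?thesis by simp
  qed
  finally have T: "T = (real j + real m * a) * degree_count m j vs - ?d ?B" .
  have "0 \<le> ?d ?B" using a block_size_le[OF m, of ?n ?B] by simp
  moreover have "?d ?B \<le> real m * a"
    using a by (auto simp: algebra_simps of_bool_def)
  ultimately show "(real j + real m * a) * degree_count m j vs - real m * a \<le> T"
    "T \<le> (real j + real m * a) * degree_count m j vs"
    unfolding T by linarith+
qed

text \<open>The new edge moves its target from one degree to the next. The newborn is node
  \<open>length vs + 2\<close> and opens a vertex, of degree 0, exactly if \<open>m\<close> divides
  \<open>Suc (length vs)\<close>.\<close>

lemma degree_count_Cons:
  assumes "1 \<le> m"
  shows "degree_count m k (w # vs) = degree_count m k vs
    + of_bool (m dvd Suc (length vs) \<and> k = 0)
    + of_bool (Suc (block_degree m vs (block m (label vs (tl w)))) = k)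
    - of_bool (block_degree m vs (block m (label vs (tl w))) = k)"
proof -
  let ?b = "block m (label vs (tl w))"
  let ?B = "Suc (length vs div m)"
  let ?I = "\<lambda>b. of_bool (block_degree m (w # vs) b = k) :: real"
  let ?J = "\<lambda>b. of_bool (block_degree m vs b = k) :: real"
  have b: "?b \<in> {1..?B}" by (rule block_label)
  have eq: "?I b = ?J b" if "b \<noteq> ?b" for b using that by auto
  have "(\<Sum>b=1..?B. ?I b) = ?I ?b + (\<Sum>b\<in>{1..?B} - {?b}. ?I b)"
    using b by (intro sum.remove) auto
  also have "(\<Sum>b\<in>{1..?B} - {?b}. ?I b) = (\<Sum>b\<in>{1..?B} - {?b}. ?J b)"
    using eq by (intro sum.cong) auto
  also have "\<dots> = (\<Sum>b=1..?B. ?J b) - ?J ?b"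
    using b by (subst sum_diff1) auto
  finally have 1: "(\<Sum>b=1..?B. ?I b) = degree_count m k vs + ?I ?b - ?J ?b"
    by (simp add: degree_count_def)
  have 2: "degree_count m k (w # vs) = (\<Sum>b=1..?B. ?I b) + of_bool (m dvd Suc (length vs) \<and> k = 0)"
  proof (cases "m dvd Suc (length vs)")
    case True
    then have S: "Suc (length vs) div m = Suc (length vs div m)"
      by (simp add: div_Suc dvd_eq_mod_eq_0)
    then have "block_degree m vs (Suc ?B) = 0" "?b \<noteq> Suc ?B"
      using b by (auto intro!: block_degree_future)
    then have "?I (Suc ?B) = of_bool (k = 0)" by auto
    then show ?thesis
      using True S by (simp add: degree_count_def)
  next
    case False
    then have "Suc (length vs) div m = length vs div m"
      by (simp add: div_Suc dvd_eq_mod_eq_0)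
    then show ?thesis using False by (simp add: degree_count_def)
  qed
  show ?thesis unfolding 2 1 by simp
qed

lemma degree_count_bounds: "0 \<le> degree_count m k vs" "degree_count m k vs \<le> real (Suc (length vs))"
proof -
  show "0 \<le> degree_count m k vs" by (auto simp: degree_count_def intro!: sum_nonneg)
  have "degree_count m k vs \<le> (\<Sum>b=1..Suc (length vs div m). 1)"
    unfolding degree_count_def by (intro sum_mono) auto
  also have "\<dots> = real (Suc (length vs div m))" by simp
  also have "\<dots> \<le> real (Suc (length vs))"
    by (simp only: of_nat_le_iff Suc_le_mono div_le_dividend)
  finally show "degree_count m k vs \<le> real (Suc (length vs))" .
qed

text \<open>The correction for \<open>k = 0\<close> compensates that new vertices appear only at every \<open>m\<close>-th birth.\<close>

definition degree_error :: "nat \<Rightarrow> (nat \<Rightarrow> real) \<Rightarrow> nat \<Rightarrow> nat list list \<Rightarrow> real" where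
  "degree_error m p k vs = degree_count m k vs - p k * real (Suc (length vs)) / real m
     - (if k = 0 then real (Suc (length vs div m)) - real (Suc (length vs)) / real m else 0)"

section \<open>Second moments of the degree errors\<close>

lemma abs_increment_le: "A \<in> {0, 1} \<Longrightarrow> B \<in> {0, 1} \<Longrightarrow> \<bar>y + A - B\<bar> \<le> \<bar>y\<bar> + (1 :: real)"
  by auto

text \<open>The weights \<open>x\<close> are transition probabilities. The cross term is kept
  exactly, since its sign matters later; the squared increments are only bounded.\<close>

lemma second_moment_step:
  fixes x \<Delta> :: "'i \<Rightarrow> real"
  assumes "finite S" "\<And>w. w \<in> S \<Longrightarrow> 0 \<le> x w" "(\<Sum>w\<in>S. x w) = 1"
    and D: "\<And>w. w \<in> S \<Longrightarrow> \<bar>\<Delta> w\<bar> \<le> D"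
  shows "(\<Sum>w\<in>S. x w * (e + \<Delta> w)\<^sup>2) \<le> e\<^sup>2 + 2 * e * (\<Sum>w\<in>S. x w * \<Delta> w) + D\<^sup>2"
proof -
  have "(\<Sum>w\<in>S. x w * (e + \<Delta> w)\<^sup>2) \<le> (\<Sum>w\<in>S. x w * (e\<^sup>2 + D\<^sup>2) + 2 * e * (x w * \<Delta> w))"
  proof (rule sum_mono)
    fix w assume w: "w \<in> S"
    have "(\<Delta> w)\<^sup>2 \<le> D\<^sup>2" using D[OF w] by (metis abs_le_square_iff abs_ge_self order_trans)
    then have "(e + \<Delta> w)\<^sup>2 \<le> e\<^sup>2 + D\<^sup>2 + 2 * e * \<Delta> w" by (simp add: power2_sum)
    then have "x w * (e + \<Delta> w)\<^sup>2 \<le> x w * (e\<^sup>2 + D\<^sup>2 + 2 * e * \<Delta> w)"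
      using assms(2)[OF w] by (rule mult_left_mono)
    then show "x w * (e + \<Delta> w)\<^sup>2 \<le> x w * (e\<^sup>2 + D\<^sup>2) + 2 * e * (x w * \<Delta> w)"
      by (simp add: algebra_simps)
  qed
  also have "\<dots> = (\<Sum>w\<in>S. x w) * (e\<^sup>2 + D\<^sup>2) + 2 * e * (\<Sum>w\<in>S. x w * \<Delta> w)"
    by (simp add: sum.distrib sum_distrib_left sum_distrib_right)
  finally show ?thesis using assms(3) by simp
qed

lemma block_excess_bounds:
  assumes "1 \<le> m"
  shows "0 \<le> real (Suc (l div m)) - real (Suc l) / real m" "real (Suc (l div m)) - real (Suc l) / real m \<le> 1"
proof -
  have "l = l div m * m + l mod m" by simp
  moreover have "l mod m < m" using assms by simp
  ultimately have "Suc l \<le> l div m * m + m" "l div m * m \<le> l" by linarith+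
  then have "Suc l \<le> Suc (l div m) * m" "l div m * m \<le> l" by (simp_all add: add.commute)
  then have "real (Suc l) \<le> real (Suc (l div m)) * real m" "real (l div m) * real m \<le> real (Suc l)"
    by (simp_all only: of_nat_mult[symmetric] of_nat_le_iff)
  then show "0 \<le> real (Suc (l div m)) - real (Suc l) / real m" "real (Suc (l div m)) - real (Suc l) / real m \<le> 1"
    using assms by (auto simp: field_simps)
qed

text \<open>The recursion is the balance equation of the limit: with \<open>p k * n / m\<close>
  vertices of degree \<open>k\<close> and total rate about \<open>n * (1 + a)\<close>, the increment
  \<open>p k / m\<close> per birth must equal the inflow, from degree \<open>k - 1\<close> or, for
  \<open>k = 0\<close>, of \<open>1 / m\<close> new vertices, minus the outflow to degree
  \<open>k + 1\<close>.\<close>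

locale degree_recursion =
  fixes m :: nat and a :: real and p :: "nat \<Rightarrow> real"
  assumes m: "1 \<le> m" and a: "0 < a"
    and p_0: "p 0 * (1 + a + real m * a) = 1 + a"
    and p_Suc: "p (Suc k) * (1 + a + (real (Suc k) + real m * a)) = (real k + real m * a) * p k"
begin

definition vertex_weight :: "nat \<Rightarrow> real" where "vertex_weight j = real j + real m * a"

lemma vertex_weight_pos: "0 < vertex_weight j" using m a by (simp add: vertex_weight_def add_nonneg_pos)

lemma vertex_weight_Suc: "vertex_weight (Suc j) = vertex_weight j + 1" by (simp add: vertex_weight_def)

abbreviation err :: "nat \<Rightarrow> nat list list \<Rightarrow> real" where "err \<equiv> degree_error m p"

definition old_degree :: "nat list list \<Rightarrow> nat list \<Rightarrow> nat" where
  "old_degree vs w = block_degree m vs (block m (label vs (tl w)))"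

text \<open>Divided by the total rate, the probability that the next edge goes to a vertex of degree
  \<open>j\<close>.\<close>

definition attraction :: "nat \<Rightarrow> nat list list \<Rightarrow> real" where
  "attraction j vs = (\<Sum>w\<in>candidates vs. of_bool (old_degree vs w = j) * rate a w)"

text \<open>The correction in \<open>degree_error\<close> spreads the opening of vertices evenly,
  \<open>1 / m\<close> per birth; without it the increment for \<open>k = 0\<close> would depend on
  the number of births modulo \<open>m\<close>.\<close>

lemma err_Cons:
  "err k (w # vs) = err k vs + ((of_bool (k = 0) - p k) / real m
     + of_bool (Suc (old_degree vs w) = k) - of_bool (old_degree vs w = k))"
proof -
  have "Suc (length vs) div m = length vs div m + of_bool (m dvd Suc (length vs))"
    by (simp add: div_Suc dvd_eq_mod_eq_0)
  then show ?thesis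
    using m degree_count_Cons[OF m, of k w vs]
    by (cases k) (simp_all add: degree_error_def old_degree_def add_divide_distrib diff_divide_distrib algebra_simps)
qed

lemma attraction_bounds: "history vs \<Longrightarrow> \<bar>attraction j vs - vertex_weight j * degree_count m j vs\<bar> \<le> real m * a"
  using degree_weight[OF m a, of vs j] by (simp add: attraction_def vertex_weight_def old_degree_def)

lemma total_rate_ratio:
  "real (Suc l) / total_rate a l \<le> 1 / a"
  "real (Suc l) / total_rate a l = 1 / (1 + a) + 1 / ((1 + a) * total_rate a l)"
proof -
  have W: "0 < total_rate a l" using total_rate_pos[OF a] .
  show "real (Suc l) / total_rate a l \<le> 1 / a"
    using W a by (simp add: field_simps) (simp add: total_rate_def algebra_simps)
  have "real (Suc l) = (total_rate a l + 1) / (1 + a)"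
    using a by (simp add: total_rate_def)
  then have "real (Suc l) / total_rate a l = (total_rate a l + 1) / (1 + a) / total_rate a l" by (rule arg_cong)
  also have "\<dots> = 1 / (1 + a) + 1 / ((1 + a) * total_rate a l)"
    using W a by (simp add: divide_simps)
  finally show "real (Suc l) / total_rate a l = 1 / (1 + a) + 1 / ((1 + a) * total_rate a l)" .
qed

text \<open>The deterministic parts cancel by the balance equation, up to a term of order
  \<open>1 / W\<close>. What remains of the drift is linear in the errors: the outflow pulls
  \<open>err k\<close> back, and the inflow comes from \<open>err (k - 1)\<close> alone.\<close>

lemma drift_bound:
  "\<exists>K. \<forall>vs. history vs \<longrightarrow>
     \<bar>(of_bool (k = 0) - p k) / real m + ((if k = 0 then 0 else attraction (k - 1) vs) - attraction k vs) / total_rate a (length vs)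
       - ((if k = 0 then 0 else vertex_weight (k - 1) * err (k - 1) vs) - vertex_weight k * err k vs) / total_rate a (length vs)\<bar>
     \<le> K / total_rate a (length vs)"
proof (intro exI allI impI)
  fix vs assume h: "history vs"
  let ?l = "length vs"
  define W where "W = total_rate a ?l"
  define \<theta> where "\<theta> = real (Suc (?l div m)) - real (Suc ?l) / real m"
  define f where "f j = (if j = 0 then \<theta> else 0)" for j :: nat
  have \<theta>: "0 \<le> \<theta>" "\<theta> \<le> 1" using block_excess_bounds[OF m, of ?l] by (simp_all add: \<theta>_def)
  then have f: "\<bar>f j\<bar> \<le> 1" for j by (simp add: f_def)
  have W: "0 < W" using total_rate_pos[OF a] by (simp add: W_def)
  \<comment> \<open>\<open>\<rho>\<close> collects the effect of the incomplete vertex and, for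
    degree 0, of the correction term; both are bounded independently of the history.\<close>
  define \<rho> where "\<rho> j = attraction j vs - vertex_weight j * degree_count m j vs + vertex_weight j * f j" for j
  have \<rho>: "\<bar>\<rho> j\<bar> \<le> real m * a + vertex_weight j" for j
  proof -
    have "\<bar>vertex_weight j * f j\<bar> \<le> vertex_weight j * 1"
      using f[of j] vertex_weight_pos[of j] by (simp add: abs_mult)
    then show ?thesis using attraction_bounds[OF h, of j] by (simp add: \<rho>_def)
  qed
  have attraction: "attraction j vs = vertex_weight j * err j vs + vertex_weight j * p j * (real (Suc ?l) / real m) + \<rho> j" for j
    by (simp add: \<rho>_def degree_error_def f_def \<theta>_def algebra_simps)
  define q where "q = of_bool (k = 0) - p k"
  \<comment> \<open>The recursion for \<open>p\<close> enters here: the part of the drift that is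
    linear in the population becomes a multiple of \<open>q\<close>, which compensates the constant
    increment \<open>q / m\<close>.\<close>
  have balance: "(if k = 0 then 0 else vertex_weight (k - 1) * p (k - 1)) - vertex_weight k * p k = - (1 + a) * q"
  proof (cases k)
    case 0 then show ?thesis using p_0 by (simp add: vertex_weight_def q_def algebra_simps)
  next
    case (Suc j) then show ?thesis using p_Suc[of j] by (simp add: vertex_weight_def q_def algebra_simps)
  qed
  have r: "real (Suc ?l) / W = 1 / (1 + a) + 1 / ((1 + a) * W)"
    unfolding W_def by (rule total_rate_ratio)
  have "((if k = 0 then 0 else attraction (k - 1) vs) - attraction k vs)
      = ((if k = 0 then 0 else vertex_weight (k - 1) * err (k - 1) vs) - vertex_weight k * err k vs)
        + - (1 + a) * q * (real (Suc ?l) / real m) + ((if k = 0 then 0 else \<rho> (k - 1)) - \<rho> k)"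
    unfolding balance[symmetric] by (simp add: attraction algebra_simps)
  then have "((if k = 0 then 0 else attraction (k - 1) vs) - attraction k vs) / W
      = ((if k = 0 then 0 else vertex_weight (k - 1) * err (k - 1) vs) - vertex_weight k * err k vs) / W
        + - (1 + a) * q / real m * (real (Suc ?l) / W) + ((if k = 0 then 0 else \<rho> (k - 1)) - \<rho> k) / W"
    by (simp add: add_divide_distrib del: of_nat_Suc)
  \<comment> \<open>The total rate is \<open>1 + a\<close> times the population minus 1, so the
    compensation is exact up to \<open>q / m / W\<close>.\<close>
  moreover have "- (1 + a) * q / real m * (real (Suc ?l) / W) = - q / real m + - q / real m / W"
  proof -
    have "x * (1 / (1 + a) + 1 / ((1 + a) * W)) = x / (1 + a) + x / (1 + a) / W" for x
      by (simp add: distrib_left)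
    moreover have "- (1 + a) * q / real m / (1 + a) = - q / real m"
    proof -
      have "b * x / y / b = x / y" if "b \<noteq> 0" for b x y :: real using that by simp
      from this[of "1 + a" "- q" "real m"] a show ?thesis by (simp only: minus_mult_commute)
    qed
    ultimately show ?thesis unfolding r by metis
  qed
  ultimately have eq: "q / real m + ((if k = 0 then 0 else attraction (k - 1) vs) - attraction k vs) / W
       - ((if k = 0 then 0 else vertex_weight (k - 1) * err (k - 1) vs) - vertex_weight k * err k vs) / W
      = (- q / real m + ((if k = 0 then 0 else \<rho> (k - 1)) - \<rho> k)) / W"
    by (simp add: add_divide_distrib diff_divide_distrib)
  have "\<bar>- q / real m + ((if k = 0 then 0 else \<rho> (k - 1)) - \<rho> k)\<bar>
      \<le> \<bar>q / real m\<bar> + (real m * a + vertex_weight (k - 1)) + (real m * a + vertex_weight k)"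
  proof -
    have "- q / real m = - (q / real m)" "0 \<le> real m * a" using a by simp_all
    moreover have "\<bar>if k = 0 then 0 else \<rho> (k - 1)\<bar> \<le> real m * a + vertex_weight (k - 1)"
      using \<rho>[of "k - 1"] vertex_weight_pos[of "k - 1"] a by auto
    ultimately show ?thesis using \<rho>[of k] by linarith
  qed
  then have "\<bar>(- q / real m + ((if k = 0 then 0 else \<rho> (k - 1)) - \<rho> k)) / W\<bar>
      \<le> (\<bar>q / real m\<bar> + (real m * a + vertex_weight (k - 1)) + (real m * a + vertex_weight k)) / W"
    using W by (simp only: abs_divide) (simp add: divide_right_mono)
  then show "\<bar>(of_bool (k = 0) - p k) / real m + ((if k = 0 then 0 else attraction (k - 1) vs) - attraction k vs) / total_rate a (length vs)
       - ((if k = 0 then 0 else vertex_weight (k - 1) * err (k - 1) vs) - vertex_weight k * err k vs) / total_rate a (length vs)\<bar>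
     \<le> (\<bar>(of_bool (k = 0) - p k) / real m\<bar> + (real m * a + vertex_weight (k - 1)) + (real m * a + vertex_weight k)) / total_rate a (length vs)"
    using eq by (simp add: W_def q_def)
qed

lemma err_bound: "\<bar>err k vs\<bar> \<le> (2 + \<bar>p k\<bar>) * real (Suc (length vs))"
proof -
  have "\<bar>p k * real (Suc (length vs)) / real m\<bar> \<le> \<bar>p k\<bar> * real (Suc (length vs))"
  proof -
    have "\<bar>p k * real (Suc (length vs)) / real m\<bar> = \<bar>p k\<bar> * real (Suc (length vs)) / real m"
      by (simp add: abs_mult del: of_nat_Suc)
    also have "\<dots> \<le> \<bar>p k\<bar> * real (Suc (length vs)) / 1"
      using m by (intro divide_left_mono) auto
    finally show ?thesis by simp
  qed
  moreover have "\<bar>if k = 0 then real (Suc (length vs div m)) - real (Suc (length vs)) / real m else 0\<bar>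
      \<le> real (Suc (length vs))"
    using block_excess_bounds[OF m, of "length vs"] by auto
  moreover have "\<bar>N - A - B\<bar> \<le> (2 + P) * s"
    if "\<bar>A\<bar> \<le> P * s" "\<bar>B\<bar> \<le> s" "0 \<le> N" "N \<le> s" for N A B P s :: real
  proof -
    have "(2 + P) * s = 2 * s + P * s" by (rule distrib_right)
    then show ?thesis using that by linarith
  qed
  ultimately show ?thesis
    using degree_count_bounds[of m k vs] unfolding degree_error_def by blast
qed

text \<open>In twice the error times its drift, the outflow contributes
  \<open>- 2 * vertex_weight k * e^2 / W\<close>. This absorbs the part of the cross term that falls
  on \<open>e^2\<close>, so that \<open>e^2\<close> keeps the coefficient 1.\<close>

lemma err_step:
  "\<exists>C\<ge>0. \<forall>vs. history vs \<longrightarrow>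
     (\<Sum>w\<in>candidates vs. rate a w / total_rate a (length vs) * (err k (w # vs))\<^sup>2)
       \<le> (err k vs)\<^sup>2 + (if k = 0 then 0 else vertex_weight (k - 1) * (err (k - 1) vs)\<^sup>2) / total_rate a (length vs) + C"
proof -
  obtain K0 where K0: "\<And>vs. history vs \<Longrightarrow>
     \<bar>(of_bool (k = 0) - p k) / real m + ((if k = 0 then 0 else attraction (k - 1) vs) - attraction k vs) / total_rate a (length vs)
       - ((if k = 0 then 0 else vertex_weight (k - 1) * err (k - 1) vs) - vertex_weight k * err k vs) / total_rate a (length vs)\<bar>
     \<le> K0 / total_rate a (length vs)" using drift_bound[of k] by blast
  define K where "K = \<bar>K0\<bar>"
  define D where "D = \<bar>(of_bool (k = 0) - p k) / real m\<bar> + 1"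
  define C where "C = 2 * (2 + \<bar>p k\<bar>) * K / a + D\<^sup>2"
  have C0: "0 \<le> C" using a by (simp add: C_def K_def)
  show ?thesis
  proof (intro exI[of _ C] conjI C0 allI impI)
    fix vs assume h: "history vs"
    define W where "W = total_rate a (length vs)"
    have W: "0 < W" using total_rate_pos[OF a] by (simp add: W_def)
    let ?x = "\<lambda>w. rate a w / W"
    let ?e = "err k vs"
    define \<Delta> where "\<Delta> w = (of_bool (k = 0) - p k) / real m
     + of_bool (Suc (old_degree vs w) = k) - of_bool (old_degree vs w = k)" for w
    define d where "d = (if k = 0 then 0 else vertex_weight (k - 1) * err (k - 1) vs) - vertex_weight k * ?e"
    have D: "\<bar>\<Delta> w\<bar> \<le> D" for w
      unfolding \<Delta>_def D_def by (rule abs_increment_le) auto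
    have x: "(\<Sum>w\<in>candidates vs. ?x w) = 1"
      using sum_rate_ratio[OF a, of vs "length vs"] h by (simp add: histories_def W_def)
    have mean: "(\<Sum>w\<in>candidates vs. ?x w * \<Delta> w)
        = (of_bool (k = 0) - p k) / real m + ((if k = 0 then 0 else attraction (k - 1) vs) - attraction k vs) / W"
    proof -
      have "(\<Sum>w\<in>candidates vs. ?x w * \<Delta> w)
          = (\<Sum>w\<in>candidates vs. ?x w) * ((of_bool (k = 0) - p k) / real m)
            + (\<Sum>w\<in>candidates vs. of_bool (Suc (old_degree vs w) = k) * rate a w) / W
            - (\<Sum>w\<in>candidates vs. of_bool (old_degree vs w = k) * rate a w) / W"
        unfolding sum_distrib_right sum_divide_distrib sum.distrib[symmetric] sum_subtractf[symmetric]
        by (intro sum.cong) (auto simp: \<Delta>_def algebra_simps)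
      moreover have "(\<Sum>w\<in>candidates vs. of_bool (Suc (old_degree vs w) = k) * rate a w)
          = (if k = 0 then 0 else attraction (k - 1) vs)"
        by (cases k) (auto simp: attraction_def)
      ultimately show ?thesis by (simp add: x attraction_def[of k] diff_divide_distrib)
    qed
    have "(\<Sum>w\<in>candidates vs. ?x w * (err k (w # vs))\<^sup>2) = (\<Sum>w\<in>candidates vs. ?x w * (?e + \<Delta> w)\<^sup>2)"
      by (simp add: err_Cons \<Delta>_def)
    also have "\<dots> \<le> ?e\<^sup>2 + 2 * ?e * (\<Sum>w\<in>candidates vs. ?x w * \<Delta> w) + D\<^sup>2"
      using D x W rate_pos[OF a] by (intro second_moment_step) (auto intro: less_imp_le)
    also have "2 * ?e * (\<Sum>w\<in>candidates vs. ?x w * \<Delta> w) \<le> 2 * ?e * (d / W) + 2 * \<bar>?e\<bar> * (K / W)"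
    proof -
      have "\<bar>(\<Sum>w\<in>candidates vs. ?x w * \<Delta> w) - d / W\<bar> \<le> K0 / W"
        using K0[OF h] unfolding W_def[symmetric] d_def mean .
      also have "K0 / W \<le> K / W" using W by (intro divide_right_mono) (auto simp: K_def)
      finally have "\<bar>?e * ((\<Sum>w\<in>candidates vs. ?x w * \<Delta> w) - d / W)\<bar> \<le> \<bar>?e\<bar> * (K / W)"
        unfolding abs_mult by (intro mult_left_mono) auto
      then have "?e * ((\<Sum>w\<in>candidates vs. ?x w * \<Delta> w) - d / W) \<le> \<bar>?e\<bar> * (K / W)" by linarith
      then show ?thesis by (simp only: right_diff_distrib mult.assoc)
    qed
    also have "2 * ?e * (d / W) \<le> (if k = 0 then 0 else vertex_weight (k - 1) * (err (k - 1) vs)\<^sup>2) / W"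
    proof -
      have "2 * ?e * d \<le> (if k = 0 then 0 else vertex_weight (k - 1) * (err (k - 1) vs)\<^sup>2)"
      proof (cases k)
        case 0
        have "0 \<le> vertex_weight k * (?e * ?e)" using vertex_weight_pos[of k] by simp
        then show ?thesis using 0 by (simp add: d_def algebra_simps)
      next
        case (Suc j)
        let ?y = "err j vs"
        \<comment> \<open>\<open>2 e y <= e^2 + y^2\<close> splits the cross term; as
          \<open>vertex_weight k = vertex_weight j + 1\<close>, the outflow more than covers the
          share of \<open>e^2\<close>.\<close>
        have "vertex_weight j * (2 * (?e * ?y)) \<le> vertex_weight j * (?e\<^sup>2 + ?y\<^sup>2)"
          using vertex_weight_pos[of j] sum_squares_bound[of ?e ?y] by (intro mult_left_mono) (auto simp: algebra_simps)
        moreover have "2 * ?e * d = vertex_weight j * (2 * (?e * ?y)) - 2 * (vertex_weight j * ?e\<^sup>2) - 2 * ?e\<^sup>2"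
          using Suc by (simp add: d_def vertex_weight_Suc algebra_simps power2_eq_square)
        moreover have "0 \<le> vertex_weight j * ?e\<^sup>2" using vertex_weight_pos[of j] by simp
        moreover have "0 \<le> ?e\<^sup>2" by simp
        ultimately have "2 * ?e * d \<le> vertex_weight j * ?y\<^sup>2" by (simp only: distrib_left)
        then show ?thesis using Suc by simp
      qed
      then have "2 * ?e * d / W \<le> (if k = 0 then 0 else vertex_weight (k - 1) * (err (k - 1) vs)\<^sup>2) / W"
        using W by (intro divide_right_mono) auto
      then show ?thesis by simp
    qed
    also have "2 * \<bar>?e\<bar> * (K / W) \<le> 2 * (2 + \<bar>p k\<bar>) * K / a"
    proof -
      \<comment> \<open>The crude linear bound on the error is balanced by the factor
        \<open>1 / W\<close>, which leaves a constant per birth.\<close>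
      have "2 * \<bar>?e\<bar> * (K / W) \<le> 2 * ((2 + \<bar>p k\<bar>) * real (Suc (length vs))) * (K / W)"
        using err_bound[of k vs] W by (intro mult_right_mono mult_left_mono) (auto simp: K_def)
      also have "\<dots> = 2 * (2 + \<bar>p k\<bar>) * K * (real (Suc (length vs)) / W)" by simp
      also have "\<dots> \<le> 2 * (2 + \<bar>p k\<bar>) * K * (1 / a)"
        unfolding W_def using total_rate_ratio(1) by (intro mult_left_mono) (auto simp: K_def)
      finally show ?thesis by simp
    qed
    finally show "(\<Sum>w\<in>candidates vs. rate a w / total_rate a (length vs) * (err k (w # vs))\<^sup>2)
       \<le> (err k vs)\<^sup>2 + (if k = 0 then 0 else vertex_weight (k - 1) * (err (k - 1) vs)\<^sup>2) / total_rate a (length vs) + C"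
      by (simp add: W_def C_def)
  qed
qed

text \<open>Induction on the degree: the bound for \<open>k - 1\<close>, of order \<open>n\<close>,
  divided by the total rate gives a constant, so each birth adds at most a constant. The step is
  proved once for all degrees, with no inflow term for \<open>k = 0\<close>.\<close>

lemma err_second_moment: "\<exists>K\<ge>0. \<forall>n. history_mean a n (\<lambda>vs. (err k vs)\<^sup>2) \<le> K * real (Suc n)"
proof (induction k)
  have step: "\<exists>K\<ge>0. \<forall>n. history_mean a n (\<lambda>vs. (err k vs)\<^sup>2) \<le> K * real (Suc n)"
    if prev: "0 \<le> K'" "\<And>n. (if k = 0 then 0 else vertex_weight (k - 1) * history_mean a n (\<lambda>vs. (err (k - 1) vs)\<^sup>2)) \<le> K' * real (Suc n)"
    for k K'
  proof -
    obtain C where C: "0 \<le> C" "\<And>vs. history vs \<Longrightarrow>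
     (\<Sum>w\<in>candidates vs. rate a w / total_rate a (length vs) * (err k (w # vs))\<^sup>2)
       \<le> (err k vs)\<^sup>2 + (if k = 0 then 0 else vertex_weight (k - 1) * (err (k - 1) vs)\<^sup>2) / total_rate a (length vs) + C"
      using err_step[of k] by blast
    \<comment> \<open>The initial value, the feed from the lower degree, and the remainder of one
      step.\<close>
    define K where "K = (err k [])\<^sup>2 + K' / a + C"
    have "0 \<le> K" using prev C a by (simp add: K_def)
    moreover have "history_mean a n (\<lambda>vs. (err k vs)\<^sup>2) \<le> K * real (Suc n)" for n
    proof (induction n)
      case 0
      then show ?case using prev C a by (simp add: history_mean_def K_def)
    next
      case (Suc n)
      let ?W = "total_rate a n"
      have W: "0 < ?W" by (rule total_rate_pos[OF a])
      have "history_mean a (Suc n) (\<lambda>vs. (err k vs)\<^sup>2)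
          \<le> history_mean a n (\<lambda>vs. (err k vs)\<^sup>2 + ((1 / ?W) * (if k = 0 then 0 else vertex_weight (k - 1) * (err (k - 1) vs)\<^sup>2) + C))"
        unfolding history_mean_Suc using C(2) a
        by (intro history_mean_mono) (force simp: histories_def)+
      also have "\<dots> = history_mean a n (\<lambda>vs. (err k vs)\<^sup>2)
          + ((1 / ?W) * (if k = 0 then 0 else vertex_weight (k - 1) * history_mean a n (\<lambda>vs. (err (k - 1) vs)\<^sup>2)) + C)"
        unfolding history_mean_add history_mean_cmult history_mean_const[OF a]
        by (cases "k = 0") (simp_all add: history_mean_cmult history_mean_const[OF a])
      also have "\<dots> \<le> K * real (Suc n) + ((1 / ?W) * (K' * real (Suc n)) + C)"
        using Suc prev(2)[of n] W by (intro add_mono mult_left_mono) auto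
      also have "(1 / ?W) * (K' * real (Suc n)) = K' * (real (Suc n) / ?W)" by simp
      also have "\<dots> \<le> K' * (1 / a)" using total_rate_ratio(1) prev by (intro mult_left_mono) auto
      also have "K * real (Suc n) + (K' * (1 / a) + C) \<le> K * real (Suc (Suc n))"
        by (simp add: K_def algebra_simps)
      finally show ?case by simp
    qed
    ultimately show ?thesis by blast
  qed
  { case 0 show ?case by (rule step[of 0]) auto }
  { case (Suc k)
    then obtain K where K: "0 \<le> K" "\<And>n. history_mean a n (\<lambda>vs. (err k vs)\<^sup>2) \<le> K * real (Suc n)" by blast
    show ?case
    proof (rule step[of "vertex_weight k * K"])
      show "0 \<le> vertex_weight k * K" using K vertex_weight_pos[of k] by simp
      fix n
      have "vertex_weight k * history_mean a n (\<lambda>vs. (err k vs)\<^sup>2) \<le> vertex_weight k * (K * real (Suc n))"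
        using K vertex_weight_pos[of k] by (intro mult_left_mono) auto
      then show "(if Suc k = 0 then 0 else vertex_weight (Suc k - 1) * history_mean a n (\<lambda>vs. (err (Suc k - 1) vs)\<^sup>2))
          \<le> vertex_weight k * K * real (Suc n)" by (simp add: mult.assoc)
    qed }
qed

end

section \<open>The numbering in order of birth\<close>

definition increasing_births :: "(nat list \<Rightarrow> nat \<Rightarrow> real) \<Rightarrow> bool" where
  "increasing_births x \<longleftrightarrow> (\<forall>u. 0 < x u 0 \<and> (\<forall>k. x u k < x u (Suc k)))"

lemma increasing_births_mono:
  assumes "increasing_births x"
  shows "j \<le> k \<Longrightarrow> x u j \<le> x u k" "0 < x u k"
proof -
  have "mono (x u)" using assms by (auto simp: increasing_births_def less_imp_le intro!: incseq_SucI)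
  then show *: "j \<le> k \<Longrightarrow> x u j \<le> x u k" for j k by (rule monoD)
  show "0 < x u k" using *[of 0 k] assms by (auto simp: increasing_births_def intro: less_le_trans)
qed

lemma birth_time_append: "increasing_births x \<Longrightarrow> birth_time x u \<le> birth_time x (zs @ u)"
  by (induction zs) (auto intro!: add_increasing2 increasing_births_mono(2)[THEN less_imp_le])

text \<open>This is why racing the candidates alone finds the next birth: following the ancestors of
  an unborn individual to the first living one, the candidate of that one is no later than the
  branch taken.\<close>

lemma candidate_above:
  assumes "history vs" "u \<notin> alive vs"
  shows "\<exists>w\<in>candidates vs. \<exists>zs k. u = zs @ k # tl w \<and> hd w \<le> k"
  using assms
proof (induction vs)
  case Nil
  then have "u = butlast u @ last u # []" by simp
  then show ?case by auto
next
  case (Cons v vs)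
  then obtain w zs k where w: "w \<in> candidates vs" "u = zs @ k # tl w" "hd w \<le> k" by auto
  have v: "v \<noteq> []" using Cons.prems candidates_nonempty by auto
  show ?case
  proof (cases "w = v")
    case False
    then show ?thesis using w by auto
  next
    case True
    show ?thesis
    proof (cases "k = hd w")
      case False
      then have "Suc (hd v) \<le> k" using w True by simp
      then show ?thesis using w True by (intro bexI[of _ "Suc (hd v) # tl v"]) auto
    next
      case hd: True
      \<comment> \<open>Here \<open>u\<close> descends properly from the newborn \<open>v\<close>,
        so the first child of \<open>v\<close> is the candidate to take.\<close>
      then have u: "u = zs @ v" using w True v by simp
      then have "zs \<noteq> []" using Cons.prems by auto
      then have "u = butlast zs @ last zs # v" using u by simp
      then show ?thesis by (intro bexI[of _ "0 # v"]) auto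
    qed
  qed
qed

lemma birth_time_order:
  assumes x: "increasing_births x" and "history vs" "births_follow (birth_time x) vs"
  shows "(\<forall>w\<in>candidates vs. birth_time x (newest vs) < birth_time x w)
    \<and> (\<forall>u\<in>alive vs. birth_time x u \<le> birth_time x (newest vs))"
  using assms(2,3)
proof (induction vs)
  case Nil
  then show ?case using x by (simp add: increasing_births_def)
next
  case (Cons v vs)
  then have IH: "\<forall>w\<in>candidates vs. birth_time x (newest vs) < birth_time x w"
    "\<forall>u\<in>alive vs. birth_time x u \<le> birth_time x (newest vs)" and v: "v \<in> candidates vs"
    and f: "\<forall>w\<in>candidates vs - {v}. birth_time x v < birth_time x w" by auto
  obtain k u where ku: "v = k # u" using candidates_nonempty[OF v] by (cases v) auto
  have "birth_time x v < birth_time x (0 # v)" "birth_time x v < birth_time x (Suc k # u)"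
    using x ku by (auto simp: increasing_births_def)
  moreover have "birth_time x (newest vs) \<le> birth_time x v" using IH v by (auto intro: less_imp_le)
  ultimately show ?case using IH f ku by (auto intro: order_trans)
qed

text \<open>Anyone outside the history is born no earlier than some candidate, and the candidates
  come after the newest birth. So a list checked only by races accounts for all births up to that
  time.\<close>

lemma born_until_newest:
  assumes x: "increasing_births x" and h: "history vs" and f: "births_follow (birth_time x) vs"
  shows "{u. birth_time x u \<le> birth_time x (newest vs)} = alive vs"
proof (intro equalityI subsetI)
  fix u assume u: "u \<in> {u. birth_time x u \<le> birth_time x (newest vs)}"
  show "u \<in> alive vs"
  proof (rule ccontr)
    assume "u \<notin> alive vs"
    then obtain w zs k where w: "w \<in> candidates vs" "u = zs @ k # tl w" "hd w \<le> k"
      using candidate_above[OF h] by blast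
    then have "w = hd w # tl w" using candidates_nonempty by (metis list.collapse)
    then have "birth_time x w = birth_time x (tl w) + x (tl w) (hd w)"
      by (metis birth_time.simps(2))
    also have "\<dots> \<le> birth_time x (k # tl w)" using increasing_births_mono(1)[OF x w(3)] by simp
    also have "\<dots> \<le> birth_time x u" unfolding w(2) by (rule birth_time_append[OF x])
    finally show False using birth_time_order[OF x h f] w u by force
  qed
qed (use birth_time_order[OF x h f] in auto)

lemma card_alive: "history vs \<Longrightarrow> card (alive vs) = Suc (length vs)"
proof (induction vs)
  case (Cons v vs)
  then have "v \<notin> alive vs" using candidates_not_alive by auto
  moreover have "alive (v # vs) = insert v (alive vs)" by auto
  ultimately show ?case using Cons by (metis List.finite_set card_insert_disjoint finite.insertI history.simps(2) length_Cons)
qed simp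

text \<open>By \<open>born_until_newest\<close> the rank of the newest individual is the number of
  the living; the older ones keep the label they got at their own birth.\<close>

lemma birth_rank_label:
  assumes x: "increasing_births x" and "history vs" "births_follow (birth_time x) vs" "u \<in> alive vs"
  shows "birth_rank x u = label vs u"
  using assms(2-)
proof (induction vs)
  case Nil
  then show ?case using born_until_newest[OF x, of "[]"] by (simp add: birth_rank_def)
next
  case (Cons v vs)
  show ?case
  proof (cases "u = v")
    case True
    have "birth_rank x v = card (alive (v # vs))"
      using born_until_newest[OF x Cons.prems(1,2)] by (simp only: birth_rank_def newest.simps)
    then show ?thesis using card_alive[OF Cons.prems(1)] True by simp
  next
    case False
    then show ?thesis using Cons by auto
  qed
qed

lemma label_inj: "history vs \<Longrightarrow> inj_on (label vs) (alive vs)"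
proof (induction vs)
  case (Cons v vs)
  have b: "label vs u \<noteq> length vs + 2" for u using label_bounds[of vs u] by linarith
  have b': "length vs + 2 \<noteq> label vs u" for u using b[of u] by linarith
  have i: "inj_on (label vs) (alive vs)" and v: "v \<notin> alive vs" using Cons candidates_not_alive by auto
  have *: "alive (v # vs) = insert v (alive vs)" by auto
  have "inj_on (label (v # vs)) (insert v (alive vs))"
    using i v b b' by (auto simp: inj_on_def)
  then show ?case unfolding * .
qed simp

text \<open>Two different winners of the same race would each be strictly first.\<close>

lemma births_follow_unique:
  "history vs \<Longrightarrow> history vs' \<Longrightarrow> births_follow b vs \<Longrightarrow> births_follow b vs' \<Longrightarrow> length vs = length vs' \<Longrightarrow> vs = vs'"
proof (induction vs arbitrary: vs')
  case (Cons v vs)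
  then obtain v' us where vs': "vs' = v' # us" by (cases vs') auto
  then have "vs = us" using Cons.IH[of us] Cons.prems by simp
  moreover have "v = v'"
  proof (rule ccontr)
    assume "v \<noteq> v'"
    then have "b v < b v'" "b v' < b v" using Cons.prems vs' \<open>vs = us\<close> by auto
    then show False by simp
  qed
  ultimately show ?case using vs' by simp
qed simp

text \<open>The recursive count uses labels at the time of each birth; the label of a parent never
  changes afterwards, so counting with the final labels gives the same.\<close>

lemma block_degree_card:
  "history vs \<Longrightarrow> block_degree m vs b = card {w\<in>set vs. block m (label vs (tl w)) = b}"
proof (induction vs)
  case (Cons v vs)
  then have h: "history vs" and v: "v \<in> candidates vs" by auto
  have vn: "v \<notin> alive vs" using candidates_not_alive[OF h v] .
  have "tl w \<noteq> v" if "w \<in> set (v # vs)" for w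
  proof -
    have "tl w \<in> alive vs"
    proof (cases "w = v")
      case True
      then show ?thesis using tl_candidates[OF h] v by blast
    next
      case False
      then show ?thesis using history_structure(1)[OF h, of w] that by simp
    qed
    then show ?thesis using vn by blast
  qed
  then have "{w\<in>set (v # vs). block m (label (v # vs) (tl w)) = b}
    = {w\<in>set (v # vs). block m (label vs (tl w)) = b}" by auto
  also have "\<dots> = (if block m (label vs (tl v)) = b then insert v {w\<in>set vs. block m (label vs (tl w)) = b}
      else {w\<in>set vs. block m (label vs (tl w)) = b})" by auto
  finally show ?case using Cons.IH[OF h] vn by simp
qed simp

lemma block_eq_iff:
  assumes "1 \<le> m" "1 \<le> i" "1 \<le> b"
  shows "block m i = b \<longleftrightarrow> (\<exists>j\<in>{1..m}. i = node m b j)"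
proof
  assume "block m i = b"
  then have "(i - 1) div m = b - 1" by (auto simp: block_def)
  then have "i = m * (b - 1) + (Suc ((i - 1) mod m))"
    using assms div_mult_mod_eq[of "i - 1" m] by (simp add: mult.commute)
  moreover have "Suc ((i - 1) mod m) \<in> {1..m}" using assms by (auto simp: Suc_le_eq)
  ultimately show "\<exists>j\<in>{1..m}. i = node m b j" unfolding node_def by blast
next
  assume "\<exists>j\<in>{1..m}. i = node m b j"
  then obtain j where "j \<in> {1..m}" "i = m * (b - 1) + j" by (auto simp: node_def)
  then have "(i - 1) div m = b - 1" by (intro div_nat_eqI) (auto simp: mult.commute)
  then show "block m i = b" using assms by (simp add: block_def)
qed

text \<open>The almost sure properties of a realisation under which numbering by birth is genuine;
  everything in this locale is deterministic. The last assumption excludes explosion: histories of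
  every length could still accumulate in finite time.\<close>

locale regular_births =
  fixes x :: "nat list \<Rightarrow> nat \<Rightarrow> real"
  assumes increasing: "increasing_births x"
    and ex_history: "\<exists>vs\<in>histories n. births_follow (birth_time x) vs"
    and unbounded: "\<exists>vs. history vs \<and> births_follow (birth_time x) vs \<and> t < birth_time x (newest vs)"
begin

text \<open>By \<open>births_follow_unique\<close> the choice is forced, which is why
  \<open>hist (Suc n)\<close> extends \<open>hist n\<close>.\<close>

definition hist :: "nat \<Rightarrow> nat list list" where
  "hist n = (SOME vs. vs \<in> histories n \<and> births_follow (birth_time x) vs)"

lemma hist: "history (hist n)" "length (hist n) = n" "births_follow (birth_time x) (hist n)"
proof -
  have "\<exists>vs. vs \<in> histories n \<and> births_follow (birth_time x) vs" using ex_history by blast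
  from someI_ex[OF this] show "history (hist n)" "length (hist n) = n" "births_follow (birth_time x) (hist n)"
    by (auto simp: hist_def histories_def)
qed

lemma hist_unique: "history vs \<Longrightarrow> births_follow (birth_time x) vs \<Longrightarrow> hist (length vs) = vs"
  using births_follow_unique hist by metis

lemma hist_0[simp]: "hist 0 = []" using hist(2)[of 0] by simp

lemma hist_Suc: "hist (Suc n) = newest (hist (Suc n)) # hist n"
proof -
  obtain v vs where vs: "hist (Suc n) = v # vs" using hist(2)[of "Suc n"] by (cases "hist (Suc n)") auto
  then have "history vs" "births_follow (birth_time x) vs" "length vs = n"
    using hist[of "Suc n"] by auto
  then have "hist n = vs" using hist_unique by blast
  then show ?thesis using vs by simp
qed

lemma newest_candidate: "newest (hist (Suc n)) \<in> candidates (hist n)"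
  using hist(1)[of "Suc n"] hist_Suc[of n] by (metis history.simps(2))

lemma born_hist: "{u. birth_time x u \<le> birth_time x (newest (hist n))} = alive (hist n)"
  using born_until_newest[OF increasing hist(1,3)] .

lemma ex_alive: "\<exists>n. {u. birth_time x u \<le> t} \<subseteq> alive (hist n)"
proof -
  obtain vs where vs: "history vs" "births_follow (birth_time x) vs" "t < birth_time x (newest vs)"
    using unbounded by blast
  then have "{u. birth_time x u \<le> t} \<subseteq> {u. birth_time x u \<le> birth_time x (newest vs)}" by auto
  also have "\<dots> = alive (hist (length vs))"
    using born_until_newest[OF increasing vs(1,2)] hist_unique[OF vs(1,2)] by simp
  finally show ?thesis by blast
qed

lemma finite_born: "finite {u. birth_time x u \<le> t}"
  using ex_alive[of t] by (meson List.finite_set finite.insertI finite_subset)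

lemma rank_hist: "u \<in> alive (hist n) \<Longrightarrow> birth_rank x u = label (hist n) u"
  using birth_rank_label[OF increasing hist(1,3)] .

lemma rank_le_iff: "birth_rank x u \<le> birth_rank x v \<longleftrightarrow> birth_time x u \<le> birth_time x v"
proof
  show "birth_time x u \<le> birth_time x v \<Longrightarrow> birth_rank x u \<le> birth_rank x v"
    unfolding birth_rank_def by (intro card_mono finite_born) auto
  show "birth_rank x u \<le> birth_rank x v \<Longrightarrow> birth_time x u \<le> birth_time x v"
  proof (rule ccontr)
    assume "\<not> birth_time x u \<le> birth_time x v"
    then have "{w. birth_time x w \<le> birth_time x v} \<subset> {w. birth_time x w \<le> birth_time x u}" by force
    then have "birth_rank x v < birth_rank x u"
      unfolding birth_rank_def by (intro psubset_card_mono finite_born)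
    then show "birth_rank x u \<le> birth_rank x v \<Longrightarrow> False" by simp
  qed
qed

lemma rank_inj: "birth_rank x u = birth_rank x v \<longleftrightarrow> u = v"
proof
  assume eq: "birth_rank x u = birth_rank x v"
  obtain n where n: "{w. birth_time x w \<le> max (birth_time x u) (birth_time x v)} \<subseteq> alive (hist n)"
    using ex_alive by blast
  have "u \<in> alive (hist n)" "v \<in> alive (hist n)"
    using subsetD[OF n, of u] subsetD[OF n, of v] by simp_all
  then show "u = v" using eq label_inj[OF hist(1)] by (metis inj_onD rank_hist)
qed simp

lemma rank_newest: "birth_rank x (newest (hist n)) = Suc n"
  unfolding birth_rank_def born_hist card_alive[OF hist(1)] by (simp add: hist)

lemma individual_Suc: "individual x (Suc n) = newest (hist n)"
  unfolding individual_def by (rule the_equality) (auto simp: rank_newest rank_inj[symmetric])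

lemma rank_pos: "1 \<le> birth_rank x u"
proof -
  have "0 < birth_rank x u" unfolding birth_rank_def using finite_born by (auto simp: card_gt_0_iff)
  then show ?thesis by simp
qed

lemma rank_individual: "1 \<le> i \<Longrightarrow> birth_rank x (individual x i) = i"
  using individual_Suc[of "i - 1"] rank_newest[of "i - 1"] by simp

lemma individual_rank: "individual x (birth_rank x u) = u"
  using rank_individual[OF rank_pos] rank_inj by blast

lemma tau_le_iff: "1 \<le> i \<Longrightarrow> 1 \<le> j \<Longrightarrow> tau x i \<le> tau x j \<longleftrightarrow> i \<le> j"
  unfolding tau_def rank_le_iff[symmetric] by (simp add: rank_individual)

lemma tau_Suc: "tau x (Suc n) = birth_time x (newest (hist n))"
  by (simp add: tau_def individual_Suc)

text \<open>The sets of individuals born up to a time are nested in time, so the number of elements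
  determines the set.\<close>

lemma born_eq_alive:
  assumes "population x t = Suc l"
  shows "{u. birth_time x u \<le> t} = alive (hist l)"
proof (rule ccontr)
  assume ne: "{u. birth_time x u \<le> t} \<noteq> alive (hist l)"
  have c: "card {u. birth_time x u \<le> t} = card (alive (hist l))"
    using assms card_alive[OF hist(1)] by (simp add: population_def hist)
  show False
  proof (cases "birth_time x (newest (hist l)) \<le> t")
    case True
    then have "{u. birth_time x u \<le> birth_time x (newest (hist l))} \<subseteq> {u. birth_time x u \<le> t}" by auto
    then have "alive (hist l) \<subseteq> {u. birth_time x u \<le> t}" unfolding born_hist .
    then show False using c ne finite_born card_subset_eq by metis
  next
    case False
    then have "{u. birth_time x u \<le> t} \<subseteq> {u. birth_time x u \<le> birth_time x (newest (hist l))}" by auto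
    then have "{u. birth_time x u \<le> t} \<subseteq> alive (hist l)" unfolding born_hist .
    then show False using c ne card_subset_eq by (metis List.finite_set finite.insertI)
  qed
qed

lemma population_pos: "0 \<le> t \<Longrightarrow> 1 \<le> population x t"
proof -
  assume "0 \<le> t"
  then have "[] \<in> {u. birth_time x u \<le> t}" by simp
  then have "0 < population x t" unfolding population_def using finite_born[of t] by (metis card_gt_0_iff empty_iff)
  then show ?thesis by simp
qed

lemma tau_le_population: "0 \<le> t \<Longrightarrow> 1 \<le> i \<Longrightarrow> tau x i \<le> t \<longleftrightarrow> i \<le> population x t"
proof -
  assume t: "0 \<le> t" and i: "1 \<le> i"
  obtain l where l: "population x t = Suc l" using population_pos[OF t] by (cases "population x t") auto
  have "tau x i \<le> t \<longleftrightarrow> individual x i \<in> alive (hist l)"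
    using born_eq_alive[OF l] by (auto simp: tau_def)
  also have "\<dots> \<longleftrightarrow> tau x i \<le> tau x (Suc l)"
    using born_hist[of l] by (auto simp: tau_def individual_Suc)
  also have "\<dots> \<longleftrightarrow> i \<le> Suc l" using i by (intro tau_le_iff) auto
  finally show "tau x i \<le> t \<longleftrightarrow> i \<le> population x t" using l by simp
qed

text \<open>The offspring of the \<open>m\<close> merged individuals are disjoint families, so the
  sum of their sizes counts the individuals in the history with a parent in the block.\<close>

lemma CBP_degree_hist:
  assumes m: "1 \<le> m" and b: "1 \<le> b" and l: "population x t = Suc l"
  shows "CBP_degree m x b t = block_degree m (hist l) b"
proof -
  let ?u = "\<lambda>j. individual x (node m b j)"
  let ?A = "\<lambda>j. {w\<in>set (hist l). tl w = ?u j}"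
  have nodes: "1 \<le> node m b j" if "j \<in> {1..m}" for j using that by (auto simp: node_def)
  have inj: "j = j'" if "?u j = ?u j'" "j \<in> {1..m}" "j' \<in> {1..m}" for j j'
    using that rank_individual[OF nodes, of j] rank_individual[OF nodes, of j'] by (auto simp: node_def)
  have "points_upto (x u) (t - birth_time x u) = card {w\<in>set (hist l). tl w = u}" for u
  proof -
    \<comment> \<open>Positivity of the points makes the lower bound 0 harmless, and both sides are
      empty if \<open>u\<close> is born after \<open>t\<close>.\<close>
    have "{k. x u k \<in> {0..t - birth_time x u}} = {k. birth_time x (k # u) \<le> t}"
      using increasing_births_mono(2)[OF increasing] by (auto simp: algebra_simps less_imp_le)
    also have "\<dots> = {k. k # u \<in> set (hist l)}"
    proof -
      have "k # u \<in> {u. birth_time x u \<le> t} \<longleftrightarrow> k # u \<in> alive (hist l)" for k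
        by (simp only: born_eq_alive[OF l])
      then show ?thesis by simp
    qed
    finally have "points_upto (x u) (t - birth_time x u) = card {k. k # u \<in> set (hist l)}"
      by (simp add: points_upto_def)
    also have "\<dots> = card ((\<lambda>k. k # u) ` {k. k # u \<in> set (hist l)})"
      by (intro card_image[symmetric]) (auto simp: inj_on_def)
    also have "(\<lambda>k. k # u) ` {k. k # u \<in> set (hist l)} = {w\<in>set (hist l). tl w = u}"
      using history_structure(1)[OF hist(1), of _ l] by (auto simp: image_iff) (metis list.collapse)
    finally show ?thesis .
  qed
  then have "CBP_degree m x b t = (\<Sum>j=1..m. card (?A j))"
    by (simp add: CBP_degree_def tau_def)
  also have "\<dots> = card (\<Union>j\<in>{1..m}. ?A j)"
    using inj by (subst card_UN_disjoint) auto
  also have "(\<Union>j\<in>{1..m}. ?A j) = {w\<in>set (hist l). block m (label (hist l) (tl w)) = b}"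
  proof -
    have "(\<exists>j\<in>{1..m}. tl w = ?u j) \<longleftrightarrow> block m (label (hist l) (tl w)) = b" if w: "w \<in> set (hist l)" for w
    proof -
      have "tl w \<in> alive (hist l)" using history_structure(1)[OF hist(1) w] by simp
      then have r: "label (hist l) (tl w) = birth_rank x (tl w)" using rank_hist by simp
      show ?thesis unfolding r block_eq_iff[OF m rank_pos b]
        using rank_individual[OF nodes] individual_rank by metis
    qed
    then show ?thesis by auto
  qed
  finally show ?thesis using block_degree_card[OF hist(1)] by simp
qed

lemma vertices_CBP:
  assumes m: "1 \<le> m" and t: "0 \<le> t" and l: "population x t = Suc l"
  shows "vertices (CBP m x t) = {1..Suc (l div m)}"
proof -
  have "node m n 1 \<le> Suc l \<longleftrightarrow> n \<le> Suc (l div m)" if "1 \<le> n" for n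
  proof -
    have "node m n 1 \<le> Suc l \<longleftrightarrow> (n - 1) * m \<le> l" by (simp add: node_def mult.commute)
    also have "\<dots> \<longleftrightarrow> n - 1 \<le> l div m" using m by (simp add: less_eq_div_iff_mult_less_eq)
    finally show ?thesis by auto
  qed
  moreover have "1 \<le> node m n 1" for n by (simp add: node_def)
  ultimately show ?thesis
    using tau_le_population[OF t] l by (auto simp: CBP_def collapse_def)
qed

lemma num_vertices_hist:
  "1 \<le> m \<Longrightarrow> 0 \<le> t \<Longrightarrow> population x t = Suc l \<Longrightarrow> num_vertices m x t = Suc (l div m)"
  by (simp add: num_vertices_def vertices_CBP)

lemma num_vertices_deg_hist:
  assumes "1 \<le> m" "0 \<le> t" "population x t = Suc l"
  shows "real (num_vertices_deg m x k t) = degree_count m k (hist l)"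
proof -
  have "{n \<in> vertices (CBP m x t). CBP_degree m x n t = k} = {b\<in>{1..Suc (l div m)}. block_degree m (hist l) b = k}"
    using vertices_CBP[OF assms] CBP_degree_hist[OF assms(1) _ assms(3)] by auto
  then have "num_vertices_deg m x k t = card ({1..Suc (l div m)} \<inter> {b. block_degree m (hist l) b = k})"
    by (simp add: num_vertices_deg_def Int_def)
  then show ?thesis
    by (simp only: degree_count_def hist(2)) (simp only: sum_of_bool_eq finite_atLeastAtMost)
qed

text \<open>Restricted to nodes from 2 on, because the tree law lives on the product over
  these.\<close>

definition parents :: "nat \<Rightarrow> nat" where
  "parents = (\<lambda>i\<in>{2..}. birth_rank x (tl (individual x i)))"

lemma parents_Suc: "parents (Suc (Suc n)) = label (hist n) (tl (newest (hist (Suc n))))"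
proof -
  have "tl (newest (hist (Suc n))) \<in> alive (hist n)"
    using newest_candidate tl_candidates[OF hist(1)] by blast
  then show ?thesis using rank_hist by (simp add: parents_def individual_Suc)
qed

lemma ctbp_parent_parents:
  "1 \<le> i \<Longrightarrow> ctbp_parent x i = (if 2 \<le> i then Some (parents i) else None)"
proof -
  assume i: "1 \<le> i"
  have "individual x i = [] \<longleftrightarrow> i = 1"
    using i rank_inj[of "individual x i" "[]"] rank_individual[OF i] rank_newest[of 0] by auto
  then show ?thesis using i by (auto simp: ctbp_parent_def parents_def)
qed

text \<open>At the birth time of node \<open>i\<close> exactly the nodes up to \<open>i\<close> are
  present; so the two sequences agree for every regular realisation and not merely in law.\<close>

lemma CBP_sequence_PA: "1 \<le> m \<Longrightarrow> CBP_sequence m x = PA_sequence m parents"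
proof -
  assume m: "1 \<le> m"
  have "CBP m x (tau x (node m n j)) = PA m parents (node m n j)" if "(n, j) \<in> steps m" for n j
  proof -
    have "1 \<le> node m n j" using that by (auto simp: node_def steps_def)
    moreover have "1 \<le> node m a j'" if "j' \<in> {1..m}" for a j' using that by (auto simp: node_def)
    ultimately show ?thesis
      using m unfolding CBP_def PA_def collapse_def
      by (auto simp: tau_le_iff ctbp_parent_parents fun_eq_iff intro!: arg_cong[of _ _ card] simp del: One_nat_def split: if_splits)
  qed
  then show ?thesis
    by (auto simp: CBP_sequence_def PA_sequence_def restrict_def fun_eq_iff)
qed

text \<open>Siblings are born without gaps, so the head of a candidate counts the older ones, which
  are the nodes attached to its parent. This identifies the attachment weight with the rate of the
  candidate.\<close>

lemma card_children:
  assumes w: "w \<in> candidates (hist n)"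
  shows "card {i\<in>{2..Suc n}. parents i = label (hist n) (tl w)} = hd w"
proof -
  have u: "tl w \<in> alive (hist n)" using w tl_candidates[OF hist(1)] by blast
  have wc: "hd w # tl w \<in> candidates (hist n)" using w candidates_nonempty[OF w] by simp
  have "{i\<in>{2..Suc n}. parents i = label (hist n) (tl w)} = (\<lambda>j. birth_rank x (j # tl w)) ` {..<hd w}"
  proof (intro equalityI subsetI)
    fix i assume i: "i \<in> {i\<in>{2..Suc n}. parents i = label (hist n) (tl w)}"
    let ?v = "individual x i"
    have rv: "birth_rank x ?v = i" using i by (intro rank_individual) auto
    have "2 \<le> i" "parents i = label (hist n) (tl w)" using i by auto
    then have "birth_rank x (tl ?v) = birth_rank x (tl w)" using rank_hist[OF u] by (simp add: parents_def)
    then have tl: "tl ?v = tl w" by (simp add: rank_inj)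
    have "?v \<noteq> []" using rv i rank_newest[of 0] by auto
    then have v: "?v = hd ?v # tl w" using tl by (metis list.collapse)
    have "birth_rank x ?v \<le> birth_rank x (newest (hist n))" using rv i by (simp add: rank_newest)
    then have "?v \<in> alive (hist n)" using born_hist[of n] rank_le_iff by blast
    then have "?v \<in> set (hist n)" using \<open>?v \<noteq> []\<close> by simp
    then have "hd ?v < hd w" using history_structure(2)[OF hist(1) wc, of "hd ?v"] v by simp
    then show "i \<in> (\<lambda>j. birth_rank x (j # tl w)) ` {..<hd w}" using v rv by (intro image_eqI[of _ _ "hd ?v"]) auto
  next
    fix i assume "i \<in> (\<lambda>j. birth_rank x (j # tl w)) ` {..<hd w}"
    then obtain j where j: "j < hd w" "i = birth_rank x (j # tl w)" by auto
    then have "j # tl w \<in> set (hist n)" using history_structure(2)[OF hist(1) wc, of j] by simp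
    then have "birth_time x (j # tl w) \<le> birth_time x (newest (hist n))" using born_hist[of n] by auto
    then have "i \<le> Suc n" using rank_le_iff j rank_newest by metis
    moreover have "i \<noteq> 1" using j rank_newest[of 0] rank_inj[of "j # tl w" "[]"] by auto
    moreover have "1 \<le> i" using j rank_pos by simp
    moreover have "parents i = label (hist n) (tl w)" if "2 \<le> i"
      using that j rank_hist[OF u] by (simp add: parents_def individual_rank)
    ultimately show "i \<in> {i\<in>{2..Suc n}. parents i = label (hist n) (tl w)}" by auto
  qed
  moreover have "inj_on (\<lambda>j. birth_rank x (j # tl w)) {..<hd w}" by (auto simp: inj_on_def rank_inj)
  ultimately show ?thesis by (simp add: card_image)
qed

end

text \<open>The number of a parent determines the parent, who has only one candidate; so tree and
  history carry the same information, and events about the first parents become events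
  \<open>births_follow\<close>.\<close>

lemma parents_eq_iff:
  assumes x: "regular_births x" and y: "regular_births y"
  shows "(\<forall>i\<in>{2..Suc n}. regular_births.parents x i = regular_births.parents y i)
    \<longleftrightarrow> regular_births.hist x n = regular_births.hist y n"
proof (induction n)
  case 0
  then show ?case by (simp add: regular_births.hist_0[OF x] regular_births.hist_0[OF y])
next
  case (Suc n)
  interpret x: regular_births x by fact
  interpret y: regular_births y by fact
  have S: "{2..Suc (Suc n)} = insert (Suc (Suc n)) {2..Suc n}" by auto
  show ?case
  proof
    assume l: "\<forall>i\<in>{2..Suc (Suc n)}. x.parents i = y.parents i"
    then have eq: "x.hist n = y.hist n" using Suc by (simp add: S)
    have "label (x.hist n) (tl (newest (x.hist (Suc n)))) = label (x.hist n) (tl (newest (y.hist (Suc n))))"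
      using l x.parents_Suc[of n] y.parents_Suc[of n] by (simp add: eq)
    moreover have c: "newest (x.hist (Suc n)) \<in> candidates (x.hist n)" "newest (y.hist (Suc n)) \<in> candidates (x.hist n)"
      using x.newest_candidate[of n] y.newest_candidate[of n] unfolding eq by simp_all
    moreover have "tl w \<in> alive (x.hist n)" if "w \<in> candidates (x.hist n)" for w
      using that tl_candidates[OF x.hist(1)[of n]] by blast
    ultimately have "tl (newest (x.hist (Suc n))) = tl (newest (y.hist (Suc n)))"
      using inj_onD[OF label_inj[OF x.hist(1)[of n]]] by blast
    then have "newest (x.hist (Suc n)) = newest (y.hist (Suc n))"
      using inj_onD[OF candidates_inj[OF x.hist(1)[of n]]] c by blast
    then show "x.hist (Suc n) = y.hist (Suc n)" using x.hist_Suc[of n] y.hist_Suc[of n] eq by metis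
  next
    assume r: "x.hist (Suc n) = y.hist (Suc n)"
    then have eq: "x.hist n = y.hist n" using x.hist_Suc[of n] y.hist_Suc[of n] by (metis list.inject)
    then have "x.parents (Suc (Suc n)) = y.parents (Suc (Suc n))"
      using x.parents_Suc[of n] y.parents_Suc[of n] r by simp
    then show "\<forall>i\<in>{2..Suc (Suc n)}. x.parents i = y.parents i" using Suc eq by (simp add: S)
  qed
qed

section \<open>The law of the branching process\<close>

text \<open>Differences of points, because these, unlike the points themselves, are independent for
  one parent.\<close>

definition clock :: "(nat list \<Rightarrow> nat \<Rightarrow> real) \<Rightarrow> nat list \<Rightarrow> real" where
  "clock x v = x (tl v) (hd v) - (if hd v = 0 then 0 else x (tl v) (hd v - 1))"

lemma sum_clock: "(\<Sum>j\<le>k. clock x (j # u)) = x u k"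
  by (induction k) (auto simp: clock_def)

lemma clock_time_clock: "clock_time (\<lambda>v\<in>- {[]}. clock x v) = birth_time x"
proof
  fix v show "clock_time (\<lambda>v\<in>- {[]}. clock x v) v = birth_time x v"
    by (induction v) (simp_all add: sum_clock)
qed

lemma siblings_set: "finite K \<Longrightarrow> (\<And>v. v \<in> K \<Longrightarrow> B v \<in> sets borel) \<Longrightarrow>
  {s. \<forall>v\<in>K. s (hd v) - (if hd v = 0 then 0 else s (hd v - 1)) \<in> B v} \<in> sets (\<Pi>\<^sub>M k\<in>(UNIV :: nat set). (borel :: real measure))"
proof -
  assume K: "finite K" "\<And>v. v \<in> K \<Longrightarrow> B v \<in> sets (borel :: real measure)"
  let ?P = "\<Pi>\<^sub>M k\<in>(UNIV :: nat set). (borel :: real measure)"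
  have c[measurable]: "(\<lambda>s. s k) \<in> borel_measurable ?P" for k
    using measurable_component_singleton[of k UNIV "\<lambda>_. borel :: real measure"] by simp
  have "Measurable.pred ?P (\<lambda>s. \<forall>v\<in>K. s (hd v) - (if hd v = 0 then 0 else s (hd v - 1)) \<in> B v)"
  proof (intro pred_intros_finite K(1))
    fix v assume "v \<in> K"
    note [measurable] = K(2)[OF this]
    show "Measurable.pred ?P (\<lambda>s. s (hd v) - (if hd v = 0 then 0 else s (hd v - 1)) \<in> B v)"
      by measurable
  qed
  then show ?thesis by (simp add: pred_def space_PiM)
qed

lemma births_follow_measurable[measurable]:
  assumes [measurable]: "\<And>v. (\<lambda>\<omega>. b \<omega> v) \<in> borel_measurable L"
  shows "Measurable.pred L (\<lambda>\<omega>. births_follow (b \<omega>) vs)"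
proof (induction vs)
  case (Cons v vs)
  have [measurable]: "Measurable.pred L (\<lambda>\<omega>. \<forall>w\<in>candidates vs - {v}. b \<omega> v < b \<omega> w)"
    by (intro pred_intros_finite) auto
  note [measurable] = Cons
  show ?case unfolding births_follow.simps by measurable
qed simp

lemma gap_prod_measurable[measurable]:
  assumes [measurable]: "\<And>v. (\<lambda>\<omega>. b \<omega> v) \<in> borel_measurable L" "\<And>l. g l \<in> borel_measurable borel"
  shows "(\<lambda>\<omega>. gap_prod g (b \<omega>) vs) \<in> borel_measurable L"
  by (induction vs) auto

locale branching =
  fixes a :: real and N :: "'b measure" and \<xi> :: "'b \<Rightarrow> nat \<Rightarrow> real"
    and M :: "'a measure" and X :: "nat list \<Rightarrow> 'a \<Rightarrow> nat \<Rightarrow> real" and E :: "nat \<Rightarrow> 'b \<Rightarrow> real"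
  assumes a: "0 < a" and N: "prob_space N" and M: "prob_space M"
    and E_indep: "prob_space.indep_vars N (\<lambda>_. borel) E UNIV"
    and E_exp: "distributed N lborel (E k) (exponential_density (real k + a))"
    and \<xi>: "\<omega> \<in> space N \<Longrightarrow> \<xi> \<omega> k = (\<Sum>i\<le>k. E i \<omega>)"
    and iid: "iid_copies M X N \<xi>"
begin

sublocale N: prob_space N by (rule N)
sublocale M: prob_space M by (rule M)

lemma E_measurable[measurable]: "E k \<in> borel_measurable N"
  using distributed_measurable[OF E_exp[of k]] by simp

lemma \<xi>_component[measurable]: "(\<lambda>\<omega>. \<xi> \<omega> k) \<in> borel_measurable N"
  using \<xi> by (subst measurable_cong[where g = "\<lambda>\<omega>. \<Sum>i\<le>k. E i \<omega>"]) auto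

lemma \<xi>_measurable[measurable]: "\<xi> \<in> N \<rightarrow>\<^sub>M (\<Pi>\<^sub>M k\<in>UNIV. borel)"
  by (rule measurable_abs_UNIV) measurable

lemma X_indep: "M.indep_vars (\<lambda>_. \<Pi>\<^sub>M k\<in>UNIV. borel) X UNIV"
  using iid by (simp add: iid_copies_def)

lemma X_measurable[measurable]: "X u \<in> M \<rightarrow>\<^sub>M (\<Pi>\<^sub>M k\<in>UNIV. borel)"
  using X_indep by (auto simp: M.indep_vars_def)

lemma X_component[measurable]: "(\<lambda>\<omega>. X u \<omega> k) \<in> borel_measurable M"
  using measurable_compose[OF X_measurable measurable_component_singleton[of k UNIV "\<lambda>_. borel"]] by simp

lemma prob_X: "S \<in> sets (\<Pi>\<^sub>M k\<in>UNIV. borel) \<Longrightarrow> M.prob (X u -` S \<inter> space M) = N.prob (\<xi> -` S \<inter> space N)"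
  using iid measure_distr[OF X_measurable, of S u] measure_distr[OF \<xi>_measurable, of S]
  by (simp add: iid_copies_def)

abbreviation x :: "'a \<Rightarrow> nat list \<Rightarrow> nat \<Rightarrow> real" where "x \<omega> \<equiv> (\<lambda>u. X u \<omega>)"

lemma clock_measurable[measurable]: "(\<lambda>\<omega>. clock (x \<omega>) v) \<in> borel_measurable M"
  unfolding clock_def by measurable

text \<open>Siblings read off one copy of \<open>\<xi>\<close>, which has the same law on sequences;
  there the differences of consecutive points are the independent \<open>E\<close>.\<close>

lemma prob_clocks_siblings:
  assumes K: "finite K" "K \<subseteq> {v. v \<noteq> [] \<and> tl v = u}" "K \<noteq> {}" and B: "\<And>v. v \<in> K \<Longrightarrow> B v \<in> sets borel"
  shows "M.prob {\<omega>\<in>space M. \<forall>v\<in>K. clock (x \<omega>) v \<in> B v}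
    = (\<Prod>v\<in>K. N.prob (E (hd v) -` B v \<inter> space N))"
proof -
  \<comment> \<open>Siblings are told apart by their heads, which turns the product over
    \<open>K\<close> into one over indices of \<open>E\<close>.\<close>
  have inj: "inj_on hd K" using K(2) by (intro inj_onI) (metis (mono_tags) list.expand mem_Collect_eq subsetD)
  let ?S = "{s. \<forall>v\<in>K. s (hd v) - (if hd v = 0 then 0 else s (hd v - 1)) \<in> B v}"
  have S: "?S \<in> sets (\<Pi>\<^sub>M k\<in>(UNIV :: nat set). (borel :: real measure))"
    using siblings_set[OF K(1) B] .
  have "{\<omega>\<in>space M. \<forall>v\<in>K. clock (x \<omega>) v \<in> B v} = X u -` ?S \<inter> space M"
    using K(2) by (auto simp: clock_def)
  then have "M.prob {\<omega>\<in>space M. \<forall>v\<in>K. clock (x \<omega>) v \<in> B v} = N.prob (\<xi> -` ?S \<inter> space N)"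
    using prob_X[OF S] by simp
  also have "\<xi> -` ?S \<inter> space N = (\<Inter>k\<in>hd ` K. E k -` B (the_inv_into K hd k) \<inter> space N)"
  proof -
    have *: "\<xi> \<omega> k - (if k = 0 then 0 else \<xi> \<omega> (k - 1)) = E k \<omega>" if "\<omega> \<in> space N" for \<omega> k
      using that by (cases k) (auto simp: \<xi>)
    have "\<xi> -` ?S \<inter> space N
        = {\<omega>\<in>space N. \<forall>v\<in>K. \<xi> \<omega> (hd v) - (if hd v = 0 then 0 else \<xi> \<omega> (hd v - 1)) \<in> B v}"
      by blast
    also have "\<dots> = {\<omega>\<in>space N. \<forall>v\<in>K. E (hd v) \<omega> \<in> B v}"
      by (intro Collect_cong conj_cong refl ball_cong) (simp only: *)
    finally show ?thesis using K(3) by (auto simp: the_inv_into_f_f[OF inj])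
  qed
  also have "N.prob \<dots> = (\<Prod>k\<in>hd ` K. N.prob (E k -` B (the_inv_into K hd k) \<inter> space N))"
    using K B by (intro N.indep_varsD[OF E_indep]) (auto simp: the_inv_into_f_f[OF inj])
  also have "\<dots> = (\<Prod>v\<in>K. N.prob (E (hd v) -` B v \<inter> space N))"
    by (subst prod.reindex[OF inj]) (simp add: the_inv_into_f_f[OF inj])
  finally show ?thesis .
qed

text \<open>Two layers of independence: different families are independent by the copies, and within
  a family \<open>prob_clocks_siblings\<close> applies. The right-hand side involves the
  \<open>E\<close> alone, so the marginal laws and the independence of all clocks both follow from
  it.\<close>

lemma prob_clocks:
  assumes J: "finite J" "[] \<notin> J" "J \<noteq> {}" and B: "\<And>v. v \<in> J \<Longrightarrow> B v \<in> sets borel"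
  shows "M.prob {\<omega>\<in>space M. \<forall>v\<in>J. clock (x \<omega>) v \<in> B v}
    = (\<Prod>v\<in>J. N.prob (E (hd v) -` B v \<inter> space N))"
proof -
  let ?K = "\<lambda>u. {v\<in>J. tl v = u}"
  let ?S = "\<lambda>u. {s. \<forall>v\<in>?K u. s (hd v) - (if hd v = 0 then 0 else s (hd v - 1)) \<in> B v}"
  have S: "?S u \<in> sets (\<Pi>\<^sub>M k\<in>(UNIV :: nat set). (borel :: real measure))" for u
    using J B by (intro siblings_set) auto
  have eq: "X u -` ?S u \<inter> space M = {\<omega>\<in>space M. \<forall>v\<in>?K u. clock (x \<omega>) v \<in> B v}" for u
    by (auto simp: clock_def)
  have "{\<omega>\<in>space M. \<forall>v\<in>J. clock (x \<omega>) v \<in> B v} = (\<Inter>u\<in>tl ` J. X u -` ?S u \<inter> space M)"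
    unfolding eq using J by auto
  also have "M.prob \<dots> = (\<Prod>u\<in>tl ` J. M.prob (X u -` ?S u \<inter> space M))"
    using J S by (intro M.indep_varsD[OF X_indep]) auto
  also have "\<dots> = (\<Prod>u\<in>tl ` J. \<Prod>v\<in>?K u. N.prob (E (hd v) -` B v \<inter> space N))"
    unfolding eq using J B by (intro prod.cong refl prob_clocks_siblings) auto
  also have "\<dots> = (\<Prod>v\<in>J. N.prob (E (hd v) -` B v \<inter> space N))"
    using J by (intro prod.group) auto
  finally show ?thesis .
qed

lemma distr_clock: "v \<noteq> [] \<Longrightarrow> distr M borel (\<lambda>\<omega>. clock (x \<omega>) v) = expo (rate a v)"
proof -
  assume v: "v \<noteq> []"
  have "distr M borel (\<lambda>\<omega>. clock (x \<omega>) v) = distr N borel (E (hd v))"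
  proof (rule measure_eqI)
    fix A assume "A \<in> sets (distr M borel (\<lambda>\<omega>. clock (x \<omega>) v))"
    then have A: "A \<in> sets borel" by simp
    have "M.prob ((\<lambda>\<omega>. clock (x \<omega>) v) -` A \<inter> space M) = N.prob (E (hd v) -` A \<inter> space N)"
      using prob_clocks[of "{v}" "\<lambda>_. A"] v A by (simp add: vimage_def Int_def conj_commute)
    then show "emeasure (distr M borel (\<lambda>\<omega>. clock (x \<omega>) v)) A = emeasure (distr N borel (E (hd v))) A"
      using A by (simp add: emeasure_distr M.emeasure_eq_measure N.emeasure_eq_measure)
  qed simp
  also have "\<dots> = distr N lborel (E (hd v))" by (rule distr_cong) auto
  also have "\<dots> = expo (rate a v)"
    using distributed_distr_eq_density[OF E_exp[of "hd v"]] by (simp add: rate_def)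
  finally show ?thesis .
qed

lemma clocks_indep: "M.indep_vars (\<lambda>_. borel) (\<lambda>v \<omega>. clock (x \<omega>) v) (- {[]})"
  unfolding M.indep_vars_def2
proof (intro conjI ballI M.indep_setsI)
  fix A J assume J: "J \<noteq> {}" "J \<subseteq> - {[]}" "finite J"
    and A: "\<forall>v\<in>J. A v \<in> {(\<lambda>\<omega>. clock (x \<omega>) v) -` B \<inter> space M |B. B \<in> sets borel}"
  then obtain B where B: "\<And>v. v \<in> J \<Longrightarrow> A v = (\<lambda>\<omega>. clock (x \<omega>) v) -` B v \<inter> space M \<and> B v \<in> sets borel"
    by (simp add: bchoice_iff) metis
  have single: "M.prob (A v) = N.prob (E (hd v) -` B v \<inter> space N)" if "v \<in> J" for v
    using prob_clocks[of "{v}" B] B[OF that] that J by (auto simp: vimage_def Int_def conj_commute)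
  have "(\<Inter>v\<in>J. A v) = {\<omega>\<in>space M. \<forall>v\<in>J. clock (x \<omega>) v \<in> B v}"
    using J B by auto
  also have "M.prob \<dots> = (\<Prod>v\<in>J. N.prob (E (hd v) -` B v \<inter> space N))"
    using J B by (intro prob_clocks) auto
  finally show "M.prob (\<Inter>v\<in>J. A v) = (\<Prod>v\<in>J. M.prob (A v))" using single by simp
qed auto

lemma distr_clocks:
  "distr M (\<Pi>\<^sub>M v\<in>- {[]}. borel) (\<lambda>\<omega>. \<lambda>v\<in>- {[]}. clock (x \<omega>) v) = (\<Pi>\<^sub>M v\<in>- {[]}. expo (rate a v))"
proof -
  have "- {[]} \<noteq> ({} :: nat list set)" by auto
  then have "distr M (\<Pi>\<^sub>M v\<in>- {[]}. borel) (\<lambda>\<omega>. \<lambda>v\<in>- {[]}. clock (x \<omega>) v)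
      = (\<Pi>\<^sub>M v\<in>- {[]}. distr M borel (\<lambda>\<omega>. clock (x \<omega>) v))"
    using clocks_indep by (subst (asm) M.indep_vars_iff_distr_eq_PiM) auto
  also have "\<dots> = (\<Pi>\<^sub>M v\<in>- {[]}. expo (rate a v))"
    by (rule PiM_cong) (auto simp: distr_clock)
  finally show ?thesis .
qed

lemma birth_time_measurable[measurable]: "(\<lambda>\<omega>. birth_time (x \<omega>) v) \<in> borel_measurable M"
  by (induction v) auto

text \<open>The birth times depend on the clocks only, so the integral moves to the product space,
  where the race computation applies with constant \<open>H\<close>.\<close>

lemma nn_integral_births:
  assumes h: "history vs" and g[measurable]: "\<And>l. g l \<in> borel_measurable borel"
  shows "(\<integral>\<^sup>+\<omega>. (if births_follow (birth_time (x \<omega>)) vs then gap_prod g (birth_time (x \<omega>)) vs else 0) \<partial>M)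
    = ennreal (history_prob a vs) * (\<Prod>l<length vs. \<integral>\<^sup>+s. g l s \<partial>expo (total_rate a l))"
proof -
  let ?P = "\<Pi>\<^sub>M v\<in>- {[]}. (borel :: real measure)"
  let ?Q = "\<Pi>\<^sub>M v\<in>- {[]}. expo (rate a v)"
  let ?f = "\<lambda>e. if births_follow (clock_time e) vs then gap_prod g (clock_time e) vs * 1 else 0"
  have c[measurable]: "(\<lambda>e. e v) \<in> borel_measurable ?P" if "v \<noteq> []" for v
    using measurable_component_singleton[of v "- {[]}" "\<lambda>_. borel :: real measure"] that by simp
  have [measurable]: "(\<lambda>e. clock_time e v) \<in> borel_measurable ?P" for v
    by (induction v) auto
  have f: "?f \<in> borel_measurable ?P" by measurable
  have "(\<integral>\<^sup>+\<omega>. (if births_follow (birth_time (x \<omega>)) vs then gap_prod g (birth_time (x \<omega>)) vs else 0) \<partial>M)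
      = (\<integral>\<^sup>+\<omega>. ?f (\<lambda>v\<in>- {[]}. clock (x \<omega>) v) \<partial>M)"
    unfolding clock_time_clock by (simp cong: if_cong)
  also have "\<dots> = (\<integral>\<^sup>+e. ?f e \<partial>distr M ?P (\<lambda>\<omega>. \<lambda>v\<in>- {[]}. clock (x \<omega>) v))"
    using f by (subst nn_integral_distr) (auto intro!: measurable_restrict)
  also have "\<dots> = (\<integral>\<^sup>+e. ?f e \<partial>?Q)" unfolding distr_clocks ..
  also have "\<dots> = ennreal (history_prob a vs) * (\<Prod>l<length vs. \<integral>\<^sup>+s. g l s \<partial>expo (total_rate a l))
      * (\<integral>\<^sup>+r. 1 \<partial>PiM (- alive vs) (\<lambda>v. expo (rate a v)))"
    by (rule nn_integral_history[OF a h g]) auto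
  also have "(\<integral>\<^sup>+r. 1 \<partial>PiM (- alive vs) (\<lambda>v. expo (rate a v))) = 1"
  proof -
    interpret prob_space "PiM (- alive vs) (\<lambda>v. expo (rate a v))"
      using rate_pos[OF a] by (intro prob_space_PiM prob_space_exponential_density)
    show ?thesis by (simp add: emeasure_space_1)
  qed
  finally show ?thesis by simp
qed

end

section \<open>Existence of histories and moments of the gaps\<close>

lemma gap_prod_1: "gap_prod (\<lambda>_ _. 1) b vs = 1"
  by (induction vs) auto

lemma nn_integral_expo_power:
  assumes "0 < r"
  shows "(\<integral>\<^sup>+y. ennreal (y ^ i) \<partial>expo r) = ennreal (fact i / r ^ i)"
proof -
  have "(\<integral>\<^sup>+y. ennreal (y ^ i) \<partial>expo r) = (\<integral>\<^sup>+y. ennreal (erlang_density 0 r y * y ^ i) \<partial>lborel)"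
    using assms by (subst nn_integral_expo)
      (auto intro!: nn_integral_cong simp: ennreal_mult' exponential_density_nonneg)
  also have "\<dots> = ennreal (fact i / r ^ i)"
    using nn_integral_erlang_ith_moment[OF assms, of 0 i] by simp
  finally show ?thesis .
qed

lemma sum_follow:
  fixes f :: "nat list list \<Rightarrow> 'c::comm_monoid_add"
  assumes "vs \<in> histories n" "births_follow b vs"
  shows "(\<Sum>us\<in>histories n. if births_follow b us then f us else 0) = f vs"
proof -
  have "(\<Sum>us\<in>histories n. if births_follow b us then f us else 0)
      = (\<Sum>us\<in>histories n. if us = vs then f vs else 0)"
    using assms births_follow_unique by (intro sum.cong refl) (auto simp: histories_def)
  then show ?thesis using assms by simp
qed

context branching
begin

lemma prob_births_follow:
  assumes "history vs"
  shows "M.prob {\<omega>\<in>space M. births_follow (birth_time (x \<omega>)) vs} = history_prob a vs"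
proof -
  let ?A = "{\<omega>\<in>space M. births_follow (birth_time (x \<omega>)) vs}"
  have A: "?A \<in> sets M" by measurable
  have "emeasure M ?A = (\<integral>\<^sup>+\<omega>. indicator ?A \<omega> \<partial>M)" using A by simp
  also have "\<dots> = (\<integral>\<^sup>+\<omega>. (if births_follow (birth_time (x \<omega>)) vs then gap_prod (\<lambda>_ _. 1) (birth_time (x \<omega>)) vs else 0) \<partial>M)"
    by (intro nn_integral_cong) (simp add: gap_prod_1)
  also have "\<dots> = ennreal (history_prob a vs) * (\<Prod>l<length vs. \<integral>\<^sup>+s. 1 \<partial>expo (total_rate a l))"
    by (rule nn_integral_births[OF assms]) simp
  also have "(\<Prod>l<length vs. \<integral>\<^sup>+s. 1 \<partial>expo (total_rate a l)) = 1"
    using nn_integral_expo_power[OF total_rate_pos[OF a], of _ 0] by (intro prod.neutral) simp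
  finally show ?thesis
    using history_prob_nonneg[OF a, of vs] by (simp add: M.emeasure_eq_measure)
qed

lemma AE_increasing: "AE \<omega> in M. increasing_births (x \<omega>)"
proof -
  have "AE \<omega> in M. v \<noteq> [] \<longrightarrow> 0 < clock (x \<omega>) v" for v
  proof (cases "v = []")
    case False
    have "AE y in expo (rate a v). 0 < y" by (rule AE_expo_pos)
    then have "AE y in distr M borel (\<lambda>\<omega>. clock (x \<omega>) v). 0 < y" unfolding distr_clock[OF False] .
    then show ?thesis by (subst (asm) AE_distr_iff) auto
  qed simp
  then have "AE \<omega> in M. \<forall>v. v \<noteq> [] \<longrightarrow> 0 < clock (x \<omega>) v" by (simp add: AE_all_countable)
  then show ?thesis
  proof eventually_elim
    case (elim \<omega>)
    have "0 < X u \<omega> 0 \<and> X u \<omega> k < X u \<omega> (Suc k)" for u k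
      using elim[rule_format, of "0 # u"] elim[rule_format, of "Suc k # u"] by (simp add: clock_def)
    then show ?case by (auto simp: increasing_births_def)
  qed
qed

text \<open>Ties are excluded all at once: the events of following different histories of length
  \<open>n\<close> are disjoint, and their probabilities already sum to 1.\<close>

lemma AE_ex_history: "AE \<omega> in M. \<forall>n. \<exists>vs\<in>histories n. births_follow (birth_time (x \<omega>)) vs"
  unfolding AE_all_countable
proof
  fix n
  let ?A = "\<lambda>vs. {\<omega>\<in>space M. births_follow (birth_time (x \<omega>)) vs}"
  have "M.prob (\<Union>vs\<in>histories n. ?A vs) = (\<Sum>vs\<in>histories n. M.prob (?A vs))"
  proof (rule M.finite_measure_finite_Union)
    show "disjoint_family_on ?A (histories n)"
      unfolding disjoint_family_on_def histories_def using births_follow_unique by fastforce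
  qed auto
  also have "\<dots> = (\<Sum>vs\<in>histories n. history_prob a vs * 1)"
    by (intro sum.cong) (auto simp: prob_births_follow histories_def)
  also have "\<dots> = 1" using history_mean_const[OF a, of n 1] by (simp add: history_mean_def)
  finally have "AE \<omega> in M. \<omega> \<in> (\<Union>vs\<in>histories n. ?A vs)"
    by (subst (asm) M.prob_eq_1) auto
  then show "AE \<omega> in M. \<exists>vs\<in>histories n. births_follow (birth_time (x \<omega>)) vs" by eventually_elim auto
qed

text \<open>At most one term of the sum is nonzero; this form makes measurability immediate.\<close>

definition birth_at :: "nat \<Rightarrow> 'a \<Rightarrow> real" where
  "birth_at n \<omega> = (\<Sum>us\<in>histories n. if births_follow (birth_time (x \<omega>)) us
     then birth_time (x \<omega>) (newest us) else 0)"

definition gap :: "nat \<Rightarrow> 'a \<Rightarrow> real" where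
  "gap l \<omega> = birth_at (Suc l) \<omega> - birth_at l \<omega>"

lemma birth_at_measurable[measurable]: "birth_at n \<in> borel_measurable M"
  unfolding birth_at_def[abs_def] by measurable

lemma gap_measurable[measurable]: "gap n \<in> borel_measurable M"
  unfolding gap_def[abs_def] by measurable

lemma birth_at_newest:
  "history vs \<Longrightarrow> births_follow (birth_time (x \<omega>)) vs \<Longrightarrow> birth_at (length vs) \<omega> = birth_time (x \<omega>) (newest vs)"
  unfolding birth_at_def by (rule sum_follow) (auto simp: histories_def)

lemma birth_at_0: "birth_at 0 \<omega> = 0"
  by (simp add: birth_at_def)

lemma gap_prod_gaps:
  "history vs \<Longrightarrow> births_follow (birth_time (x \<omega>)) vs \<Longrightarrow>
    gap_prod g (birth_time (x \<omega>)) vs = (\<Prod>l<length vs. g l (gap l \<omega>))"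
proof (induction vs)
  case (Cons v vs)
  then show ?case
    using birth_at_newest[of "v # vs" \<omega>] birth_at_newest[of vs \<omega>] by (simp add: gap_def)
qed simp

lemma AE_gap_pos: "AE \<omega> in M. \<forall>l. 0 < gap l \<omega>"
  using AE_increasing AE_ex_history
proof eventually_elim
  case (elim \<omega>)
  show ?case
  proof
    fix l
    obtain us where us: "us \<in> histories (Suc l)" "births_follow (birth_time (x \<omega>)) us" using elim by blast
    then obtain v vs where vs: "us = v # vs" by (cases us) (auto simp: histories_def)
    have h: "history (v # vs)" "length vs = l" "births_follow (birth_time (x \<omega>)) (v # vs)"
      using us vs by (auto simp: histories_def)
    then have "birth_time (x \<omega>) (newest vs) < birth_time (x \<omega>) v"
      using birth_time_order[OF elim(1), of vs] by simp
    then show "0 < gap l \<omega>"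
      using birth_at_newest[of "v # vs" \<omega>] birth_at_newest[of vs \<omega>] h by (simp add: gap_def)
  qed
qed

text \<open>For each history the integral is its probability times a product that does not depend on
  it; summing over all histories removes the tree. This expresses that the gaps are independent
  exponentials.\<close>

lemma nn_integral_gaps:
  assumes g[measurable]: "\<And>l. g l \<in> borel_measurable borel"
  shows "(\<integral>\<^sup>+\<omega>. (\<Prod>l<n. g l (gap l \<omega>)) \<partial>M) = (\<Prod>l<n. \<integral>\<^sup>+s. g l s \<partial>expo (total_rate a l))"
proof -
  let ?f = "\<lambda>vs \<omega>. if births_follow (birth_time (x \<omega>)) vs then gap_prod g (birth_time (x \<omega>)) vs else 0"
  have "AE \<omega> in M. (\<Prod>l<n. g l (gap l \<omega>)) = (\<Sum>vs\<in>histories n. ?f vs \<omega>)"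
    using AE_ex_history
  proof eventually_elim
    case (elim \<omega>)
    then obtain vs where vs: "vs \<in> histories n" "births_follow (birth_time (x \<omega>)) vs" by blast
    then show ?case
      using gap_prod_gaps[of vs \<omega> g] sum_follow[OF vs, of "gap_prod g (birth_time (x \<omega>))"]
      by (simp add: histories_def)
  qed
  then have "(\<integral>\<^sup>+\<omega>. (\<Prod>l<n. g l (gap l \<omega>)) \<partial>M) = (\<integral>\<^sup>+\<omega>. (\<Sum>vs\<in>histories n. ?f vs \<omega>) \<partial>M)"
    by (rule nn_integral_cong_AE)
  also have "\<dots> = (\<Sum>vs\<in>histories n. \<integral>\<^sup>+\<omega>. ?f vs \<omega> \<partial>M)"
    by (rule nn_integral_sum) measurable
  also have "\<dots> = (\<Sum>vs\<in>histories n. ennreal (history_prob a vs) * (\<Prod>l<n. \<integral>\<^sup>+s. g l s \<partial>expo (total_rate a l)))"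
    using nn_integral_births[OF _ g] by (intro sum.cong refl) (auto simp: histories_def)
  also have "\<dots> = ennreal (\<Sum>vs\<in>histories n. history_prob a vs) * (\<Prod>l<n. \<integral>\<^sup>+s. g l s \<partial>expo (total_rate a l))"
    using history_prob_nonneg[OF a] by (simp add: sum_distrib_right[symmetric])
  also have "(\<Sum>vs\<in>histories n. history_prob a vs) = 1"
    using history_mean_const[OF a, of n 1] by (simp add: history_mean_def)
  finally show ?thesis by simp
qed

abbreviation W :: "nat \<Rightarrow> real" where "W \<equiv> total_rate a"

lemma W_pos: "0 < W l" by (rule total_rate_pos[OF a])

lemma W_ge: "a * real (Suc l) \<le> W l"
  using a by (simp add: total_rate_def algebra_simps)

lemma gap_moment: "has_bochner_integral M (\<lambda>\<omega>. gap l \<omega> ^ i) (fact i / W l ^ i)"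
proof (rule has_bochner_integral_nn_integral)
  \<comment> \<open>The constant 1 in all other factors isolates the gap \<open>l\<close>.\<close>
  let ?g = "\<lambda>k y. if k = l then ennreal (y ^ i) else 1"
  have "(\<integral>\<^sup>+\<omega>. ennreal (gap l \<omega> ^ i) \<partial>M) = (\<integral>\<^sup>+\<omega>. (\<Prod>k<Suc l. ?g k (gap k \<omega>)) \<partial>M)"
    by (intro nn_integral_cong) (simp add: prod.neutral)
  also have "\<dots> = (\<Prod>k<Suc l. \<integral>\<^sup>+s. ?g k s \<partial>expo (W k))"
    by (rule nn_integral_gaps) auto
  also have "\<dots> = (\<integral>\<^sup>+s. ennreal (s ^ i) \<partial>expo (W l))"
    using nn_integral_expo_power[OF W_pos, of _ 0] by (simp add: prod.neutral)
  also have "\<dots> = ennreal (fact i / W l ^ i)" by (rule nn_integral_expo_power[OF W_pos])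
  finally show "(\<integral>\<^sup>+\<omega>. ennreal (gap l \<omega> ^ i) \<partial>M) = ennreal (fact i / W l ^ i)" .
  show "AE \<omega> in M. 0 \<le> gap l \<omega> ^ i" using AE_gap_pos by eventually_elim (simp add: less_imp_le)
  show "0 \<le> fact i / W l ^ i" using W_pos[of l] by simp
qed measurable

lemma gap_product_less:
  assumes "i < j"
  shows "has_bochner_integral M (\<lambda>\<omega>. gap i \<omega> * gap j \<omega>) (1 / (W i * W j))"
proof (rule has_bochner_integral_nn_integral)
  let ?g = "\<lambda>k y. if k = j then ennreal y else if k = i then ennreal y else 1"
  have P: "(\<Prod>k<Suc j. if k = j then F k else if k = i then F k else 1) = F i * F j" for F :: "nat \<Rightarrow> ennreal"
  proof -
    have "(\<Prod>k<j. if k = j then F k else if k = i then F k else 1) = (\<Prod>k<j. if k = i then F k else 1)"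
      by (intro prod.cong) auto
    also have "\<dots> = F i" using assms by (simp add: prod.delta)
    finally show ?thesis by simp
  qed
  have "(\<integral>\<^sup>+\<omega>. ennreal (gap i \<omega> * gap j \<omega>) \<partial>M) = (\<integral>\<^sup>+\<omega>. (\<Prod>k<Suc j. ?g k (gap k \<omega>)) \<partial>M)"
  proof (rule nn_integral_cong_AE)
    show "AE \<omega> in M. ennreal (gap i \<omega> * gap j \<omega>) = (\<Prod>k<Suc j. ?g k (gap k \<omega>))"
      using AE_gap_pos
    proof eventually_elim
      case (elim \<omega>)
      then show ?case unfolding P[of "\<lambda>k. ennreal (gap k \<omega>)"] by (simp add: ennreal_mult less_imp_le)
    qed
  qed
  also have "\<dots> = (\<Prod>k<Suc j. \<integral>\<^sup>+s. ?g k s \<partial>expo (W k))"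
    by (rule nn_integral_gaps) auto
  also have "\<dots> = (\<Prod>k<Suc j. if k = j then ennreal (1 / W k) else if k = i then ennreal (1 / W k) else 1)"
    using nn_integral_expo_power[OF W_pos, of _ 0] nn_integral_expo_power[OF W_pos, of _ 1]
    by (intro prod.cong refl) auto
  also have "\<dots> = ennreal (1 / (W i * W j))"
    unfolding P using W_pos[of i] W_pos[of j] by (simp add: ennreal_mult[symmetric])
  finally show "(\<integral>\<^sup>+\<omega>. ennreal (gap i \<omega> * gap j \<omega>) \<partial>M) = ennreal (1 / (W i * W j))" .
  show "AE \<omega> in M. 0 \<le> gap i \<omega> * gap j \<omega>" using AE_gap_pos by eventually_elim (simp add: less_imp_le)
  show "0 \<le> 1 / (W i * W j)" using W_pos[of i] W_pos[of j] by simp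
qed measurable

lemma gap_product: "i \<noteq> j \<Longrightarrow> has_bochner_integral M (\<lambda>\<omega>. gap i \<omega> * gap j \<omega>) (1 / (W i * W j))"
  using gap_product_less[of i j] gap_product_less[of j i] by (cases "i < j") (auto simp: mult.commute)

lemma gap_covariance:
  "has_bochner_integral M (\<lambda>\<omega>. (gap i \<omega> - 1 / W i) * (gap j \<omega> - 1 / W j)) (if i = j then 1 / (W i)\<^sup>2 else 0)"
proof -
  have 1: "has_bochner_integral M (\<lambda>\<omega>. gap l \<omega>) (1 / W l)" for l
    using gap_moment[of l 1] by simp
  have 2: "has_bochner_integral M (\<lambda>\<omega>. gap i \<omega> * gap j \<omega>) (if i = j then 2 / (W i)\<^sup>2 else 1 / (W i * W j))"
    using gap_moment[of i 2] gap_product[of i j] by (auto simp: power2_eq_square)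
  have 3: "has_bochner_integral M (\<lambda>\<omega>. 1 / (W i * W j)) (1 / (W i * W j))"
    by (simp add: has_bochner_integral_iff M.prob_space)
  have "has_bochner_integral M (\<lambda>\<omega>. gap i \<omega> * gap j \<omega> - gap i \<omega> * (1 / W j) - gap j \<omega> * (1 / W i) + 1 / (W i * W j))
      ((if i = j then 2 / (W i)\<^sup>2 else 1 / (W i * W j)) - 1 / W i * (1 / W j) - 1 / W j * (1 / W i) + 1 / (W i * W j))"
    by (intro has_bochner_integral_add has_bochner_integral_diff has_bochner_integral_mult_left 1 2 3)
  also have "((if i = j then 2 / (W i)\<^sup>2 else 1 / (W i * W j)) - 1 / W i * (1 / W j) - 1 / W j * (1 / W i) + 1 / (W i * W j))
      = (if i = j then 1 / (W i)\<^sup>2 else 0)"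
    by (auto simp: power2_eq_square)
  also have "(\<lambda>\<omega>. gap i \<omega> * gap j \<omega> - gap i \<omega> * (1 / W j) - gap j \<omega> * (1 / W i) + 1 / (W i * W j))
      = (\<lambda>\<omega>. (gap i \<omega> - 1 / W i) * (gap j \<omega> - 1 / W j))"
    by (auto simp: algebra_simps)
  finally show ?thesis .
qed

lemma gap_sum_variance:
  assumes "finite B"
  shows "has_bochner_integral M (\<lambda>\<omega>. (\<Sum>l\<in>B. gap l \<omega> - 1 / W l)\<^sup>2) (\<Sum>l\<in>B. 1 / (W l)\<^sup>2)"
proof -
  have "has_bochner_integral M (\<lambda>\<omega>. \<Sum>i\<in>B. \<Sum>j\<in>B. (gap i \<omega> - 1 / W i) * (gap j \<omega> - 1 / W j))
      (\<Sum>i\<in>B. \<Sum>j\<in>B. if i = j then 1 / (W i)\<^sup>2 else 0)"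
    by (intro has_bochner_integral_sum gap_covariance)
  then show ?thesis using assms by (simp add: power2_eq_square sum_product)
qed

end

section \<open>Growth of the population\<close>

lemma summable_inverse_squares: "summable (\<lambda>j. inverse (real (Suc j) ^ 2))"
  by (subst summable_Suc_iff) (rule inverse_power_summable, simp)

text \<open>By monotone convergence the sum has a finite mean, so it is finite almost surely. Both
  limits along the cubes rest on this.\<close>

lemma AE_summable_of_mean:
  fixes Z :: "nat \<Rightarrow> 'a \<Rightarrow> real"
  assumes [measurable]: "\<And>j. Z j \<in> borel_measurable M" and Z: "\<And>j \<omega>. 0 \<le> Z j \<omega>" and C: "0 \<le> C"
    and mean: "\<And>j. (\<integral>\<^sup>+\<omega>. ennreal (Z j \<omega>) \<partial>M) \<le> ennreal (C * inverse (real (Suc j) ^ 2))"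
  shows "AE \<omega> in M. summable (\<lambda>j. Z j \<omega>)"
proof -
  have "(\<integral>\<^sup>+\<omega>. (\<Sum>j. ennreal (Z j \<omega>)) \<partial>M) = (\<Sum>j. \<integral>\<^sup>+\<omega>. ennreal (Z j \<omega>) \<partial>M)"
    by (rule nn_integral_suminf) measurable
  also have "\<dots> \<le> (\<Sum>j. ennreal (C * inverse (real (Suc j) ^ 2)))"
    by (intro suminf_le mean summableI)
  also have "\<dots> = ennreal (\<Sum>j. C * inverse (real (Suc j) ^ 2))"
    using C by (intro suminf_ennreal2 summable_mult summable_inverse_squares) auto
  finally have "(\<integral>\<^sup>+\<omega>. (\<Sum>j. ennreal (Z j \<omega>)) \<partial>M) \<noteq> \<infinity>"
    by (auto simp: top_unique)
  then have "AE \<omega> in M. (\<Sum>j. ennreal (Z j \<omega>)) \<noteq> \<infinity>"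
    by (intro nn_integral_PInf_AE) auto
  then show ?thesis
    by eventually_elim (use Z in \<open>auto intro: summable_suminf_not_top\<close>)
qed

text \<open>The bases start at 1 to keep the cubes positive; below \<open>n = 0\<close> there is
  then no cube, whence the proviso in the lower bound.\<close>

lemma cube_brackets:
  obtains j :: "nat \<Rightarrow> nat" where "filterlim j at_top sequentially"
    and "\<And>n. 1 \<le> n \<Longrightarrow> Suc (j n) ^ 3 \<le> n" and "\<And>n. n < Suc (Suc (j n)) ^ 3"
proof -
  have "\<exists>j. (1 \<le> n \<longrightarrow> Suc j ^ 3 \<le> n) \<and> n < Suc (Suc j) ^ 3" for n :: nat
  proof (induction n)
    case 0
    show ?case by (intro exI[of _ 0]) simp
  next
    case (Suc n)
    then obtain j where j: "1 \<le> n \<longrightarrow> Suc j ^ 3 \<le> n" "n < Suc (Suc j) ^ 3" by blast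
    show ?case
    proof (cases "Suc n < Suc (Suc j) ^ 3")
      case True
      show ?thesis
      proof (cases "n = 0")
        case True
        then show ?thesis by (intro exI[of _ 0]) (simp add: numeral_3_eq_3)
      next
        case False
        with j True show ?thesis by (intro exI[of _ j]) auto
      qed
    next
      case False
      then have "Suc n = Suc (Suc j) ^ 3" using j by simp
      moreover have "Suc (Suc j) ^ 3 < Suc (Suc (Suc j)) ^ 3" by (rule power_strict_mono) auto
      ultimately show ?thesis by (intro exI[of _ "Suc j"]) simp
    qed
  qed
  then obtain j where j: "\<And>n. 1 \<le> n \<Longrightarrow> Suc (j n) ^ 3 \<le> n" "\<And>n. n < Suc (Suc (j n)) ^ 3" by metis
  have "filterlim j at_top sequentially"
    unfolding filterlim_at_top eventually_sequentially
  proof (intro allI exI impI)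
    fix Z n assume n: "Suc (Suc Z) ^ 3 \<le> n"
    have "Suc (Suc Z) ^ 3 < Suc (Suc (j n)) ^ 3" using n j(2)[of n] by linarith
    then have "Suc (Suc Z) < Suc (Suc (j n))" by (rule power_less_imp_less_base) simp
    then show "Z \<le> j n" by simp
  qed
  with j show thesis using that by blast
qed

lemma ln_cube_gap: "(\<lambda>j. ln (real (Suc (Suc j) ^ 3)) - ln (real (Suc j ^ 3))) \<longlonglongrightarrow> 0"
proof -
  have "(\<lambda>j :: nat. ln (real (Suc (Suc j))) - ln (real (Suc j))) \<longlonglongrightarrow> 0" by real_asymp
  from tendsto_mult_left[OF this, of 3] show ?thesis by (simp add: ln_realpow algebra_simps del: of_nat_Suc)
qed

text \<open>Between consecutive cubes \<open>T\<close> is squeezed by its values at them, and the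
  logarithm changes by an amount that tends to 0.\<close>

lemma convergent_from_cubes:
  fixes T :: "nat \<Rightarrow> real"
  assumes mono: "mono T" and \<alpha>: "0 < \<alpha>"
    and L: "(\<lambda>j. T (Suc j ^ 3) - ln (real (Suc j ^ 3)) / \<alpha>) \<longlonglongrightarrow> L"
  shows "(\<lambda>n. T n - ln (real n) / \<alpha>) \<longlonglongrightarrow> L"
proof -
  obtain j :: "nat \<Rightarrow> nat" where j: "filterlim j at_top sequentially"
    "\<And>n. 1 \<le> n \<Longrightarrow> Suc (j n) ^ 3 \<le> n" "\<And>n. n < Suc (Suc (j n)) ^ 3"
    using cube_brackets by blast
  let ?S = "\<lambda>j. T (Suc j ^ 3) - ln (real (Suc j ^ 3)) / \<alpha>"
  let ?d = "\<lambda>j. (ln (real (Suc (Suc j) ^ 3)) - ln (real (Suc j ^ 3))) / \<alpha>"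
  have d: "?d \<longlonglongrightarrow> 0" using tendsto_divide[OF ln_cube_gap tendsto_const[of \<alpha>]] \<alpha> by simp
  have lo: "(\<lambda>n. ?S (j n) - ?d (j n)) \<longlonglongrightarrow> L"
    using filterlim_compose[OF tendsto_diff[OF L d] j(1)] by simp
  have hi: "(\<lambda>n. ?S (Suc (j n)) + ?d (j n)) \<longlonglongrightarrow> L"
    using filterlim_compose[OF tendsto_add[OF LIMSEQ_Suc[OF L] d] j(1)] by simp
  show ?thesis
  proof (rule tendsto_sandwich[OF _ _ lo hi])
    show "\<forall>\<^sub>F n in sequentially. ?S (j n) - ?d (j n) \<le> T n - ln (real n) / \<alpha>"
      using eventually_ge_at_top[of 1]
    proof eventually_elim
      case (elim n)
      have "T (Suc (j n) ^ 3) \<le> T n" using mono j(2)[OF elim] by (rule monoD)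
      moreover have "ln (real n) / \<alpha> \<le> ln (real (Suc (Suc (j n)) ^ 3)) / \<alpha>"
        using j(3)[of n] elim \<alpha> by (intro divide_right_mono) (auto simp del: of_nat_power of_nat_Suc)
      ultimately show ?case by (simp add: diff_divide_distrib)
    qed
    show "\<forall>\<^sub>F n in sequentially. T n - ln (real n) / \<alpha> \<le> ?S (Suc (j n)) + ?d (j n)"
      using eventually_ge_at_top[of 1]
    proof eventually_elim
      case (elim n)
      have "T n \<le> T (Suc (Suc (j n)) ^ 3)" using mono j(3)[of n] by (intro monoD[of T]) auto
      moreover have "ln (real (Suc (j n) ^ 3)) / \<alpha> \<le> ln (real n) / \<alpha>"
        using j(2)[OF elim] elim \<alpha> by (intro divide_right_mono) (auto simp del: of_nat_power of_nat_Suc)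
      ultimately show ?case by (simp add: diff_divide_distrib)
    qed
  qed
qed

context branching
begin

text \<open>\<open>W l\<close> is \<open>(1 + a) * Suc l\<close> minus 1, so the sum differs from
  the harmonic numbers divided by \<open>1 + a\<close> by a convergent series; the constant of Euler
  and Mascheroni does the rest.\<close>

lemma sum_mean_gaps: "\<exists>\<gamma>. (\<lambda>n. (\<Sum>l<n. 1 / W l) - ln (real n) / (1 + a)) \<longlonglongrightarrow> \<gamma>"
proof -
  let ?\<alpha> = "1 + a"
  have \<alpha>: "0 < ?\<alpha>" using a by simp
  let ?d = "\<lambda>l. 1 / W l - 1 / (?\<alpha> * real (Suc l))"
  have "summable ?d"
  proof (rule summable_comparison_test)
    show "summable (\<lambda>l. 1 / a * inverse (real (Suc l) ^ 2))"
      by (intro summable_mult summable_inverse_squares)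
    show "\<exists>N. \<forall>l\<ge>N. norm (?d l) \<le> 1 / a * inverse (real (Suc l) ^ 2)"
    proof (intro exI allI impI)
      fix l :: nat
      define s where "s = real (Suc l)"
      have s: "1 \<le> s" by (simp add: s_def)
      have w: "W l = s * ?\<alpha> - 1" by (simp add: total_rate_def s_def)
      have wa: "a * s \<le> W l" using W_ge[of l] by (simp add: s_def)
      have d: "1 / W l - 1 / (?\<alpha> * s) = 1 / (W l * (?\<alpha> * s))"
        using W_pos[of l] \<alpha> s by (simp add: w field_simps)
      have "s \<le> ?\<alpha> * s" using a s by (simp add: algebra_simps)
      then have "a * s * s \<le> W l * (?\<alpha> * s)"
        using wa a s W_pos[of l] by (intro mult_mono) auto
      then have "1 / (W l * (?\<alpha> * s)) \<le> 1 / (a * s * s)" using a s W_pos[of l]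
        by (intro divide_left_mono mult_pos_pos) auto
      moreover have "0 \<le> 1 / (W l * (?\<alpha> * s))" using W_pos[of l] \<alpha> s by simp
      ultimately show "norm (?d l) \<le> 1 / a * inverse (real (Suc l) ^ 2)"
        using d unfolding s_def[symmetric]
        by (simp add: power2_eq_square inverse_eq_divide mult.assoc)
    qed
  qed
  then obtain D where D: "(\<lambda>n. \<Sum>l<n. ?d l) \<longlonglongrightarrow> D" by (auto simp: summable_def sums_def)
  have h: "(\<lambda>n. (harm n - ln (real n)) / ?\<alpha>) \<longlonglongrightarrow> euler_mascheroni / ?\<alpha>"
    using \<alpha> by (intro tendsto_divide euler_mascheroni_LIMSEQ tendsto_const) auto
  have "(\<Sum>l<n. 1 / W l) - ln (real n) / ?\<alpha> = (\<Sum>l<n. ?d l) + (harm n - ln (real n)) / ?\<alpha>" for n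
  proof -
    have "harm n = (\<Sum>l<n. inverse (real (Suc l)))"
      unfolding harm_def by (rule sum.reindex_bij_witness[of _ Suc "\<lambda>k. k - 1"]) auto
    then have "harm n / ?\<alpha> = (\<Sum>l<n. 1 / (?\<alpha> * real (Suc l)))"
      by (simp add: sum_divide_distrib inverse_eq_divide mult.commute del: of_nat_Suc)
    then show ?thesis by (simp add: sum_subtractf diff_divide_distrib)
  qed
  then show ?thesis using tendsto_add[OF D h] by auto
qed

definition noise :: "nat \<Rightarrow> 'a \<Rightarrow> real" where
  "noise j \<omega> = (\<Sum>l\<in>{Suc j ^ 3..<Suc (Suc j) ^ 3}. gap l \<omega> - 1 / W l)"

lemma noise_measurable[measurable]: "noise j \<in> borel_measurable M"
  unfolding noise_def[abs_def] by measurable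

text \<open>A block has at most \<open>7 s^2\<close> gaps, because
  \<open>3 s^2 + 3 s + 1 <= 7 s^2\<close>, each of variance at most \<open>1 / (a s^3)^2\<close>.
  The weight \<open>s^2\<close> will pay for passing from squares to absolute values, and the bound
  is still summable.\<close>

lemma noise_second_moment:
  "(\<integral>\<^sup>+\<omega>. ennreal (real (Suc j) ^ 2 * (noise j \<omega>)\<^sup>2) \<partial>M) \<le> ennreal (7 / a\<^sup>2 * inverse (real (Suc j) ^ 2))"
proof -
  define s where "s = real (Suc j)"
  have s: "1 \<le> s" by (simp add: s_def)
  let ?B = "{Suc j ^ 3..<Suc (Suc j) ^ 3}"
  have hb: "has_bochner_integral M (\<lambda>\<omega>. s ^ 2 * (noise j \<omega>)\<^sup>2) (s ^ 2 * (\<Sum>l\<in>?B. 1 / (W l)\<^sup>2))"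
    unfolding noise_def by (intro has_bochner_integral_mult_right gap_sum_variance) auto
  have "(\<integral>\<^sup>+\<omega>. ennreal (s ^ 2 * (noise j \<omega>)\<^sup>2) \<partial>M) = ennreal (s ^ 2 * (\<Sum>l\<in>?B. 1 / (W l)\<^sup>2))"
    using hb by (subst nn_integral_eq_integral) (auto simp: has_bochner_integral_iff)
  also have "s ^ 2 * (\<Sum>l\<in>?B. 1 / (W l)\<^sup>2) \<le> 7 / a\<^sup>2 * inverse (s ^ 2)"
  proof -
    have "1 / (W l)\<^sup>2 \<le> 1 / (a * s ^ 3)\<^sup>2" if "l \<in> ?B" for l
    proof -
      have "Suc j ^ 3 \<le> Suc l" using that by simp
      then have "real (Suc j ^ 3) \<le> real (Suc l)" by (simp only: of_nat_le_iff)
      then have "a * s ^ 3 \<le> a * real (Suc l)" using a by (simp add: s_def)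
      also have "\<dots> \<le> W l" by (rule W_ge)
      finally show ?thesis using a s W_pos[of l] by (intro divide_left_mono power_mono) auto
    qed
    then have "(\<Sum>l\<in>?B. 1 / (W l)\<^sup>2) \<le> real (card ?B) * (1 / (a * s ^ 3)\<^sup>2)"
      by (rule sum_bounded_above)
    also have "\<dots> \<le> 7 * s ^ 2 * (1 / (a * s ^ 3)\<^sup>2)"
    proof (rule mult_right_mono)
      have "real (card ?B) = (s + 1) ^ 3 - s ^ 3"
        by (simp add: s_def of_nat_diff power_mono add.commute)
      also have "\<dots> \<le> 7 * s ^ 2"
      proof -
        have "1 * s \<le> s * s" using s by (intro mult_right_mono) auto
        then have "s \<le> s * s" "1 \<le> s * s" using s by linarith+
        then show ?thesis by (simp add: power3_eq_cube power2_eq_square algebra_simps)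
      qed
      finally show "real (card ?B) \<le> 7 * s ^ 2" .
    qed simp
    finally have "(\<Sum>l\<in>?B. 1 / (W l)\<^sup>2) \<le> 7 * s ^ 2 * (1 / (a * s ^ 3)\<^sup>2)" .
    then have "s ^ 2 * (\<Sum>l\<in>?B. 1 / (W l)\<^sup>2) \<le> s ^ 2 * (7 * s ^ 2 * (1 / (a * s ^ 3)\<^sup>2))"
      by (rule mult_left_mono) simp
    also have "\<dots> = 7 / a\<^sup>2 * inverse (s ^ 2)"
      using s a by (simp add: field_simps power2_eq_square power3_eq_cube)
    finally show ?thesis .
  qed
  finally have "(\<integral>\<^sup>+\<omega>. ennreal (s ^ 2 * (noise j \<omega>)\<^sup>2) \<partial>M) \<le> ennreal (7 / a\<^sup>2 * inverse (s ^ 2))"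
    by (simp add: ennreal_leI)
  then show ?thesis by (simp only: s_def)
qed

lemma AE_noise_summable: "AE \<omega> in M. summable (\<lambda>j. noise j \<omega>)"
proof -
  let ?f = "\<lambda>j \<omega>. real (Suc j) ^ 2 * (noise j \<omega>)\<^sup>2"
  have "AE \<omega> in M. summable (\<lambda>j. ?f j \<omega>)"
    using noise_second_moment by (intro AE_summable_of_mean[where C = "7 / a\<^sup>2"]) auto
  then show ?thesis
  proof eventually_elim
    case (elim \<omega>)
    have bound: "\<bar>noise j \<omega>\<bar> \<le> ?f j \<omega> + inverse (real (Suc j) ^ 2)" for j
    proof -
      define s where "s = real (Suc j)"
      define y where "y = \<bar>noise j \<omega>\<bar>"
      have s: "0 < s" by (simp add: s_def)
      \<comment> \<open>This square trades the weighted second power for the absolute value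
        \<open>y\<close>, at the price of the summable \<open>inverse (s^2)\<close>.\<close>
      have "0 \<le> (s * y - inverse s)\<^sup>2" by simp
      also have "\<dots> = s\<^sup>2 * y\<^sup>2 + inverse (s\<^sup>2) - 2 * y"
        using s by (simp add: power2_diff power_mult_distrib power_inverse)
      finally have "2 * y \<le> s\<^sup>2 * y\<^sup>2 + inverse (s\<^sup>2)" by simp
      moreover have "0 \<le> y" by (simp add: y_def)
      ultimately have "y \<le> s\<^sup>2 * y\<^sup>2 + inverse (s\<^sup>2)" by linarith
      then show ?thesis by (simp add: y_def s_def)
    qed
    show ?case
      by (rule summable_comparison_test'[OF summable_add[OF elim summable_inverse_squares], where N = 0]) (use bound in simp)
  qed
qed

lemma AE_birth_at_limit: "AE \<omega> in M. \<exists>L. (\<lambda>n. birth_at n \<omega> - ln (real n) / (1 + a)) \<longlonglongrightarrow> L"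
  using AE_noise_summable AE_gap_pos
proof eventually_elim
  case (elim \<omega>)
  let ?S = "\<lambda>n. \<Sum>l<n. gap l \<omega> - 1 / W l"
  let ?c = "\<lambda>j :: nat. Suc j ^ 3"
  \<comment> \<open>Sums up to the cubes telescope into blocks; the sum up to the first cube, which
    is 1, stays as a constant.\<close>
  have tel: "?S (?c j) - ?S (?c 0) = (\<Sum>i<j. noise i \<omega>)" for j
  proof (induction j)
    case (Suc j)
    have "?c j \<le> ?c (Suc j)" by (rule power_mono) auto
    then have "?S (?c (Suc j)) = ?S (?c j) + noise j \<omega>"
      unfolding noise_def lessThan_atLeast0 by (intro sum.atLeastLessThan_concat[symmetric] le0)
    then show ?case using Suc by (simp only: sum.lessThan_Suc)
  qed simp
  obtain D where "(\<lambda>j. \<Sum>i<j. noise i \<omega>) \<longlonglongrightarrow> D"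
    using elim(1) by (auto simp: summable_def sums_def)
  then have "(\<lambda>j. (\<Sum>i<j. noise i \<omega>) + ?S (?c 0)) \<longlonglongrightarrow> D + ?S (?c 0)"
    by (intro tendsto_add tendsto_const)
  then have S: "(\<lambda>j. ?S (?c j)) \<longlonglongrightarrow> D + ?S (?c 0)"
    unfolding tel[symmetric] by simp
  have birth: "birth_at n \<omega> = (\<Sum>l<n. gap l \<omega>)" for n
    unfolding gap_def using birth_at_0[of \<omega>] sum_lessThan_telescope[of "\<lambda>l. birth_at l \<omega>" n] by simp
  obtain \<gamma> where \<gamma>: "(\<lambda>n. (\<Sum>l<n. 1 / W l) - ln (real n) / (1 + a)) \<longlonglongrightarrow> \<gamma>"
    using sum_mean_gaps by blast
  have "filterlim ?c at_top sequentially"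
  proof (rule filterlim_at_top_mono[OF filterlim_ident])
    have "j \<le> ?c j" for j :: nat
      using self_le_power[of "Suc j" 3] by linarith
    then show "\<forall>\<^sub>F j in sequentially. j \<le> ?c j" by simp
  qed
  from filterlim_compose[OF \<gamma> this]
  have "(\<lambda>j. ?S (?c j) + ((\<Sum>l<?c j. 1 / W l) - ln (real (?c j)) / (1 + a))) \<longlonglongrightarrow> (D + ?S (?c 0)) + \<gamma>"
    by (intro tendsto_add S)
  then have "(\<lambda>j. birth_at (?c j) \<omega> - ln (real (?c j)) / (1 + a)) \<longlonglongrightarrow> (D + ?S (?c 0)) + \<gamma>"
    by (simp add: birth sum_subtractf)
  moreover have "mono (\<lambda>n. birth_at n \<omega>)"
    using elim(2) by (intro incseq_SucI) (simp add: gap_def less_imp_le)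
  ultimately show ?case using a by (intro exI convergent_from_cubes) auto
qed

text \<open>Non-explosion is read off the logarithmic growth of \<open>birth_at\<close>, which was
  defined without the numbering; so using the growth to justify the numbering is not
  circular.\<close>

lemma AE_regular: "AE \<omega> in M. regular_births (x \<omega>)"
  using AE_birth_at_limit AE_increasing AE_ex_history
proof eventually_elim
  case (elim \<omega>)
  then obtain L where L: "(\<lambda>n. birth_at n \<omega> - ln (real n) / (1 + a)) \<longlonglongrightarrow> L" by blast
  have "filterlim (\<lambda>n. ln (real n) / (1 + a)) at_top sequentially"
    using a by real_asymp
  from filterlim_tendsto_add_at_top[OF L this]
  have inf: "filterlim (\<lambda>n. birth_at n \<omega>) at_top sequentially" by simp
  show ?case
  proof
    show "increasing_births (x \<omega>)" by fact
    show "\<exists>vs\<in>histories n. births_follow (birth_time (x \<omega>)) vs" for n using elim by blast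
    show "\<exists>vs. history vs \<and> births_follow (birth_time (x \<omega>)) vs \<and> t < birth_time (x \<omega>) (newest vs)" for t
    proof -
      have "\<forall>\<^sub>F n in sequentially. t < birth_at n \<omega>" using inf by (simp add: filterlim_at_top_dense)
      then obtain n where n: "t < birth_at n \<omega>" by (auto simp: eventually_sequentially)
      obtain vs where "vs \<in> histories n" "births_follow (birth_time (x \<omega>)) vs" using elim by blast
      then show ?thesis using n birth_at_newest[of vs \<omega>] by (auto simp: histories_def)
    qed
  qed
qed

end

section \<open>Convergence of the degree fractions\<close>

lemma cube_gap_ratio: "(\<lambda>j :: nat. (real (Suc (Suc j) ^ 3) - real (Suc j ^ 3)) / real (Suc j ^ 3)) \<longlonglongrightarrow> 0"
  unfolding of_nat_power by real_asymp

text \<open>Between cubes \<open>e\<close> moves by at most \<open>D\<close> times the length of the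
  block, which is negligible against the cube itself.\<close>

lemma from_cubes_slowly_varying:
  fixes e :: "nat \<Rightarrow> real"
  assumes step: "\<And>n. \<bar>e (Suc n) - e n\<bar> \<le> D"
    and cubes: "(\<lambda>j. e (Suc j ^ 3) / real (Suc j ^ 3)) \<longlonglongrightarrow> 0"
  shows "(\<lambda>n. e n / real n) \<longlonglongrightarrow> 0"
proof -
  obtain j :: "nat \<Rightarrow> nat" where j: "filterlim j at_top sequentially"
    "\<And>n. 1 \<le> n \<Longrightarrow> Suc (j n) ^ 3 \<le> n" "\<And>n. n < Suc (Suc (j n)) ^ 3"
    using cube_brackets by blast
  have drift: "\<bar>e (k + d) - e k\<bar> \<le> D * real d" for k d
  proof (induction d)
    case (Suc d)
    then show ?case using step[of "k + d"] by (simp add: algebra_simps)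
  qed simp
  have D: "0 \<le> D" using step[of 0] by linarith
  let ?u = "\<lambda>j. \<bar>e (Suc j ^ 3) / real (Suc j ^ 3)\<bar>
    + D * ((real (Suc (Suc j) ^ 3) - real (Suc j ^ 3)) / real (Suc j ^ 3))"
  have "?u \<longlonglongrightarrow> 0 + D * 0"
    by (intro tendsto_add tendsto_rabs_zero cubes tendsto_mult_left cube_gap_ratio)
  then have u: "(\<lambda>n. ?u (j n)) \<longlonglongrightarrow> 0" using j(1) by (auto intro: filterlim_compose)
  show ?thesis
  proof (rule Lim_null_comparison[OF _ u])
    show "\<forall>\<^sub>F n in sequentially. norm (e n / real n) \<le> ?u (j n)"
      using eventually_ge_at_top[of 1]
    proof eventually_elim
      case (elim n)
      define k where "k = Suc (j n) ^ 3"
      have k: "1 \<le> k" "k \<le> n" using j(2)[OF elim] by (auto simp: k_def)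
      have "\<bar>e n\<bar> \<le> \<bar>e k\<bar> + D * real (n - k)" using drift[of k "n - k"] k by simp
      also have "\<dots> \<le> \<bar>e k\<bar> + D * (real (Suc (Suc (j n)) ^ 3) - real k)"
      proof -
        have "real n \<le> real (Suc (Suc (j n)) ^ 3)" using j(3)[of n] by (simp only: of_nat_le_iff)
        then show ?thesis using D k by (intro add_left_mono mult_left_mono) (auto simp: of_nat_diff)
      qed
      finally have b: "\<bar>e n\<bar> \<le> \<bar>e k\<bar> + D * (real (Suc (Suc (j n)) ^ 3) - real k)" .
      have "\<bar>e n / real n\<bar> = \<bar>e n\<bar> / real n" by simp
      also have "\<dots> \<le> \<bar>e n\<bar> / real k" using k by (intro divide_left_mono) auto
      also have "\<dots> \<le> (\<bar>e k\<bar> + D * (real (Suc (Suc (j n)) ^ 3) - real k)) / real k"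
        using b by (intro divide_right_mono) auto
      also have "\<dots> = ?u (j n)" unfolding k_def[symmetric] by (simp add: add_divide_distrib)
      finally show ?case by simp
    qed
  qed
qed

context regular_births
begin

lemma population_tendsto: "filterlim (\<lambda>t. population x t - 1) at_top at_top"
  unfolding filterlim_at_top
proof
  fix n
  show "\<forall>\<^sub>F t in at_top. n \<le> population x t - 1"
    using eventually_ge_at_top[of "max 0 (tau x (Suc n))"]
  proof eventually_elim
    case (elim t)
    then show ?case using tau_le_population[of t "Suc n"] by simp
  qed
qed

text \<open>The asymptotics of \<open>tau\<close> say that
  \<open>n * exp (- \<alpha> * tau x (Suc n))\<close> converges. Between two births the population
  is constant and the exponential monotone, so bounds at both ends have the same limit.\<close>

lemma population_growth:
  assumes \<alpha>: "0 < \<alpha>" and L: "(\<lambda>n. tau x (Suc n) - ln (real n) / \<alpha>) \<longlonglongrightarrow> L"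
  shows "((\<lambda>t. exp (- \<alpha> * t) * real (population x t)) \<longlongrightarrow> exp (- \<alpha> * L)) at_top"
proof -
  let ?T = "\<lambda>n. tau x (Suc n)"
  let ?u = "\<lambda>n. real n * exp (- \<alpha> * ?T n)"
  let ?l = "\<lambda>t. population x t - 1"
  have u: "?u \<longlonglongrightarrow> exp (- \<alpha> * L)"
  proof (rule Lim_transform_eventually)
    show "(\<lambda>n. exp (- \<alpha> * (?T n - ln (real n) / \<alpha>))) \<longlonglongrightarrow> exp (- \<alpha> * L)"
      by (intro tendsto_intros L)
    show "\<forall>\<^sub>F n in sequentially. exp (- \<alpha> * (?T n - ln (real n) / \<alpha>)) = ?u n"
      using eventually_ge_at_top[of 1]
    proof eventually_elim
      case (elim n)
      have "- \<alpha> * (?T n - ln (real n) / \<alpha>) = ln (real n) + - \<alpha> * ?T n"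
        using \<alpha> by (simp add: right_diff_distrib)
      then show ?case using elim by (simp only: exp_add) simp
    qed
  qed
  have "(\<lambda>n. real (Suc n) / real n) \<longlonglongrightarrow> 1" by real_asymp
  from tendsto_mult[OF this u]
  have "(\<lambda>n. real (Suc n) / real n * ?u n) \<longlonglongrightarrow> exp (- \<alpha> * L)" by simp
  then have hi: "((\<lambda>t. real (Suc (?l t)) / real (?l t) * ?u (?l t)) \<longlongrightarrow> exp (- \<alpha> * L)) at_top"
    by (rule filterlim_compose[OF _ population_tendsto])
  have lo: "((\<lambda>t. ?u (Suc (?l t))) \<longlongrightarrow> exp (- \<alpha> * L)) at_top"
    by (rule filterlim_compose[OF LIMSEQ_Suc[OF u] population_tendsto])
  \<comment> \<open>\<open>?l t\<close> births after the root have occurred by time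
    \<open>t\<close>, so \<open>t\<close> lies between the births numbered \<open>?l t + 1\<close>
    and \<open>?l t + 2\<close>.\<close>
  have l: "?T (?l t) \<le> t" "t < ?T (Suc (?l t))" "real (population x t) = real (Suc (?l t))" if "0 \<le> t" for t
    using tau_le_population[OF that, of "population x t"] tau_le_population[OF that, of "Suc (population x t)"]
      population_pos[OF that] by auto
  show ?thesis
  proof (rule tendsto_sandwich[OF _ _ lo hi])
    show "\<forall>\<^sub>F t in at_top. ?u (Suc (?l t)) \<le> exp (- \<alpha> * t) * real (population x t)"
      using eventually_ge_at_top[of 0]
    proof eventually_elim
      case (elim t)
      have "exp (- \<alpha> * ?T (Suc (?l t))) \<le> exp (- \<alpha> * t)" using l(2)[OF elim] \<alpha> by simp
      then have "real (Suc (?l t)) * exp (- \<alpha> * ?T (Suc (?l t))) \<le> real (Suc (?l t)) * exp (- \<alpha> * t)"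
        by (rule mult_left_mono) simp
      then show ?case unfolding l(3)[OF elim] by (simp only: mult.commute)
    qed
    show "\<forall>\<^sub>F t in at_top. exp (- \<alpha> * t) * real (population x t) \<le> real (Suc (?l t)) / real (?l t) * ?u (?l t)"
      using eventually_ge_at_top[of 0] population_tendsto[unfolded filterlim_at_top, rule_format, of 1]
    proof eventually_elim
      case (elim t)
      have "exp (- \<alpha> * t) \<le> exp (- \<alpha> * ?T (?l t))" using l(1)[OF elim(1)] \<alpha> by simp
      then have "real (Suc (?l t)) * exp (- \<alpha> * t) \<le> real (Suc (?l t)) * exp (- \<alpha> * ?T (?l t))"
        by (rule mult_left_mono) simp
      moreover have "real (?l t) \<noteq> 0" using elim(2) by linarith
      ultimately show ?case unfolding l(3)[OF elim(1)] by (simp add: mult.commute)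
    qed
  qed
qed

end

context branching
begin

definition Hist :: "'a \<Rightarrow> nat \<Rightarrow> nat list list" where
  "Hist \<omega> = regular_births.hist (x \<omega>)"

lemma sum_follow_Hist:
  fixes f :: "nat list list \<Rightarrow> real"
  assumes "regular_births (x \<omega>)"
  shows "(\<Sum>us\<in>histories n. if births_follow (birth_time (x \<omega>)) us then f us else 0) = f (Hist \<omega> n)"
proof -
  interpret regular_births "x \<omega>" by fact
  show ?thesis unfolding Hist_def using hist by (intro sum_follow) (auto simp: histories_def)
qed

text \<open>The sum picks out the value at the followed history; it stands in for
  \<open>Hist\<close> because its measurability is immediate.\<close>

lemma nn_integral_Hist:
  assumes f: "\<And>vs. 0 \<le> f vs"
  shows "(\<integral>\<^sup>+\<omega>. ennreal (\<Sum>us\<in>histories n. if births_follow (birth_time (x \<omega>)) us then f us else 0) \<partial>M)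
    = ennreal (history_mean a n f)"
proof -
  let ?A = "\<lambda>us. {\<omega>\<in>space M. births_follow (birth_time (x \<omega>)) us}"
  have "(\<integral>\<^sup>+\<omega>. ennreal (\<Sum>us\<in>histories n. if births_follow (birth_time (x \<omega>)) us then f us else 0) \<partial>M)
      = (\<integral>\<^sup>+\<omega>. (\<Sum>us\<in>histories n. ennreal (f us) * indicator (?A us) \<omega>) \<partial>M)"
  proof (rule nn_integral_cong)
    fix \<omega> assume \<omega>: "\<omega> \<in> space M"
    let ?g = "\<lambda>us. if births_follow (birth_time (x \<omega>)) us then f us else 0"
    have "ennreal (\<Sum>us\<in>histories n. ?g us) = (\<Sum>us\<in>histories n. ennreal (?g us))"
      using f by (intro sum_ennreal[symmetric]) auto
    also have "\<dots> = (\<Sum>us\<in>histories n. ennreal (f us) * indicator (?A us) \<omega>)"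
      using \<omega> by (intro sum.cong) auto
    finally show "ennreal (\<Sum>us\<in>histories n. ?g us) = (\<Sum>us\<in>histories n. ennreal (f us) * indicator (?A us) \<omega>)" .
  qed
  also have "\<dots> = (\<Sum>us\<in>histories n. ennreal (f us) * emeasure M (?A us))"
    by (subst nn_integral_sum) (auto simp: nn_integral_cmult)
  also have "\<dots> = (\<Sum>us\<in>histories n. ennreal (history_prob a us * f us))"
    using f history_prob_nonneg[OF a]
    by (intro sum.cong refl)
      (auto simp: M.emeasure_eq_measure prob_births_follow histories_def ennreal_mult mult.commute)
  also have "\<dots> = ennreal (history_mean a n f)"
    unfolding history_mean_def using f history_prob_nonneg[OF a] by (intro sum_ennreal) auto
  finally show ?thesis .
qed

text \<open>A second moment of order \<open>n\<close> divided by \<open>n^2\<close> is of order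
  \<open>j^-3\<close> at the \<open>j\<close>-th cube, so the squares are summable there; bounded
  increments carry the convergence over to all \<open>n\<close>.\<close>

lemma AE_degree_error:
  assumes "degree_recursion m a p"
  shows "AE \<omega> in M. (\<lambda>n. degree_error m p k (Hist \<omega> n) / real n) \<longlonglongrightarrow> 0"
proof -
  interpret degree_recursion m a p by fact
  obtain K where K: "0 \<le> K" "\<And>n. history_mean a n (\<lambda>vs. (err k vs)\<^sup>2) \<le> K * real (Suc n)"
    using err_second_moment by blast
  let ?c = "\<lambda>j. Suc j ^ 3"
  define Z where "Z j \<omega> = (\<Sum>us\<in>histories (?c j). if births_follow (birth_time (x \<omega>)) us
    then (err k us / real (?c j))\<^sup>2 else 0)" for j \<omega>
  have "AE \<omega> in M. summable (\<lambda>j. Z j \<omega>)"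
  proof (rule AE_summable_of_mean)
    show "Z j \<in> borel_measurable M" for j unfolding Z_def[abs_def] by measurable
    show "0 \<le> Z j \<omega>" for j \<omega> unfolding Z_def by (intro sum_nonneg) auto
    show "0 \<le> 2 * K" using K by simp
    fix j
    define s where "s = real (Suc j)"
    have s: "1 \<le> s" by (simp add: s_def)
    have c: "real (?c j) = s ^ 3" by (simp add: s_def)
    have "(\<integral>\<^sup>+\<omega>. ennreal (Z j \<omega>) \<partial>M) = ennreal (history_mean a (?c j) (\<lambda>vs. 1 / (s ^ 3) ^ 2 * (err k vs)\<^sup>2))"
      unfolding Z_def c by (subst nn_integral_Hist) (simp_all add: power_divide)
    also have "history_mean a (?c j) (\<lambda>vs. 1 / (s ^ 3) ^ 2 * (err k vs)\<^sup>2) \<le> 1 / (s ^ 3) ^ 2 * (K * (2 * s ^ 3))"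
      unfolding history_mean_cmult
    proof (rule mult_left_mono)
      have "1 \<le> s ^ 3" using s by simp
      then have "real (Suc (?c j)) \<le> 2 * s ^ 3" unfolding of_nat_Suc c by simp
      then have "K * real (Suc (?c j)) \<le> K * (2 * s ^ 3)" using K by (intro mult_left_mono)
      then show "history_mean a (?c j) (\<lambda>vs. (err k vs)\<^sup>2) \<le> K * (2 * s ^ 3)" using K(2)[of "?c j"] by linarith
    qed (use s in auto)
    also have "\<dots> = 2 * K * inverse (s ^ 3)" using s by (simp add: field_simps power2_eq_square)
    also have "\<dots> \<le> 2 * K * inverse (s ^ 2)"
      using s K by (intro mult_left_mono le_imp_inverse_le power_increasing) auto
    finally show "(\<integral>\<^sup>+\<omega>. ennreal (Z j \<omega>) \<partial>M) \<le> ennreal (2 * K * inverse (real (Suc j) ^ 2))"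
      by (simp only: s_def ennreal_leI)
  qed
  then show ?thesis using AE_regular
  proof eventually_elim
    case (elim \<omega>)
    interpret regular_births "x \<omega>" by (rule elim(2))
    have "Z j \<omega> = (err k (Hist \<omega> (?c j)) / real (?c j))\<^sup>2" for j
      unfolding Z_def by (rule sum_follow_Hist[OF elim(2)])
    then have "(\<lambda>j. (err k (Hist \<omega> (?c j)) / real (?c j))\<^sup>2) \<longlonglongrightarrow> 0"
      using summable_LIMSEQ_zero[OF elim(1)] by simp
    from tendsto_real_sqrt[OF this]
    have cubes: "(\<lambda>j. err k (Hist \<omega> (?c j)) / real (?c j)) \<longlonglongrightarrow> 0"
      by (simp only: real_sqrt_abs real_sqrt_zero) (rule tendsto_rabs_zero_cancel)
    show ?case
    proof (rule from_cubes_slowly_varying[OF _ cubes])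
      fix n
      let ?w = "newest (Hist \<omega> (Suc n))"
      have "Hist \<omega> (Suc n) = ?w # Hist \<omega> n" unfolding Hist_def by (rule hist_Suc)
      then have eq: "err k (Hist \<omega> (Suc n)) - err k (Hist \<omega> n) = (of_bool (k = 0) - p k) / real m
         + of_bool (Suc (old_degree (Hist \<omega> n) ?w) = k) - of_bool (old_degree (Hist \<omega> n) ?w = k)"
        using err_Cons[of k ?w "Hist \<omega> n"] by simp
      show "\<bar>err k (Hist \<omega> (Suc n)) - err k (Hist \<omega> n)\<bar> \<le> \<bar>(of_bool (k = 0) - p k) / real m\<bar> + 1"
        unfolding eq by (rule abs_increment_le) auto
    qed
  qed
qed

lemma AE_degree_fraction:
  assumes "degree_recursion m a p"
  shows "AE \<omega> in M. (\<lambda>l. degree_count m k (Hist \<omega> l) / real (Suc (l div m))) \<longlonglongrightarrow> p k"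
  using AE_degree_error[OF assms, of k] AE_regular
proof eventually_elim
  case (elim \<omega>)
  interpret degree_recursion m a p by fact
  interpret regular_births "x \<omega>" by (rule elim(2))
  let ?n = "\<lambda>l. real (Suc (l div m))"
  define \<theta> where "\<theta> l = ?n l - real (Suc l) / real m" for l
  have \<theta>: "0 \<le> \<theta> l" "\<theta> l \<le> 1" for l using block_excess_bounds[OF m, of l] by (auto simp: \<theta>_def)
  have n1: "real (Suc l) / real m \<le> ?n l" for l using \<theta>(1)[of l] by (simp add: \<theta>_def)
  have inv: "(\<lambda>l. inverse (?n l)) \<longlonglongrightarrow> 0"
  proof (rule Lim_null_comparison)
    show "(\<lambda>l. real m * inverse (real (Suc l))) \<longlonglongrightarrow> 0"
      using tendsto_mult_left[OF LIMSEQ_inverse_real_of_nat, of "real m"] by simp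
    show "\<forall>\<^sub>F l in sequentially. norm (inverse (?n l)) \<le> real m * inverse (real (Suc l))"
    proof (intro always_eventually allI)
      fix l
      have "inverse (?n l) \<le> inverse (real (Suc l) / real m)"
        using n1[of l] m by (intro le_imp_inverse_le) auto
      then show "norm (inverse (?n l)) \<le> real m * inverse (real (Suc l))"
        by (simp add: inverse_eq_divide)
    qed
  qed
  have \<theta>0: "(\<lambda>l. \<theta> l * inverse (?n l)) \<longlonglongrightarrow> 0"
  proof (rule Lim_null_comparison[OF _ inv])
    show "\<forall>\<^sub>F l in sequentially. norm (\<theta> l * inverse (?n l)) \<le> inverse (?n l)"
    proof (intro always_eventually allI)
      fix l
      have "\<theta> l * inverse (?n l) \<le> 1 * inverse (?n l)" using \<theta>(2)[of l] by (intro mult_right_mono) auto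
      then show "norm (\<theta> l * inverse (?n l)) \<le> inverse (?n l)" using \<theta>(1)[of l] by (simp add: abs_mult)
    qed
  qed
  have e0: "(\<lambda>l. err k (Hist \<omega> l) * inverse (?n l)) \<longlonglongrightarrow> 0"
  proof (rule Lim_null_comparison)
    show "(\<lambda>l. real m * \<bar>err k (Hist \<omega> l) / real l\<bar>) \<longlonglongrightarrow> 0"
      using tendsto_mult_left[OF tendsto_rabs_zero[OF elim(1)], of "real m"] by simp
    show "\<forall>\<^sub>F l in sequentially. norm (err k (Hist \<omega> l) * inverse (?n l)) \<le> real m * \<bar>err k (Hist \<omega> l) / real l\<bar>"
      using eventually_ge_at_top[of 1]
    proof eventually_elim
      case (elim l)
      have "inverse (?n l) \<le> inverse (real l / real m)"
      proof (rule le_imp_inverse_le)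
        have "real l / real m \<le> real (Suc l) / real m" by (intro divide_right_mono) auto
        then show "real l / real m \<le> ?n l" using n1[of l] by linarith
      qed (use elim m in auto)
      then have "\<bar>err k (Hist \<omega> l)\<bar> * inverse (?n l) \<le> \<bar>err k (Hist \<omega> l)\<bar> * inverse (real l / real m)"
        by (rule mult_left_mono) simp
      then show ?case by (simp add: abs_mult inverse_eq_divide mult.commute)
    qed
  qed
  \<comment> \<open>\<open>\<theta>\<close> is the excess of the number of vertices over the number
    of individuals divided by \<open>m\<close>; being at most 1, it disappears in the limit together
    with the correction for \<open>k = 0\<close>.\<close>
  have "degree_count m k (Hist \<omega> l) / ?n l
      = p k - p k * (\<theta> l * inverse (?n l)) + err k (Hist \<omega> l) * inverse (?n l)
        + of_bool (k = 0) * (\<theta> l * inverse (?n l))" for l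
  proof -
    have len: "length (Hist \<omega> l) = l" by (simp add: Hist_def hist)
    have "degree_count m k (Hist \<omega> l) = err k (Hist \<omega> l) + p k * (?n l - \<theta> l) + of_bool (k = 0) * \<theta> l"
      by (simp add: degree_error_def len \<theta>_def)
    moreover have "(e + P * (y - t) + b * t) / y = P - P * (t * inverse y) + e * inverse y + b * (t * inverse y)"
      if "y \<noteq> 0" for e P y t b :: real using that by (simp add: field_simps)
    ultimately show ?thesis by simp
  qed
  moreover have "(\<lambda>l. p k - p k * (\<theta> l * inverse (?n l)) + err k (Hist \<omega> l) * inverse (?n l)
        + of_bool (k = 0) * (\<theta> l * inverse (?n l))) \<longlonglongrightarrow> p k - p k * 0 + 0 + of_bool (k = 0) * 0"
    by (intro tendsto_intros \<theta>0 e0)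
  ultimately show ?case by simp
qed

lemma AE_num_vertices_deg:
  assumes "degree_recursion m a p"
  shows "AE \<omega> in M. ((\<lambda>t. real (num_vertices_deg m (x \<omega>) k t) / real (num_vertices m (x \<omega>) t)) \<longlongrightarrow> p k) at_top"
  using AE_degree_fraction[OF assms, of k] AE_regular
proof eventually_elim
  case (elim \<omega>)
  interpret degree_recursion m a p by fact
  interpret regular_births "x \<omega>" by (rule elim(2))
  show ?case
  proof (rule Lim_transform_eventually[OF filterlim_compose[OF elim(1) population_tendsto]])
    show "\<forall>\<^sub>F t in at_top. degree_count m k (Hist \<omega> (population (x \<omega>) t - 1)) / real (Suc ((population (x \<omega>) t - 1) div m))
      = real (num_vertices_deg m (x \<omega>) k t) / real (num_vertices m (x \<omega>) t)"
      using eventually_ge_at_top[of 0]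
    proof eventually_elim
      case (elim t)
      then have l: "population (x \<omega>) t = Suc (population (x \<omega>) t - 1)" using population_pos by fastforce
      show ?case
        using num_vertices_deg_hist[OF m elim l, of k] num_vertices_hist[OF m elim l] by (simp add: Hist_def)
    qed
  qed
qed

lemma AE_population_limit:
  "AE \<omega> in M. \<exists>V>0. ((\<lambda>t. exp (- (1 + a) * t) * real (population (x \<omega>) t)) \<longlongrightarrow> V) at_top"
  using AE_birth_at_limit AE_regular
proof eventually_elim
  case (elim \<omega>)
  then obtain L where L: "(\<lambda>n. birth_at n \<omega> - ln (real n) / (1 + a)) \<longlonglongrightarrow> L" by blast
  interpret regular_births "x \<omega>" by (rule elim(2))
  have "birth_at n \<omega> = tau (x \<omega>) (Suc n)" for n
    using birth_at_newest[of "hist n" \<omega>] hist by (simp add: tau_Suc)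
  then show ?case using population_growth[of "1 + a" L] L a by (intro exI[of _ "exp (- (1 + a) * L)"]) auto
qed

lemma AE_num_vertices_population:
  assumes "1 \<le> m"
  shows "AE \<omega> in M. ((\<lambda>t. real m * real (num_vertices m (x \<omega>) t) / real (population (x \<omega>) t)) \<longlongrightarrow> 1) at_top"
  using AE_regular
proof eventually_elim
  case (elim \<omega>)
  interpret regular_births "x \<omega>" by (rule elim)
  let ?f = "\<lambda>l. real m * real (Suc (l div m)) / real (Suc l)"
  have "?f \<longlonglongrightarrow> 1"
  proof (rule tendsto_sandwich)
    show "(\<lambda>_. 1) \<longlonglongrightarrow> (1 :: real)" by simp
    show "(\<lambda>l. 1 + real m / real (Suc l)) \<longlonglongrightarrow> 1" by real_asymp
    have b: "real (Suc l) \<le> real m * real (Suc (l div m))" "real m * real (Suc (l div m)) \<le> real (Suc l) + real m" for l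
      using block_excess_bounds[OF assms, of l] assms by (auto simp: field_simps)
    show "\<forall>\<^sub>F l in sequentially. 1 \<le> ?f l" using b by (intro always_eventually) simp
    have "?f l \<le> (real (Suc l) + real m) / real (Suc l)" for l
      using b(2)[of l] by (intro divide_right_mono) auto
    then show "\<forall>\<^sub>F l in sequentially. ?f l \<le> 1 + real m / real (Suc l)"
      by (intro always_eventually) (simp add: add_divide_distrib)
  qed
  show ?case
  proof (rule Lim_transform_eventually[OF filterlim_compose[OF \<open>?f \<longlonglongrightarrow> 1\<close> population_tendsto]])
    show "\<forall>\<^sub>F t in at_top. ?f (population (x \<omega>) t - 1) = real m * real (num_vertices m (x \<omega>) t) / real (population (x \<omega>) t)"
      using eventually_ge_at_top[of 0]
    proof eventually_elim
      case (elim t)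
      then have l: "population (x \<omega>) t = Suc (population (x \<omega>) t - 1)" using population_pos by fastforce
      show ?case using num_vertices_hist[OF assms elim l] l by simp
    qed
  qed
qed

end

section \<open>The preferential attachment law\<close>

text \<open>With one candidate per living individual, choosing the next birth is choosing a node
  number; this turns sums over candidates into sums over nodes.\<close>

lemma label_bij:
  assumes h: "history vs"
  shows "bij_betw (\<lambda>w. label vs (tl w)) (candidates vs) {1..Suc (length vs)}"
proof -
  have "bij_betw tl (candidates vs) (alive vs)"
    using candidates_inj[OF h] tl_candidates[OF h] by (simp add: bij_betw_def)
  moreover have "bij_betw (label vs) (alive vs) {1..Suc (length vs)}"
  proof -
    have "label vs ` alive vs \<subseteq> {1..Suc (length vs)}" using label_bounds[of vs] by auto
    moreover have "card (label vs ` alive vs) = card {1..Suc (length vs)}"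
      by (simp only: card_image[OF label_inj[OF h]] card_alive[OF h]) simp
    ultimately have "label vs ` alive vs = {1..Suc (length vs)}" by (intro card_subset_eq) auto
    then show ?thesis using label_inj[OF h] by (simp add: bij_betw_def)
  qed
  ultimately show ?thesis using bij_betw_trans[of tl _ _ "label vs"] by (simp add: o_def)
qed

section \<open>Measurability of the numbered and collapsed objects\<close>

lemma measurable_card_countable:
  fixes P :: "'i::countable \<Rightarrow> 'a \<Rightarrow> bool"
  assumes [measurable]: "\<And>i. Measurable.pred L (P i)"
  shows "(\<lambda>\<omega>. card {i. P i \<omega>}) \<in> L \<rightarrow>\<^sub>M count_space UNIV"
proof -
  have eq: "card {i. P i \<omega>} = card {n. \<exists>i. n = to_nat i \<and> P i \<omega>}" for \<omega>
  proof -
    have "{n. \<exists>i. n = to_nat i \<and> P i \<omega>} = to_nat ` {i. P i \<omega>}" by auto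
    then show ?thesis by (simp add: card_image)
  qed
  have "{\<omega>\<in>space L. n \<in> {n. \<exists>i. n = to_nat i \<and> P i \<omega>}} \<in> sets L" for n
    by simp
  then show ?thesis unfolding eq by (rule measurable_card)
qed

lemma measurable_count_space_countable:
  fixes f :: "'a \<Rightarrow> 'i::countable"
  assumes "\<And>i. {\<omega>\<in>space L. f \<omega> = i} \<in> sets L"
  shows "f \<in> L \<rightarrow>\<^sub>M count_space UNIV"
  using assms by (subst measurable_count_space_eq2_countable) (auto simp: vimage_def Int_def conj_commute)

lemma measurable_eq_const_set:
  "f \<in> L \<rightarrow>\<^sub>M count_space UNIV \<Longrightarrow> {\<omega>\<in>space L. f \<omega> = k} \<in> sets L"
  using measurable_sets[of f L "count_space UNIV" "{k}"] by (simp add: vimage_def Int_def conj_commute)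

lemma sets_If: "A \<in> sets L \<Longrightarrow> B \<in> sets L \<Longrightarrow> (if P then A else B) \<in> sets L"
  by simp

lemma measurable_add_nat:
  fixes f g :: "'a \<Rightarrow> nat"
  assumes f: "f \<in> L \<rightarrow>\<^sub>M count_space UNIV" and g: "g \<in> L \<rightarrow>\<^sub>M count_space UNIV"
  shows "(\<lambda>\<omega>. f \<omega> + g \<omega>) \<in> L \<rightarrow>\<^sub>M count_space UNIV"
proof (rule measurable_compose_countable[OF _ f])
  show "(\<lambda>\<omega>. i + g \<omega>) \<in> L \<rightarrow>\<^sub>M count_space UNIV" for i
    by (rule measurable_compose[OF g]) simp
qed

text \<open>A later individual of the same rank would have a strictly larger set of predecessors,
  finite because its number is not 0. Rank 0 is left out since \<open>card\<close> assigns it to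
  everyone with infinitely many predecessors.\<close>

lemma finite_rank_fibre:
  assumes "1 \<le> i"
  shows "finite {u. birth_rank y u = i}"
proof (cases "\<exists>u. birth_rank y u = i")
  case True
  then obtain u0 where u0: "birth_rank y u0 = i" by blast
  let ?B = "\<lambda>u. {v. birth_time y v \<le> birth_time y u}"
  have fin: "finite (?B u)" if "birth_rank y u = i" for u
    using that assms unfolding birth_rank_def by (intro card_ge_0_finite) simp
  have "{u. birth_rank y u = i} \<subseteq> ?B u0"
  proof (intro subsetI CollectI, rule ccontr)
    fix u assume u: "u \<in> {u. birth_rank y u = i}" and "\<not> birth_time y u \<le> birth_time y u0"
    then have "?B u0 \<subset> ?B u" by force
    then have "card (?B u0) < card (?B u)" using fin[of u] u by (intro psubset_card_mono) auto
    then show False using u u0 by (simp add: birth_rank_def)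
  qed
  then show ?thesis using fin[OF u0] by (rule finite_subset)
qed simp

lemma node_ge_1: "1 \<le> j \<Longrightarrow> 1 \<le> node m n j"
  by (simp add: node_def)

text \<open>Multigraphs are tested only through vertices and edge counts, which involve nodes from 1
  on; so the hypotheses can avoid node 0, to which the numbering assigns no individual.\<close>

lemma measurable_collapse:
  assumes pr: "\<And>i. 1 \<le> i \<Longrightarrow> Measurable.pred L (\<lambda>\<omega>. present \<omega> i)"
    and par: "\<And>i. 1 \<le> i \<Longrightarrow> (\<lambda>\<omega>. par \<omega> i) \<in> L \<rightarrow>\<^sub>M count_space UNIV"
  shows "(\<lambda>\<omega>. collapse m (present \<omega>) (par \<omega>)) \<in> L \<rightarrow>\<^sub>M multigraph_space"
  unfolding multigraph_space_def
proof (rule measurable_measure_of)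
  fix Y assume "Y \<in> {{G. n \<in> vertices G} |n. True} \<union> {{G. edge_count G b c = k} |b c k. True}"
  then consider n where "Y = {G. n \<in> vertices G}" | b c k where "Y = {G. edge_count G b c = k}" by auto
  then show "(\<lambda>\<omega>. collapse m (present \<omega>) (par \<omega>)) -` Y \<inter> space L \<in> sets L"
  proof cases
    case 1
    have present: "{\<omega>\<in>space L. present \<omega> (node m n 1)} \<in> sets L"
      using pr[OF node_ge_1[OF order_refl]] by (simp only: pred_def)
    have "(\<lambda>\<omega>. collapse m (present \<omega>) (par \<omega>)) -` Y \<inter> space L = (if 1 \<le> n then {\<omega>\<in>space L. present \<omega> (node m n 1)} else {})"
      unfolding 1 collapse_def by auto
    then show ?thesis using sets_If[OF present sets.empty_sets] by (simp only:)
  next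
    case 2
    let ?P = "\<lambda>j \<omega>. j \<in> {1..m} \<and> present \<omega> (node m b j) \<and> (\<exists>i\<in>{1..m}. par \<omega> (node m b j) = Some (node m c i))"
    have P: "Measurable.pred L (?P j)" for j
    proof (cases "j \<in> {1..m}")
      case True
      then have j: "1 \<le> node m b j" by (intro node_ge_1) simp
      note [measurable] = pr[OF j] par[OF j]
      show ?thesis by measurable
    next
      case False
      then have "?P j = (\<lambda>_. False)" by blast
      then show ?thesis by (simp only: measurable_const space_count_space UNIV_I)
    qed
    have c: "{\<omega>\<in>space L. card {j. ?P j \<omega>} = k} \<in> sets L"
      by (rule measurable_eq_const_set[OF measurable_card_countable[OF P]])
    have "(\<lambda>\<omega>. collapse m (present \<omega>) (par \<omega>)) -` Y \<inter> space L
        = (if 1 \<le> b \<and> 1 \<le> c then {\<omega>\<in>space L. card {j. ?P j \<omega>} = k} else if k = 0 then space L else {})"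
      unfolding 2 collapse_def by auto
    also have "\<dots> \<in> sets L"
      by (intro sets_If c sets.top sets.empty_sets)
    finally show ?thesis .
  qed
qed auto

lemma PA_sequence_measurable:
  "PA_sequence m \<in> (\<Pi>\<^sub>M i\<in>{2::nat..}. count_space UNIV) \<rightarrow>\<^sub>M (\<Pi>\<^sub>M s\<in>steps m. multigraph_space)"
proof -
  have "(\<lambda>p. PA m p k) \<in> (\<Pi>\<^sub>M i\<in>{2::nat..}. count_space UNIV) \<rightarrow>\<^sub>M multigraph_space" for k
    unfolding PA_def
  proof (rule measurable_collapse)
    fix i :: nat
    show "(\<lambda>p. if 2 \<le> i then Some (p i) else (None :: nat option)) \<in> (\<Pi>\<^sub>M i\<in>{2::nat..}. count_space UNIV) \<rightarrow>\<^sub>M count_space UNIV"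
    proof (cases "2 \<le> i")
      case True
      then have "(\<lambda>p. p i) \<in> (\<Pi>\<^sub>M i\<in>{2::nat..}. count_space UNIV) \<rightarrow>\<^sub>M (count_space UNIV :: nat measure)"
        by (intro measurable_component_singleton) simp
      then have "(\<lambda>p. Some (p i)) \<in> (\<Pi>\<^sub>M i\<in>{2::nat..}. (count_space UNIV :: nat measure)) \<rightarrow>\<^sub>M count_space UNIV"
        by (rule measurable_compose) simp
      then show ?thesis by (simp only: True if_True)
    qed simp
  qed simp
  then show ?thesis
    unfolding PA_sequence_def by (intro measurable_restrict) auto
qed

context branching
begin

lemma birth_rank_measurable[measurable]: "(\<lambda>\<omega>. birth_rank (x \<omega>) u) \<in> M \<rightarrow>\<^sub>M count_space UNIV"
  unfolding birth_rank_def by (rule measurable_card_countable) measurable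

lemma population_measurable[measurable]: "(\<lambda>\<omega>. population (x \<omega>) t) \<in> M \<rightarrow>\<^sub>M count_space UNIV"
  unfolding population_def by (rule measurable_card_countable) measurable

text \<open>\<open>THE\<close> is unspecified where the rank is not a bijection; measurability survives because the set
  it is applied to is always finite, and a countable type has only countably many finite subsets.\<close>

lemma individual_measurable: "1 \<le> i \<Longrightarrow> (\<lambda>\<omega>. individual (x \<omega>) i) \<in> M \<rightarrow>\<^sub>M count_space UNIV"
proof (rule measurable_count_space_countable)
  fix v assume i: "1 \<le> i"
  let ?F = "\<lambda>\<omega>. {u. birth_rank (x \<omega>) u = i}"
  let ?S = "{S :: nat list set. finite S \<and> (THE u. u \<in> S) = v}"
  have "countable ?S"
    by (rule countable_subset[OF _ countable_Collect_finite]) auto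
  moreover have "{\<omega>\<in>space M. ?F \<omega> = S} \<in> sets M" for S
  proof -
    have "{\<omega>\<in>space M. ?F \<omega> = S} = {\<omega>\<in>space M. \<forall>u. birth_rank (x \<omega>) u = i \<longleftrightarrow> u \<in> S}" by auto
    also have "\<dots> \<in> sets M" by measurable
    finally show ?thesis .
  qed
  ultimately have "(\<Union>S\<in>?S. {\<omega>\<in>space M. ?F \<omega> = S}) \<in> sets M"
    by (intro sets.countable_UN') auto
  also have "(\<Union>S\<in>?S. {\<omega>\<in>space M. ?F \<omega> = S}) = {\<omega>\<in>space M. individual (x \<omega>) i = v}"
    using finite_rank_fibre[OF i] by (auto simp: individual_def)
  finally show "{\<omega>\<in>space M. individual (x \<omega>) i = v} \<in> sets M" .
qed

lemma tau_measurable: "1 \<le> i \<Longrightarrow> (\<lambda>\<omega>. tau (x \<omega>) i) \<in> borel_measurable M"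
  unfolding tau_def by (rule measurable_compose_countable[OF _ individual_measurable]) auto

lemma parent_measurable:
  "1 \<le> i \<Longrightarrow> (\<lambda>\<omega>. birth_rank (x \<omega>) (tl (individual (x \<omega>) i))) \<in> M \<rightarrow>\<^sub>M count_space UNIV"
  by (rule measurable_compose_countable[OF _ individual_measurable]) auto

lemma ctbp_parent_measurable: "1 \<le> i \<Longrightarrow> (\<lambda>\<omega>. ctbp_parent (x \<omega>) i) \<in> M \<rightarrow>\<^sub>M count_space UNIV"
proof -
  assume i: "1 \<le> i"
  note [measurable] = individual_measurable[OF i] parent_measurable[OF i]
  show ?thesis unfolding ctbp_parent_def by measurable
qed

lemma CBP_sequence_measurable:
  "(\<lambda>\<omega>. CBP_sequence m (x \<omega>)) \<in> M \<rightarrow>\<^sub>M (\<Pi>\<^sub>M s\<in>steps m. multigraph_space)"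
  unfolding CBP_sequence_def
proof (rule measurable_restrict)
  fix s assume s: "s \<in> steps m"
  obtain n j where nj: "s = (n, j)" by (cases s)
  then have k: "1 \<le> node m n j" using s by (intro node_ge_1) (auto simp: steps_def)
  have "(\<lambda>\<omega>. CBP m (x \<omega>) (tau (x \<omega>) (node m n j))) \<in> M \<rightarrow>\<^sub>M multigraph_space"
    unfolding CBP_def
  proof (rule measurable_collapse)
    fix i :: nat assume i: "1 \<le> i"
    note [measurable] = tau_measurable[OF i] tau_measurable[OF k]
    show "Measurable.pred M (\<lambda>\<omega>. tau (x \<omega>) i \<le> tau (x \<omega>) (node m n j))" by measurable
    show "(\<lambda>\<omega>. ctbp_parent (x \<omega>) i) \<in> M \<rightarrow>\<^sub>M count_space UNIV" by (rule ctbp_parent_measurable[OF i])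
  qed
  then show "(\<lambda>\<omega>. case s of (n, j) \<Rightarrow> CBP m (x \<omega>) (tau (x \<omega>) (node m n j))) \<in> M \<rightarrow>\<^sub>M multigraph_space"
    by (simp add: nj)
qed

lemma points_upto_measurable:
  assumes i: "1 \<le> i"
  shows "(\<lambda>\<omega>. points_upto (x \<omega> (individual (x \<omega>) i)) (t - tau (x \<omega>) i)) \<in> M \<rightarrow>\<^sub>M count_space UNIV"
proof -
  note [measurable] = tau_measurable[OF i]
  define Y where "Y k \<omega> = X (individual (x \<omega>) i) \<omega> k" for k \<omega>
  have [measurable]: "Y k \<in> borel_measurable M" for k
    unfolding Y_def[abs_def] by (rule measurable_compose_countable[OF _ individual_measurable[OF i]]) auto
  show ?thesis
    unfolding points_upto_def atLeastAtMost_iff Y_def[symmetric] by (rule measurable_card_countable) measurable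
qed

lemma CBP_degree_measurable: "(\<lambda>\<omega>. CBP_degree m (x \<omega>) n t) \<in> M \<rightarrow>\<^sub>M count_space UNIV"
proof -
  have "(\<lambda>\<omega>. \<Sum>j\<in>J. points_upto (x \<omega> (individual (x \<omega>) (node m n j))) (t - tau (x \<omega>) (node m n j))) \<in> M \<rightarrow>\<^sub>M count_space UNIV"
    if "finite J" "J \<subseteq> {1..m}" for J
    using that
  proof (induction J)
    case (insert j J)
    have 1: "(\<lambda>\<omega>. points_upto (x \<omega> (individual (x \<omega>) (node m n j))) (t - tau (x \<omega>) (node m n j))) \<in> M \<rightarrow>\<^sub>M count_space UNIV"
      using insert.prems by (intro points_upto_measurable node_ge_1) auto
    have 2: "(\<lambda>\<omega>. \<Sum>j\<in>J. points_upto (x \<omega> (individual (x \<omega>) (node m n j))) (t - tau (x \<omega>) (node m n j))) \<in> M \<rightarrow>\<^sub>M count_space UNIV"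
      using insert by auto
    show ?case using measurable_add_nat[OF 1 2] insert.hyps by simp
  qed simp
  then show ?thesis unfolding CBP_degree_def by simp
qed

lemma num_vertices_deg_measurable: "(\<lambda>\<omega>. num_vertices_deg m (x \<omega>) k t) \<in> M \<rightarrow>\<^sub>M count_space UNIV"
proof -
  note [measurable] = tau_measurable[OF node_ge_1[of 1 m]] CBP_degree_measurable
  have eq: "{n \<in> vertices (CBP m (x \<omega>) t). CBP_degree m (x \<omega>) n t = k}
      = {n. 1 \<le> n \<and> tau (x \<omega>) (node m n 1) \<le> t \<and> CBP_degree m (x \<omega>) n t = k}" for \<omega>
    by (auto simp: CBP_def collapse_def)
  show ?thesis unfolding num_vertices_deg_def eq by (rule measurable_card_countable) measurable
qed

lemma num_vertices_measurable: "(\<lambda>\<omega>. num_vertices m (x \<omega>) t) \<in> M \<rightarrow>\<^sub>M count_space UNIV"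
proof -
  note [measurable] = tau_measurable[OF node_ge_1[of 1 m]]
  have eq: "vertices (CBP m (x \<omega>) t) = {n. 1 \<le> n \<and> tau (x \<omega>) (node m n 1) \<le> t}" for \<omega>
    by (auto simp: CBP_def collapse_def)
  show ?thesis unfolding num_vertices_def eq by (rule measurable_card_countable) measurable
qed

section \<open>The tree of parents has the preferential attachment law\<close>

definition tree :: "'a \<Rightarrow> nat \<Rightarrow> nat" where
  "tree \<omega> = (\<lambda>i\<in>{2..}. birth_rank (x \<omega>) (tl (individual (x \<omega>) i)))"

lemma tree_parents: "regular_births (x \<omega>) \<Longrightarrow> tree \<omega> = regular_births.parents (x \<omega>)"
  by (simp add: tree_def regular_births.parents_def)

lemma tree_measurable[measurable]: "tree \<in> M \<rightarrow>\<^sub>M (\<Pi>\<^sub>M i\<in>{2::nat..}. count_space UNIV)"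
  unfolding tree_def by (intro measurable_restrict parent_measurable) auto

lemma tree_component_measurable[measurable]: "(\<lambda>\<omega>. tree \<omega> i) \<in> M \<rightarrow>\<^sub>M count_space UNIV"
  unfolding tree_def using parent_measurable[of i] by (cases "2 \<le> i") auto

text \<open>A past of positive probability is the past of one history \<open>vs\<close>, and
  attaching the next node to \<open>y\<close> is the birth of the candidate whose parent is numbered
  \<open>y\<close>. The conditional probability is then a quotient of two values of
  \<open>history_prob\<close>.\<close>

lemma pa_tree_law_tree:
  fixes m :: nat
  assumes a_eq: "a = 1 + \<delta> / real m"
  shows "pa_tree_law m \<delta> (distr M (\<Pi>\<^sub>M i\<in>{2::nat..}. count_space UNIV) tree)"
  unfolding pa_tree_law_def
proof (intro conjI allI impI ballI)
  let ?S = "\<Pi>\<^sub>M i\<in>{2::nat..}. (count_space UNIV :: nat measure)"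
  let ?P = "distr M ?S tree"
  show "prob_space ?P" by (rule M.prob_space_distr) measurable
  show "sets ?P = sets ?S" by simp
  fix n h y
  assume n: "1 \<le> n" and pos: "0 < \<P>(p in ?P. \<forall>i\<in>{2..n}. p i = h i)" and y: "y \<in> {1..n}"
  obtain l where l: "n = Suc l" using n by (cases n) auto
  have comp[measurable]: "(\<lambda>p. p i) \<in> ?S \<rightarrow>\<^sub>M count_space UNIV" if "2 \<le> i" for i
    using that by (intro measurable_component_singleton) simp
  have past_pred[measurable]: "Measurable.pred ?S (\<lambda>p. \<forall>i\<in>{2..n}. p i = h i)"
    by (intro pred_intros_finite) (auto intro!: measurable_compose[OF comp])
  have [measurable]: "(\<lambda>p. p (Suc n)) \<in> ?S \<rightarrow>\<^sub>M count_space UNIV" using n by (intro comp) simp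
  have prob: "\<P>(p in ?P. Q p) = M.prob {\<omega>\<in>space M. Q (tree \<omega>)}" if Q[measurable]: "Measurable.pred ?S Q" for Q
  proof -
    have "{p\<in>space ?P. Q p} \<in> sets ?S" by simp
    then have "\<P>(p in ?P. Q p) = M.prob (tree -` {p\<in>space ?P. Q p} \<inter> space M)" by (rule measure_distr[OF tree_measurable])
    also have "tree -` {p\<in>space ?P. Q p} \<inter> space M = {\<omega>\<in>space M. Q (tree \<omega>)}"
      using measurable_space[OF tree_measurable] by auto
    finally show ?thesis .
  qed
  \<comment> \<open>Positive probability of the past provides a regular realisation with this past;
    its history represents \<open>h\<close>.\<close>
  have "\<exists>\<omega>\<in>space M. regular_births (x \<omega>) \<and> (\<forall>i\<in>{2..n}. tree \<omega> i = h i)"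
  proof (rule ccontr)
    assume neg: "\<not> ?thesis"
    have "AE \<omega> in M. \<not> (\<forall>i\<in>{2..n}. tree \<omega> i = h i)"
      using AE_regular AE_space by eventually_elim (use neg in blast)
    then have "M.prob {\<omega>\<in>space M. \<forall>i\<in>{2..n}. tree \<omega> i = h i} = 0"
      by (subst M.prob_eq_0) auto
    then show False using pos unfolding prob[OF past_pred] by simp
  qed
  then obtain \<omega>0 where \<omega>0: "regular_births (x \<omega>0)" "\<And>i. i \<in> {2..n} \<Longrightarrow> tree \<omega>0 i = h i" by blast
  interpret r0: regular_births "x \<omega>0" by (rule \<omega>0(1))
  define vs where "vs = r0.hist l"
  have h: "history vs" and len: "length vs = l" using r0.hist by (auto simp: vs_def)
  have "y \<in> (\<lambda>w. label vs (tl w)) ` candidates vs"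
    unfolding bij_betw_imp_surj_on[OF label_bij[OF h]] using y by (simp add: len l)
  then obtain w where w: "w \<in> candidates vs" "label vs (tl w) = y" by blast
  have past: "(\<forall>i\<in>{2..n}. tree \<omega> i = h i) \<longleftrightarrow> births_follow (birth_time (x \<omega>)) vs"
    if r: "regular_births (x \<omega>)" for \<omega>
  proof -
    interpret r: regular_births "x \<omega>" by (rule r)
    have "(\<forall>i\<in>{2..n}. tree \<omega> i = h i) \<longleftrightarrow> (\<forall>i\<in>{2..Suc l}. r.parents i = r0.parents i)"
      using \<omega>0(2) by (simp add: tree_parents[OF r] tree_parents[OF \<omega>0(1)] l)
    also have "\<dots> \<longleftrightarrow> r.hist l = vs" unfolding vs_def by (rule parents_eq_iff[OF r \<omega>0(1)])
    also have "\<dots> \<longleftrightarrow> births_follow (birth_time (x \<omega>)) vs"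
      using r.hist(3)[of l] r.hist_unique[OF h] len by auto
    finally show ?thesis .
  qed
  have future: "tree \<omega> (Suc n) = y \<and> (\<forall>i\<in>{2..n}. tree \<omega> i = h i) \<longleftrightarrow> births_follow (birth_time (x \<omega>)) (w # vs)"
    if r: "regular_births (x \<omega>)" for \<omega>
  proof
    interpret r: regular_births "x \<omega>" by (rule r)
    assume l1: "tree \<omega> (Suc n) = y \<and> (\<forall>i\<in>{2..n}. tree \<omega> i = h i)"
    then have hist: "r.hist l = vs" using past[OF r] r.hist_unique[OF h] len by auto
    have "label vs (tl (newest (r.hist (Suc l)))) = label vs (tl w)"
      using l1 r.parents_Suc[of l] w by (simp add: tree_parents[OF r] l hist)
    then have "newest (r.hist (Suc l)) = w"
      using r.newest_candidate[of l] w inj_onD[OF bij_betw_imp_inj_on[OF label_bij[OF h]]] hist by auto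
    then have "r.hist (Suc l) = w # vs" using r.hist_Suc[of l] hist by simp
    then show "births_follow (birth_time (x \<omega>)) (w # vs)" using r.hist(3)[of "Suc l"] by simp
  next
    interpret r: regular_births "x \<omega>" by (rule r)
    assume f: "births_follow (birth_time (x \<omega>)) (w # vs)"
    then have 1: "r.hist (Suc l) = w # vs" using r.hist_unique[of "w # vs"] h w len by simp
    have 2: "r.hist l = vs" using f r.hist_unique[OF h] len by auto
    have "tree \<omega> (Suc n) = y" using r.parents_Suc[of l] w by (simp add: tree_parents[OF r] l 1 2)
    moreover have "\<forall>i\<in>{2..n}. tree \<omega> i = h i" using past[OF r] f by (simp only: births_follow.simps)
    ultimately show "tree \<omega> (Suc n) = y \<and> (\<forall>i\<in>{2..n}. tree \<omega> i = h i)" ..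
  qed
  have p1: "\<P>(p in ?P. \<forall>i\<in>{2..n}. p i = h i) = history_prob a vs"
  proof -
    have "\<P>(p in ?P. \<forall>i\<in>{2..n}. p i = h i) = M.prob {\<omega>\<in>space M. \<forall>i\<in>{2..n}. tree \<omega> i = h i}"
      by (rule prob) measurable
    also have "\<dots> = M.prob {\<omega>\<in>space M. births_follow (birth_time (x \<omega>)) vs}"
    proof (rule M.prob_eq_AE)
      show "AE \<omega> in M. (\<forall>i\<in>{2..n}. tree \<omega> i = h i) \<longleftrightarrow> births_follow (birth_time (x \<omega>)) vs"
        using AE_regular by eventually_elim (rule past)
    qed measurable
    finally show ?thesis using prob_births_follow[OF h] by simp
  qed
  have p2: "\<P>(p in ?P. p (Suc n) = y \<and> (\<forall>i\<in>{2..n}. p i = h i)) = history_prob a (w # vs)"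
  proof -
    have "\<P>(p in ?P. p (Suc n) = y \<and> (\<forall>i\<in>{2..n}. p i = h i))
        = M.prob {\<omega>\<in>space M. tree \<omega> (Suc n) = y \<and> (\<forall>i\<in>{2..n}. tree \<omega> i = h i)}"
      by (rule prob) measurable
    also have "\<dots> = M.prob {\<omega>\<in>space M. births_follow (birth_time (x \<omega>)) (w # vs)}"
    proof (rule M.prob_eq_AE)
      show "AE \<omega> in M. (tree \<omega> (Suc n) = y \<and> (\<forall>i\<in>{2..n}. tree \<omega> i = h i)) \<longleftrightarrow> births_follow (birth_time (x \<omega>)) (w # vs)"
        using AE_regular by eventually_elim (rule future)
    qed measurable
    finally show ?thesis using prob_births_follow[of "w # vs"] h w by simp
  qed
  \<comment> \<open>\<open>card_children\<close> applied to \<open>\<omega>0\<close> turns the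
    number of nodes attached by \<open>h\<close> into the head of the candidate.\<close>
  have weight: "pa_weight m \<delta> n h (label vs (tl v)) = rate a v" if v: "v \<in> candidates vs" for v
  proof -
    have "{i\<in>{2..n}. h i = label vs (tl v)} = {i\<in>{2..Suc l}. r0.parents i = label vs (tl v)}"
      using \<omega>0(2) by (auto simp: tree_parents[OF \<omega>0(1)] l)
    then have "card {i\<in>{2..n}. h i = label vs (tl v)} = hd v"
      using r0.card_children[of v l] v by (simp add: vs_def)
    then show ?thesis by (simp add: pa_weight_def rate_def a_eq)
  qed
  have "(\<Sum>z=1..n. pa_weight m \<delta> n h z) = (\<Sum>v\<in>candidates vs. pa_weight m \<delta> n h (label vs (tl v)))"
    using sum.reindex_bij_betw[OF label_bij[OF h], of "pa_weight m \<delta> n h"] by (simp add: len l)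
  also have "\<dots> = total_rate a l" using weight sum_rate_candidates[OF h, of a] by (simp add: len)
  finally have total: "(\<Sum>z=1..n. pa_weight m \<delta> n h z) = total_rate a l" .
  have "\<P>(p in ?P. p (Suc n) = y \<bar> \<forall>i\<in>{2..n}. p i = h i) = history_prob a (w # vs) / history_prob a vs"
    unfolding cond_prob_def p1 p2 ..
  also have "\<dots> = rate a w / total_rate a l" using pos p1 by (simp add: len)
  finally show "\<P>(p in ?P. p (Suc n) = y \<bar> \<forall>i\<in>{2..n}. p i = h i)
      = pa_weight m \<delta> n h y / (\<Sum>z=1..n. pa_weight m \<delta> n h z)"
    using weight[OF w(1)] w(2) total by simp
qed

lemma has_PA_law_CBP:
  assumes "1 \<le> m" "a = 1 + \<delta> / real m"
  shows "has_PA_law m \<delta> M (\<lambda>\<omega>. CBP_sequence m (x \<omega>))"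
  unfolding has_PA_law_def
proof (intro conjI exI)
  let ?S = "\<Pi>\<^sub>M i\<in>{2::nat..}. (count_space UNIV :: nat measure)"
  let ?G = "\<Pi>\<^sub>M s\<in>steps m. multigraph_space"
  show "(\<lambda>\<omega>. CBP_sequence m (x \<omega>)) \<in> M \<rightarrow>\<^sub>M ?G" by (rule CBP_sequence_measurable)
  show "pa_tree_law m \<delta> (distr M ?S tree)" by (rule pa_tree_law_tree[OF assms(2)])
  have "distr M ?G (\<lambda>\<omega>. CBP_sequence m (x \<omega>)) = distr M ?G (\<lambda>\<omega>. PA_sequence m (tree \<omega>))"
  proof (rule distr_cong_AE)
    show "AE \<omega> in M. CBP_sequence m (x \<omega>) = PA_sequence m (tree \<omega>)"
      using AE_regular
      by eventually_elim (simp only: tree_parents regular_births.CBP_sequence_PA[OF _ assms(1)])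
    show "(\<lambda>\<omega>. PA_sequence m (tree \<omega>)) \<in> M \<rightarrow>\<^sub>M ?G"
      by (rule measurable_compose[OF tree_measurable PA_sequence_measurable])
  qed (use CBP_sequence_measurable in auto)
  also have "\<dots> = distr (distr M ?S tree) ?G (PA_sequence m)"
    by (subst distr_distr[OF PA_sequence_measurable tree_measurable]) (simp add: o_def)
  finally show "distr M ?G (\<lambda>\<omega>. CBP_sequence m (x \<omega>)) = distr (distr M ?S tree) ?G (PA_sequence m)" .
qed

end

section \<open>The offspring process\<close>

lemma nn_integral_expo_exp:
  assumes r: "0 < r" and s: "0 \<le> s" and [measurable]: "f \<in> borel_measurable borel"
  shows "(\<integral>\<^sup>+y. ennreal (exp (- s * y)) * f y \<partial>expo r) = ennreal (r / (r + s)) * (\<integral>\<^sup>+y. f y \<partial>expo (r + s))"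
proof -
  have "(\<integral>\<^sup>+y. ennreal (exp (- s * y)) * f y \<partial>expo r)
      = (\<integral>\<^sup>+y. ennreal (r / (r + s)) * (ennreal (exponential_density (r + s) y) * f y) \<partial>lborel)"
  proof (subst nn_integral_expo, measurable, rule nn_integral_cong)
    fix y
    \<comment> \<open>Exponential tilting: the factor \<open>exp (- s * y)\<close> changes the rate
      from \<open>r\<close> to \<open>r + s\<close>.\<close>
    have "exp (- y * r) * exp (- s * y) = exp (- y * (r + s))"
      by (simp add: exp_add[symmetric] algebra_simps)
    then have "exponential_density r y * exp (- s * y) = r / (r + s) * exponential_density (r + s) y"
      using r s by (simp add: exponential_density_def mult.assoc)
    then have "ennreal (exponential_density r y) * ennreal (exp (- s * y))
        = ennreal (r / (r + s)) * ennreal (exponential_density (r + s) y)"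
      using r s by (simp add: ennreal_mult[symmetric] exponential_density_nonneg)
    then have "ennreal (exponential_density r y) * ennreal (exp (- s * y)) * f y
        = ennreal (r / (r + s)) * ennreal (exponential_density (r + s) y) * f y" by simp
    then show "ennreal (exponential_density r y) * (ennreal (exp (- s * y)) * f y)
        = ennreal (r / (r + s)) * (ennreal (exponential_density (r + s) y) * f y)"
      by (simp only: mult.assoc)
  qed
  also have "\<dots> = ennreal (r / (r + s)) * (\<integral>\<^sup>+y. f y \<partial>expo (r + s))"
    by (subst nn_integral_cmult) (auto simp: nn_integral_expo)
  finally show ?thesis .
qed

text \<open>The Laplace transform at \<open>\<alpha>\<close> of the point with index
  \<open>k\<close>, a sum of independent exponentials of rates \<open>i + a\<close> for
  \<open>i <= k\<close>; see \<open>laplace_point\<close>.\<close>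

definition laplace_factor :: "real \<Rightarrow> real \<Rightarrow> nat \<Rightarrow> real" where
  "laplace_factor a \<alpha> k = (\<Prod>i\<le>k. (real i + a) / (real i + a + \<alpha>))"

lemma laplace_factor_pos: "0 < a \<Longrightarrow> 0 \<le> \<alpha> \<Longrightarrow> 0 < laplace_factor a \<alpha> k"
  unfolding laplace_factor_def by (intro prod_pos) (auto intro!: divide_pos_pos add_nonneg_pos add_pos_nonneg)

text \<open>The telescoping partner of the Laplace factors: its decrements are \<open>(\<alpha> - 1)\<close> times the factors.\<close>

definition laplace_rest :: "real \<Rightarrow> real \<Rightarrow> nat \<Rightarrow> real" where
  "laplace_rest a \<alpha> n = (real n + a) * (\<Prod>i<n. (real i + a) / (real i + a + \<alpha>))"

lemma laplace_rest_nonneg: "0 < a \<Longrightarrow> 0 \<le> \<alpha> \<Longrightarrow> 0 \<le> laplace_rest a \<alpha> n"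
  unfolding laplace_rest_def by (intro mult_nonneg_nonneg prod_nonneg) auto

lemma sum_laplace_factor:
  assumes "0 < a" "0 \<le> \<alpha>"
  shows "(\<alpha> - 1) * (\<Sum>k<n. laplace_factor a \<alpha> k) = a - laplace_rest a \<alpha> n"
proof (induction n)
  case (Suc n)
  let ?P = "\<Prod>i<n. (real i + a) / (real i + a + \<alpha>)"
  have d: "real n + a + \<alpha> \<noteq> 0" using assms by simp
  have f: "laplace_factor a \<alpha> n = ?P * ((real n + a) / (real n + a + \<alpha>))"
    by (simp add: laplace_factor_def lessThan_Suc_atMost[symmetric])
  have "laplace_rest a \<alpha> n - laplace_rest a \<alpha> (Suc n) = (\<alpha> - 1) * laplace_factor a \<alpha> n"
    unfolding laplace_rest_def f prod.lessThan_Suc using d by (simp add: field_simps)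
  then show ?case using Suc by (simp add: algebra_simps)
qed (simp add: laplace_rest_def)

text \<open>With \<open>s = n + 1\<close>, each step multiplies the remainder by
  \<open>(s + a) / (s + 2 * a) = 1 - a / (s + 2 * a)\<close>; these deficits are at least a multiple
  of \<open>1 / s\<close>, so divergence of the harmonic series drives the product to 0.\<close>

lemma laplace_rest_LIMSEQ:
  assumes a: "0 < a"
  shows "laplace_rest a (1 + a) \<longlonglongrightarrow> 0"
proof -
  \<comment> \<open>The constant in the exponent comes from
    \<open>s + 2 * a <= (1 + 2 * a) * s\<close> for \<open>s >= 1\<close>.\<close>
  have bound: "laplace_rest a (1 + a) n \<le> a * exp (- (a / (1 + 2 * a)) * harm n)" for n
  proof (induction n)
    case 0
    then show ?case by (simp add: laplace_rest_def harm_def)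
  next
    case (Suc n)
    define s where "s = real (Suc n)"
    have s: "1 \<le> s" by (simp add: s_def)
    have "laplace_rest a (1 + a) (Suc n) = laplace_rest a (1 + a) n * ((s + a) / (s + 2 * a))"
      using a s by (simp add: laplace_rest_def s_def field_simps)
    also have "\<dots> \<le> (a * exp (- (a / (1 + 2 * a)) * harm n)) * exp (- (a / (1 + 2 * a)) * inverse s)"
    proof (rule mult_mono[OF Suc])
      have "(s + a) / (s + 2 * a) = 1 + - (a / (s + 2 * a))" using a s by (simp add: field_simps)
      also have "\<dots> \<le> exp (- (a / (s + 2 * a)))" by (rule exp_ge_add_one_self)
      also have "\<dots> \<le> exp (- (a / (1 + 2 * a)) * inverse s)"
      proof -
        have "s + 2 * a \<le> (1 + 2 * a) * s" using a s by (simp add: algebra_simps)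
        then have "a / ((1 + 2 * a) * s) \<le> a / (s + 2 * a)" using a s by (intro divide_left_mono) auto
        then show ?thesis by (simp add: inverse_eq_divide)
      qed
      finally show "(s + a) / (s + 2 * a) \<le> exp (- (a / (1 + 2 * a)) * inverse s)" .
    qed (use a s in auto)
    also have "\<dots> = a * exp (- (a / (1 + 2 * a)) * harm (Suc n))"
      by (simp add: harm_Suc s_def exp_add[symmetric] distrib_left)
    finally show ?case .
  qed
  have lim: "(\<lambda>n. a * exp (- (a / (1 + 2 * a)) * ln (real n + 1))) \<longlonglongrightarrow> 0"
    using a by real_asymp
  show ?thesis
  proof (rule tendsto_sandwich[OF _ _ tendsto_const lim])
    show "\<forall>\<^sub>F n in sequentially. laplace_rest a (1 + a) n \<le> a * exp (- (a / (1 + 2 * a)) * ln (real n + 1))"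
    proof (intro always_eventually allI)
      fix n
      have "a / (1 + 2 * a) * ln (real n + 1) \<le> a / (1 + 2 * a) * harm n"
        using a ln_le_harm[of n] by (intro mult_left_mono) auto
      then have "a * exp (- (a / (1 + 2 * a)) * harm n) \<le> a * exp (- (a / (1 + 2 * a)) * ln (real n + 1))"
        using a by (intro mult_left_mono) auto
      then show "laplace_rest a (1 + a) n \<le> a * exp (- (a / (1 + 2 * a)) * ln (real n + 1))"
        using bound[of n] by linarith
    qed
    show "\<forall>\<^sub>F n in sequentially. 0 \<le> laplace_rest a (1 + a) n"
      using a laplace_rest_nonneg by (intro always_eventually) auto
  qed
qed

text \<open>At \<open>\<alpha> = 1 + a\<close> the factor \<open>\<alpha> - 1\<close> equals the
  initial value \<open>a\<close> of the remainder, so the sum telescopes to exactly 1; this is where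
  the Malthusian parameter comes from.\<close>

lemma laplace_factor_sums:
  assumes "0 < a"
  shows "laplace_factor a (1 + a) sums 1"
proof -
  have "(\<lambda>n. (a - laplace_rest a (1 + a) n) / a) \<longlonglongrightarrow> (a - 0) / a"
    by (intro tendsto_intros laplace_rest_LIMSEQ assms) (use assms in auto)
  moreover have "(a - laplace_rest a (1 + a) n) / a = (\<Sum>k<n. laplace_factor a (1 + a) k)" for n
    using sum_laplace_factor[of a "1 + a" n] assms by (simp add: field_simps)
  ultimately show ?thesis using assms by (simp add: sums_def)
qed

lemma laplace_factor_summable:
  assumes "0 < a" "1 < \<alpha>"
  shows "summable (laplace_factor a \<alpha>)"
proof (rule summableI_nonneg_bounded)
  show "0 \<le> laplace_factor a \<alpha> k" for k using laplace_factor_pos[of a \<alpha> k] assms by simp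
  fix n
  have "(\<alpha> - 1) * (\<Sum>k<n. laplace_factor a \<alpha> k) \<le> a"
    using sum_laplace_factor[of a \<alpha> n] laplace_rest_nonneg[of a \<alpha> n] assms by simp
  then show "(\<Sum>k<n. laplace_factor a \<alpha> k) \<le> a / (\<alpha> - 1)"
    using assms by (simp add: field_simps)
qed

section \<open>The mean measure and the Malthusian parameter\<close>

context branching
begin

text \<open>Campbell's formula: the mean measure is the image of the product of \<open>N\<close>
  with counting measure under the map that sends outcome and index to the point.\<close>

lemma nn_integral_mean_measure:
  assumes [measurable]: "f \<in> borel_measurable borel"
  shows "(\<integral>\<^sup>+t. f t \<partial>mean_measure N \<xi>) = (\<Sum>k. \<integral>\<^sup>+\<omega>. f (\<xi> \<omega> k) \<partial>N)"
proof -
  let ?C = "count_space (UNIV :: nat set)"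
  let ?h = "\<lambda>(\<omega>, k). \<xi> \<omega> k"
  interpret C: sigma_finite_measure ?C by (rule sigma_finite_measure_count_space)
  have h[measurable]: "?h \<in> N \<Otimes>\<^sub>M ?C \<rightarrow>\<^sub>M borel"
    unfolding case_prod_beta by (rule measurable_compose_countable[OF _ measurable_snd]) measurable
  have eq: "mean_measure N \<xi> = distr (N \<Otimes>\<^sub>M ?C) borel ?h"
  proof (rule measure_eqI)
    have sets_mean: "sets (mean_measure N \<xi>) = sets borel"
      using sets.sigma_sets_eq[of "borel :: real measure"] by (simp add: mean_measure_def)
    then show "sets (mean_measure N \<xi>) = sets (distr (N \<Otimes>\<^sub>M ?C) borel ?h)" by simp
    fix A assume "A \<in> sets (mean_measure N \<xi>)"
    then have A: "A \<in> sets borel" unfolding sets_mean .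
    have S: "?h -` A \<inter> space (N \<Otimes>\<^sub>M ?C) \<in> sets (N \<Otimes>\<^sub>M ?C)" using measurable_sets[OF h A] .
    have "emeasure (distr (N \<Otimes>\<^sub>M ?C) borel ?h) A = (\<integral>\<^sup>+\<omega>. emeasure ?C (Pair \<omega> -` (?h -` A \<inter> space (N \<Otimes>\<^sub>M ?C))) \<partial>N)"
      by (simp only: emeasure_distr[OF h A] C.emeasure_pair_measure_alt[OF S])
    also have "\<dots> = (\<integral>\<^sup>+\<omega>. emeasure ?C {k. \<xi> \<omega> k \<in> A} \<partial>N)"
      by (intro nn_integral_cong arg_cong[of _ _ "emeasure ?C"]) (auto simp: space_pair_measure)
    finally show "emeasure (mean_measure N \<xi>) A = emeasure (distr (N \<Otimes>\<^sub>M ?C) borel ?h) A"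
      using emeasure_mean_measure[OF \<xi>_measurable A] by simp
  qed
  have m: "(\<lambda>z. f (?h z)) \<in> borel_measurable (N \<Otimes>\<^sub>M ?C)" by measurable
  have "(\<integral>\<^sup>+t. f t \<partial>mean_measure N \<xi>) = (\<integral>\<^sup>+z. f (?h z) \<partial>(N \<Otimes>\<^sub>M ?C))"
    unfolding eq by (rule nn_integral_distr) measurable
  also have "\<dots> = (\<integral>\<^sup>+\<omega>. \<integral>\<^sup>+k. f (?h (\<omega>, k)) \<partial>?C \<partial>N)"
    using C.nn_integral_fst[OF m] by simp
  also have "\<dots> = (\<integral>\<^sup>+\<omega>. (\<Sum>k. f (\<xi> \<omega> k)) \<partial>N)"
    by (simp add: nn_integral_count_space_nat)
  also have "\<dots> = (\<Sum>k. \<integral>\<^sup>+\<omega>. f (\<xi> \<omega> k) \<partial>N)"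
    by (rule nn_integral_suminf) measurable
  finally show ?thesis .
qed

lemma nn_integral_E:
  assumes "f \<in> borel_measurable borel"
  shows "(\<integral>\<^sup>+\<omega>. f (E k \<omega>) \<partial>N) = (\<integral>\<^sup>+y. f y \<partial>expo (real k + a))"
  using assms by (simp add: distributed_distr_eq_density[OF E_exp, symmetric] nn_integral_distr)

lemma AE_E_pos: "AE \<omega> in N. \<forall>k. 0 < E k \<omega>"
  unfolding AE_all_countable
proof
  fix k
  have "AE y in expo (real k + a). 0 < y" by (rule AE_expo_pos)
  then have "AE y in distr N lborel (E k). 0 < y" unfolding distributed_distr_eq_density[OF E_exp] .
  then show "AE \<omega> in N. 0 < E k \<omega>" by (subst (asm) AE_distr_iff) auto
qed

lemma laplace_point:
  assumes "0 \<le> \<alpha>"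
  shows "(\<integral>\<^sup>+\<omega>. ennreal (exp (- \<alpha> * \<xi> \<omega> k)) \<partial>N) = ennreal (laplace_factor a \<alpha> k)"
proof -
  have "(\<integral>\<^sup>+\<omega>. ennreal (exp (- \<alpha> * \<xi> \<omega> k)) \<partial>N) = (\<integral>\<^sup>+\<omega>. (\<Prod>i\<le>k. ennreal (exp (- \<alpha> * E i \<omega>))) \<partial>N)"
    by (intro nn_integral_cong) (simp add: \<xi> exp_sum[symmetric] sum_distrib_left prod_ennreal sum_negf)
  also have "\<dots> = (\<Prod>i\<le>k. \<integral>\<^sup>+\<omega>. ennreal (exp (- \<alpha> * E i \<omega>)) \<partial>N)"
  proof (rule N.indep_vars_nn_integral)
    show "N.indep_vars (\<lambda>_. borel) (\<lambda>i \<omega>. ennreal (exp (- \<alpha> * E i \<omega>))) {..k}"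
      by (rule N.indep_vars_compose2[OF N.indep_vars_subset[OF E_indep]]) auto
  qed auto
  also have "\<dots> = (\<Prod>i\<le>k. ennreal ((real i + a) / (real i + a + \<alpha>)))"
  proof (rule prod.cong[OF refl])
    fix i
    have p: "0 < real i + a" using a by simp
    have "(\<integral>\<^sup>+\<omega>. ennreal (exp (- \<alpha> * E i \<omega>)) \<partial>N) = (\<integral>\<^sup>+y. ennreal (exp (- \<alpha> * y)) * 1 \<partial>expo (real i + a))"
      using nn_integral_E[of "\<lambda>y. ennreal (exp (- \<alpha> * y))" i] by simp
    also have "\<dots> = ennreal ((real i + a) / (real i + a + \<alpha>)) * (\<integral>\<^sup>+y. 1 \<partial>expo (real i + a + \<alpha>))"
      using p assms by (intro nn_integral_expo_exp) auto
    also have "(\<integral>\<^sup>+y. 1 \<partial>expo (real i + a + \<alpha>)) = 1"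
      using nn_integral_expo_power[of "real i + a + \<alpha>" 0] p assms by simp
    finally show "(\<integral>\<^sup>+\<omega>. ennreal (exp (- \<alpha> * E i \<omega>)) \<partial>N) = ennreal ((real i + a) / (real i + a + \<alpha>))" by simp
  qed
  also have "\<dots> = ennreal (laplace_factor a \<alpha> k)"
    unfolding laplace_factor_def using a assms by (intro prod_ennreal) auto
  finally show ?thesis .
qed

lemma nn_integral_mean_measure_nonneg:
  assumes [measurable]: "f \<in> borel_measurable borel"
  shows "(\<integral>\<^sup>+t\<in>{0..}. f t \<partial>mean_measure N \<xi>) = (\<Sum>k. \<integral>\<^sup>+\<omega>. f (\<xi> \<omega> k) \<partial>N)"
proof -
  have "(\<integral>\<^sup>+\<omega>. f (\<xi> \<omega> k) * indicator {0..} (\<xi> \<omega> k) \<partial>N) = (\<integral>\<^sup>+\<omega>. f (\<xi> \<omega> k) \<partial>N)" for k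
  proof (rule nn_integral_cong_AE)
    show "AE \<omega> in N. f (\<xi> \<omega> k) * indicator {0..} (\<xi> \<omega> k) = f (\<xi> \<omega> k)"
      using AE_E_pos AE_space
    proof eventually_elim
      case (elim \<omega>)
      then have "0 \<le> \<xi> \<omega> k" by (simp add: \<xi> sum_nonneg less_imp_le)
      then show ?case by simp
    qed
  qed
  then show ?thesis by (subst nn_integral_mean_measure) auto
qed

lemma laplace_mean_measure:
  "0 \<le> \<alpha> \<Longrightarrow> (\<integral>\<^sup>+t\<in>{0..}. ennreal (exp (- \<alpha> * t)) \<partial>mean_measure N \<xi>) = (\<Sum>k. ennreal (laplace_factor a \<alpha> k))"
  by (subst nn_integral_mean_measure_nonneg) (simp_all only: laplace_point, measurable)

text \<open>All terms decrease weakly in the parameter and the one for \<open>k = 0\<close>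
  strictly; finiteness of the remaining sum keeps the inequality strict. This gives the uniqueness
  on which \<open>THE\<close> depends.\<close>

lemma laplace_strict:
  assumes "0 \<le> \<alpha>" "\<alpha> < \<beta>" "(\<Sum>k. ennreal (laplace_factor a \<beta> k)) = 1"
  shows "(\<Sum>k. ennreal (laplace_factor a \<alpha> k)) \<noteq> 1"
proof -
  let ?R = "\<lambda>\<alpha>. \<Sum>k. ennreal (laplace_factor a \<alpha> (Suc k))"
  have split: "(\<Sum>k. ennreal (laplace_factor a \<alpha> k)) = ennreal (laplace_factor a \<alpha> 0) + ?R \<alpha>" for \<alpha>
    using suminf_offset[of "\<lambda>k. ennreal (laplace_factor a \<alpha> k)" 1] by simp
  have "?R \<beta> \<le> ?R \<alpha>"
    unfolding laplace_factor_def using a assms(1,2)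
    by (intro suminf_le ennreal_leI prod_mono conjI divide_left_mono) auto
  have fin: "?R \<beta> < \<top>" using assms(3) unfolding split[of \<beta>] by (metis add.commute ennreal_add_eq_top ennreal_one_neq_top less_top)
  have "laplace_factor a \<beta> 0 < laplace_factor a \<alpha> 0"
    using a assms(1,2) by (simp add: laplace_factor_def divide_strict_left_mono)
  then have "ennreal (laplace_factor a \<beta> 0) < ennreal (laplace_factor a \<alpha> 0)"
    using laplace_factor_pos[OF a, of \<beta> 0] assms by (intro ennreal_lessI) auto
  then have "?R \<beta> + ennreal (laplace_factor a \<beta> 0) < ?R \<beta> + ennreal (laplace_factor a \<alpha> 0)"
    using fin by (simp add: ennreal_add_left_cancel_less)
  also have "\<dots> \<le> ?R \<alpha> + ennreal (laplace_factor a \<alpha> 0)"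
    using \<open>?R \<beta> \<le> ?R \<alpha>\<close> by (intro add_right_mono)
  finally show ?thesis using assms(3) unfolding split by (simp add: add.commute)
qed

lemma malthusian_parameter_iff: "is_malthusian_parameter N \<xi> \<alpha> \<longleftrightarrow> \<alpha> = 1 + a"
proof -
  have one: "(\<Sum>k. ennreal (laplace_factor a (1 + a) k)) = 1"
    using laplace_factor_sums[OF a] laplace_factor_pos[OF a, of "1 + a"] a
    by (subst suminf_ennreal2) (auto simp: sums_iff less_imp_le)
  show ?thesis
  proof
    assume l: "is_malthusian_parameter N \<xi> \<alpha>"
    then have "0 \<le> \<alpha>" "(\<Sum>k. ennreal (laplace_factor a \<alpha> k)) = 1"
      using laplace_mean_measure[of \<alpha>] by (auto simp: is_malthusian_parameter_def)
    then show "\<alpha> = 1 + a" using one laplace_strict[of \<alpha> "1 + a"] laplace_strict[of "1 + a" \<alpha>] a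
      by (cases \<alpha> "1 + a" rule: linorder_cases) auto
  next
    assume "\<alpha> = 1 + a"
    then show "is_malthusian_parameter N \<xi> \<alpha>"
      using laplace_mean_measure[of \<alpha>] one a by (simp add: is_malthusian_parameter_def)
  qed
qed

lemma supercritical_\<xi>: "supercritical N \<xi>"
  by (simp add: supercritical_def malthusian_parameter_iff)

lemma malthusian_parameter_\<xi>: "malthusian_parameter N \<xi> = 1 + a"
  by (simp add: malthusian_parameter_def malthusian_parameter_iff)

lemma malthusian_mu_sum: "malthusian_mu N \<xi> = (\<Sum>k. \<integral>\<^sup>+\<omega>. ennreal (\<xi> \<omega> k * exp (- (1 + a) * \<xi> \<omega> k)) \<partial>N)"
  unfolding malthusian_mu_def malthusian_parameter_\<xi> by (rule nn_integral_mean_measure_nonneg) measurable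

lemma malthusian_mu_finite: "malthusian_mu N \<xi> < \<infinity>"
proof -
  have "malthusian_mu N \<xi> \<le> (\<Sum>k. ennreal (2 / a * laplace_factor a (1 + a / 2) k))"
    unfolding malthusian_mu_sum
  proof (intro suminf_le summableI)
    fix k
    \<comment> \<open>Half of the excess \<open>a\<close> over the threshold 1 pays for the factor
      \<open>t\<close>; the other half keeps the Laplace factors summable.\<close>
    have "t * exp (- (1 + a) * t) \<le> 2 / a * exp (- (1 + a / 2) * t)" for t :: real
    proof -
      have "a / 2 * t \<le> exp (a / 2 * t)" using exp_ge_add_one_self[of "a / 2 * t"] by linarith
      then have "2 / a * (a / 2 * t) * exp (- (1 + a) * t) \<le> 2 / a * exp (a / 2 * t) * exp (- (1 + a) * t)"
        using a by (intro mult_right_mono mult_left_mono) auto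
      then show ?thesis using a by (simp add: mult.assoc exp_add[symmetric] algebra_simps)
    qed
    then have "(\<integral>\<^sup>+\<omega>. ennreal (\<xi> \<omega> k * exp (- (1 + a) * \<xi> \<omega> k)) \<partial>N)
        \<le> (\<integral>\<^sup>+\<omega>. ennreal (2 / a) * ennreal (exp (- (1 + a / 2) * \<xi> \<omega> k)) \<partial>N)"
      using a by (intro nn_integral_mono) (simp add: ennreal_mult[symmetric] ennreal_leI)
    also have "\<dots> = ennreal (2 / a) * (\<integral>\<^sup>+\<omega>. ennreal (exp (- (1 + a / 2) * \<xi> \<omega> k)) \<partial>N)"
      by (rule nn_integral_cmult) measurable
    also have "\<dots> = ennreal (2 / a * laplace_factor a (1 + a / 2) k)"
      using a laplace_factor_pos[OF a, of "1 + a / 2" k]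
      by (subst laplace_point) (auto simp: ennreal_mult[symmetric])
    finally show "(\<integral>\<^sup>+\<omega>. ennreal (\<xi> \<omega> k * exp (- (1 + a) * \<xi> \<omega> k)) \<partial>N) \<le> ennreal (2 / a * laplace_factor a (1 + a / 2) k)" .
  qed
  also have "\<dots> = ennreal (\<Sum>k. 2 / a * laplace_factor a (1 + a / 2) k)"
    using a laplace_factor_pos[OF a, of "1 + a / 2"]
    by (intro suminf_ennreal2 summable_mult laplace_factor_summable) (auto simp: less_imp_le)
  finally show ?thesis by (auto simp: less_top[symmetric] top_unique)
qed

text \<open>The first point alone contributes a positive amount. Positivity allows division by
  \<open>\<mu> * \<alpha>\<close> in the limits.\<close>

lemma malthusian_mu_pos: "0 < malthusian_mu N \<xi>"
proof -
  let ?f = "\<lambda>k. \<integral>\<^sup>+\<omega>. ennreal (\<xi> \<omega> k * exp (- (1 + a) * \<xi> \<omega> k)) \<partial>N"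
  have "?f 0 = (\<integral>\<^sup>+\<omega>. ennreal (exp (- (1 + a) * E 0 \<omega>)) * ennreal (E 0 \<omega>) \<partial>N)"
    by (intro nn_integral_cong) (simp add: \<xi> ennreal_mult'' mult.commute)
  also have "\<dots> = (\<integral>\<^sup>+y. ennreal (exp (- (1 + a) * y)) * ennreal (y ^ 1) \<partial>expo a)"
    using nn_integral_E[of "\<lambda>y. ennreal (exp (- (1 + a) * y)) * ennreal y" 0] by simp
  also have "\<dots> = ennreal (a / (a + (1 + a))) * (\<integral>\<^sup>+y. ennreal (y ^ 1) \<partial>expo (a + (1 + a)))"
    using a by (intro nn_integral_expo_exp) auto
  also have "\<dots> = ennreal (a / (a + (1 + a))) * ennreal (fact 1 / (a + (1 + a)) ^ 1)"
    using a by (subst nn_integral_expo_power) auto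
  also have "0 < \<dots>" using a by (simp add: ennreal_zero_less_mult_iff)
  finally have "0 < ?f 0" .
  also have "?f 0 \<le> (\<Sum>k. ?f k)"
    using sum_le_suminf[of ?f "{0}"] by simp
  finally show ?thesis unfolding malthusian_mu_sum .
qed

lemma malthusian_\<xi>: "malthusian N \<xi>"
  using supercritical_\<xi> malthusian_mu_finite by (simp add: malthusian_def)

text \<open>The Laplace transforms of the points at \<open>1 + a\<close> sum to 1, so the sum of the
  exponentials is finite almost surely and its terms tend to 0: a single process does not
  explode.\<close>

lemma AE_\<xi>_unbounded: "AE \<omega> in N. \<forall>t. \<exists>k. t < \<xi> \<omega> k"
proof -
  have pos: "0 \<le> 1 + a" using a by simp
  have "(\<integral>\<^sup>+\<omega>. (\<Sum>k. ennreal (exp (- (1 + a) * \<xi> \<omega> k))) \<partial>N)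
      = (\<Sum>k. \<integral>\<^sup>+\<omega>. ennreal (exp (- (1 + a) * \<xi> \<omega> k)) \<partial>N)"
    by (rule nn_integral_suminf) measurable
  also have "\<dots> = (\<Sum>k. ennreal (laplace_factor a (1 + a) k))"
    by (simp only: laplace_point[OF pos])
  also have "\<dots> = ennreal 1"
    using laplace_factor_sums[OF a] laplace_factor_pos[OF a, of "1 + a"] a
    by (subst suminf_ennreal2) (auto simp: sums_iff less_imp_le)
  finally have "AE \<omega> in N. (\<Sum>k. ennreal (exp (- (1 + a) * \<xi> \<omega> k))) \<noteq> \<infinity>"
    by (intro nn_integral_PInf_AE) auto
  then show ?thesis
  proof eventually_elim
    case (elim \<omega>)
    then have "summable (\<lambda>k. exp (- (1 + a) * \<xi> \<omega> k))" by (intro summable_suminf_not_top) auto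
    then have lim: "(\<lambda>k. exp (- (1 + a) * \<xi> \<omega> k)) \<longlonglongrightarrow> 0" by (rule summable_LIMSEQ_zero)
    show ?case
    proof
      fix t
      have "\<forall>\<^sub>F k in sequentially. exp (- (1 + a) * \<xi> \<omega> k) < exp (- (1 + a) * t)"
        by (rule order_tendstoD(2)[OF lim]) simp
      then obtain k where "exp (- (1 + a) * \<xi> \<omega> k) < exp (- (1 + a) * t)" by (auto simp: eventually_sequentially)
      then have "(1 + a) * t < (1 + a) * \<xi> \<omega> k"
        by (simp only: exp_less_cancel_iff minus_mult_left[symmetric] neg_less_iff_less)
      then show "\<exists>k. t < \<xi> \<omega> k" using a by (auto simp: mult_less_cancel_left_pos)
    qed
  qed
qed

section \<open>The law of the number of points and the Lipschitz condition\<close>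

definition cdf_point :: "nat \<Rightarrow> real \<Rightarrow> real" where
  "cdf_point k t = N.prob {\<omega>\<in>space N. (\<Sum>i<k. E i \<omega>) \<le> t}"

text \<open>\<open>E k\<close> is independent of the earlier sum and has a density bounded by its
  rate; given the earlier sum, it must fall into an interval of length \<open>t - s\<close>.\<close>

lemma cdf_point_increment:
  assumes st: "s \<le> t"
  shows "cdf_point (Suc k) t - cdf_point (Suc k) s \<le> (real k + a) * (t - s)" "cdf_point (Suc k) s \<le> cdf_point (Suc k) t"
proof -
  let ?S = "\<lambda>\<omega>. \<Sum>i<k. E i \<omega>"
  let ?r = "real k + a"
  have r: "0 < ?r" using a by simp
  have sum: "(\<Sum>i<Suc k. E i \<omega>) = E k \<omega> + ?S \<omega>" for \<omega> by simp
  let ?A = "\<lambda>u. {\<omega>\<in>space N. (\<Sum>i<Suc k. E i \<omega>) \<le> u}"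
  have sub: "?A s \<subseteq> ?A t" using st by auto
  show "cdf_point (Suc k) s \<le> cdf_point (Suc k) t"
    unfolding cdf_point_def by (rule N.finite_measure_mono[OF sub]) measurable
  have "cdf_point (Suc k) t - cdf_point (Suc k) s = N.prob (?A t - ?A s)"
    unfolding cdf_point_def by (rule N.finite_measure_Diff[symmetric, OF _ _ sub]) measurable
  also have "?A t - ?A s = (\<lambda>\<omega>. (E k \<omega>, ?S \<omega>)) -` {z. s < fst z + snd z \<and> fst z + snd z \<le> t} \<inter> space N"
    unfolding sum by auto
  finally have d: "cdf_point (Suc k) t - cdf_point (Suc k) s
      = N.prob ((\<lambda>\<omega>. (E k \<omega>, ?S \<omega>)) -` {z. s < fst z + snd z \<and> fst z + snd z \<le> t} \<inter> space N)" .
  let ?Z = "{z :: real \<times> real. s < fst z + snd z \<and> fst z + snd z \<le> t}"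
  let ?DE = "distr N borel (E k)" and ?DS = "distr N borel ?S"
  interpret DE: prob_space ?DE by (rule N.prob_space_distr) measurable
  interpret DS: prob_space ?DS by (rule N.prob_space_distr) measurable
  interpret P: pair_sigma_finite ?DE ?DS ..
  have "Measurable.pred (borel \<Otimes>\<^sub>M borel) (\<lambda>z :: real \<times> real. s < fst z + snd z \<and> fst z + snd z \<le> t)"
    by measurable
  then have Z[measurable]: "?Z \<in> sets (borel \<Otimes>\<^sub>M borel)" by (simp add: pred_def space_pair_measure)
  have "N.indep_var borel (E k) borel ?S"
    by (rule N.indep_vars_sum[OF _ _ N.indep_vars_subset[OF E_indep]]) auto
  then have eq: "?DE \<Otimes>\<^sub>M ?DS = distr N (borel \<Otimes>\<^sub>M borel) (\<lambda>\<omega>. (E k \<omega>, ?S \<omega>))"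
    using N.indep_var_distribution_eq by blast
  have DE: "?DE = expo ?r"
  proof -
    have "?DE = distr N lborel (E k)" by (rule distr_cong) auto
    then show ?thesis using distributed_distr_eq_density[OF E_exp[of k]] by simp
  qed
  have "ennreal (N.prob ((\<lambda>\<omega>. (E k \<omega>, ?S \<omega>)) -` ?Z \<inter> space N)) = emeasure (?DE \<Otimes>\<^sub>M ?DS) ?Z"
    unfolding eq by (subst emeasure_distr) (auto simp: N.emeasure_eq_measure)
  also have "\<dots> = (\<integral>\<^sup>+y. emeasure ?DE ((\<lambda>e. (e, y)) -` ?Z) \<partial>?DS)"
    by (rule P.emeasure_pair_measure_alt2) (simp add: sets_pair_measure_cong[of ?DE borel ?DS borel])
  also have "\<dots> \<le> (\<integral>\<^sup>+y. ennreal (?r * (t - s)) \<partial>?DS)"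
  proof (rule nn_integral_mono)
    fix y
    have "(\<lambda>e. (e, y)) -` ?Z = {s - y<..t - y}" by auto
    then have "emeasure ?DE ((\<lambda>e. (e, y)) -` ?Z) = (\<integral>\<^sup>+e. ennreal (exponential_density ?r e) * indicator {s - y<..t - y} e \<partial>lborel)"
      unfolding DE by (simp add: emeasure_density)
    also have "\<dots> \<le> (\<integral>\<^sup>+e. ennreal ?r * indicator {s - y<..t - y} e \<partial>lborel)"
      using r by (intro nn_integral_mono mult_right_mono ennreal_leI) (auto simp: exponential_density_def mult_le_cancel_left1)
    also have "\<dots> = ennreal ?r * ennreal (t - s)"
      using st by (simp add: nn_integral_cmult)
    finally show "emeasure ?DE ((\<lambda>e. (e, y)) -` ?Z) \<le> ennreal (?r * (t - s))"
      using st r by (simp add: ennreal_mult)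
  qed
  also have "\<dots> = ennreal (?r * (t - s))" using DS.emeasure_space_1 by simp
  finally show "cdf_point (Suc k) t - cdf_point (Suc k) s \<le> ?r * (t - s)"
    unfolding d using st r by (simp add: ennreal_le_iff)
qed

text \<open>With positive waiting times and no explosion, exactly \<open>k\<close> points up to
  \<open>t\<close> means that \<open>t\<close> lies between two consecutive partial sums. Both
  conditions hold almost surely, and the two events for the partial sums are nested.\<close>

lemma prob_points_upto:
  assumes t: "0 \<le> t"
  shows "\<P>(\<omega> in N. points_upto (\<xi> \<omega>) t = k) = cdf_point k t - cdf_point (Suc k) t"
proof -
  let ?A = "\<lambda>k. {\<omega>\<in>space N. (\<Sum>i<k. E i \<omega>) \<le> t}"
  have "AE \<omega> in N. \<omega> \<in> ?A (Suc k) \<longrightarrow> \<omega> \<in> ?A k"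
    using AE_E_pos by eventually_elim (auto intro: order_trans[rotated] simp: less_imp_le)
  have [measurable]: "Measurable.pred N (\<lambda>\<omega>. points_upto (\<xi> \<omega>) t = k)"
  proof -
    have [measurable]: "(\<lambda>\<omega>. points_upto (\<xi> \<omega>) t) \<in> N \<rightarrow>\<^sub>M count_space UNIV"
      unfolding points_upto_def by (rule measurable_card) measurable
    show ?thesis by measurable
  qed
  have "\<P>(\<omega> in N. points_upto (\<xi> \<omega>) t = k) = N.prob (?A k - (?A (Suc k) \<inter> ?A k))"
  proof (rule N.finite_measure_eq_AE)
    show "AE \<omega> in N. \<omega> \<in> {\<omega>\<in>space N. points_upto (\<xi> \<omega>) t = k} \<longleftrightarrow> \<omega> \<in> ?A k - (?A (Suc k) \<inter> ?A k)"
      using AE_E_pos AE_\<xi>_unbounded AE_space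
    proof eventually_elim
      case (elim \<omega>)
      let ?s = "\<lambda>n. \<Sum>i<n. E i \<omega>"
      have upto: "points_upto (\<xi> \<omega>) t = n" if "?s n \<le> t" "t < ?s (Suc n)" for n
      proof -
        have "\<xi> \<omega> = (\<lambda>k. \<Sum>i\<le>k. E i \<omega>)" using elim by (auto simp: \<xi>)
        then show ?thesis using points_upto_partial_sums[of "\<lambda>i. E i \<omega>" t n] elim that by (simp add: less_imp_le)
      qed
      obtain j where "t < ?s (Suc j)" using elim by (auto simp: \<xi> lessThan_Suc_atMost)
      then have ex: "\<exists>n. t < ?s (Suc n)" by blast
      define n where "n = (LEAST n. t < ?s (Suc n))"
      have n1: "t < ?s (Suc n)" unfolding n_def using ex by (rule LeastI_ex)
      have n2: "?s n \<le> t"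
      proof (cases n)
        case 0
        then show ?thesis using t by simp
      next
        case (Suc i)
        then have "\<not> t < ?s (Suc i)" using not_less_Least[of i "\<lambda>n. t < ?s (Suc n)"] by (simp add: n_def)
        then show ?thesis using Suc by simp
      qed
      have "points_upto (\<xi> \<omega>) t = k \<longleftrightarrow> ?s k \<le> t \<and> t < ?s (Suc k)"
        using upto[OF n2 n1] upto[of k] n1 n2 by auto
      then show ?case using elim by auto
    qed
  qed measurable
  also have "\<dots> = N.prob (?A k) - N.prob (?A (Suc k) \<inter> ?A k)"
    by (rule N.finite_measure_Diff) (auto intro: sets.Int)
  also have "N.prob (?A (Suc k) \<inter> ?A k) = N.prob (?A (Suc k))"
  proof (rule N.finite_measure_eq_AE)
    show "AE \<omega> in N. \<omega> \<in> ?A (Suc k) \<inter> ?A k \<longleftrightarrow> \<omega> \<in> ?A (Suc k)"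
      using AE_E_pos
    proof eventually_elim
      case (elim \<omega>)
      then have "0 < E k \<omega>" by blast
      then show ?case by auto
    qed
  qed measurable
  finally show ?thesis by (simp add: cdf_point_def)
qed

lemma lipschitz_condition_\<xi>: "lipschitz_condition N \<xi>"
  unfolding lipschitz_condition_def
proof
  fix k
  have incr: "\<bar>cdf_point k t - cdf_point k s\<bar> \<le> (real k + a) * (t - s)
      \<and> \<bar>cdf_point (Suc k) t - cdf_point (Suc k) s\<bar> \<le> (real k + a) * (t - s)"
    if st: "0 \<le> s" "s \<le> t" for s t
  proof
    show "\<bar>cdf_point (Suc k) t - cdf_point (Suc k) s\<bar> \<le> (real k + a) * (t - s)"
      using cdf_point_increment[OF st(2), of k] by simp
    show "\<bar>cdf_point k t - cdf_point k s\<bar> \<le> (real k + a) * (t - s)"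
    proof (cases k)
      case 0
      \<comment> \<open>For \<open>k = 0\<close> the empty sum makes \<open>cdf_point\<close>
        constant on nonnegative times.\<close>
      then show ?thesis using st a by (simp add: cdf_point_def)
    next
      case (Suc j)
      have "(real j + a) * (t - s) \<le> (real k + a) * (t - s)" using st Suc by (intro mult_right_mono) auto
      then show ?thesis using cdf_point_increment[OF st(2), of j] Suc by simp
    qed
  qed
  let ?f = "\<lambda>t. \<P>(\<omega> in N. points_upto (\<xi> \<omega>) t = k)"
  have step: "\<bar>?f t - ?f s\<bar> \<le> 2 * (real k + a) * (t - s)" if "0 \<le> s" "s \<le> t" for s t
  proof -
    have "?f t - ?f s = (cdf_point k t - cdf_point k s) - (cdf_point (Suc k) t - cdf_point (Suc k) s)"
      using that prob_points_upto[of s k] prob_points_upto[of t k] by simp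
    then show ?thesis using incr[OF that] by (simp only: mult.assoc) linarith
  qed
  have "(2 * (real k + a))-lipschitz_on {0..} ?f"
  proof (rule lipschitz_onI)
    fix s t :: real assume "s \<in> {0..}" "t \<in> {0..}"
    then show "dist (?f s) (?f t) \<le> 2 * (real k + a) * dist s t"
      using step[of s t] step[of t s] by (cases "s \<le> t") (auto simp: dist_real_def abs_minus_commute)
  qed (use a in auto)
  then show "\<exists>L>0. L-lipschitz_on {0..} ?f" using a by (intro exI[of _ "2 * (real k + a)"]) auto
qed

end

section \<open>Limits in probability\<close>

text \<open>Dominated convergence is about sequences, so the limit along the reals is tested along
  all sequences tending to infinity.\<close>

lemma (in prob_space) AE_tendsto_imp_in_probability:
  fixes Y :: "real \<Rightarrow> 'a \<Rightarrow> real"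
  assumes Y[measurable]: "\<And>t. Y t \<in> borel_measurable M" and Z[measurable]: "Z \<in> borel_measurable M"
    and lim: "AE \<omega> in M. ((\<lambda>t. Y t \<omega>) \<longlongrightarrow> Z \<omega>) at_top"
  shows "tendsto_in_probability M Y Z at_top"
  unfolding tendsto_in_probability_def
proof (intro conjI allI impI Y Z tendsto_at_topI_sequentially)
  fix \<epsilon> :: real and t :: "nat \<Rightarrow> real"
  assume \<epsilon>: "0 < \<epsilon>" and t: "filterlim t at_top sequentially"
  let ?A = "\<lambda>n. {\<omega>\<in>space M. \<epsilon> < \<bar>Y (t n) \<omega> - Z \<omega>\<bar>}"
  have "(\<lambda>n. \<integral>\<omega>. indicator (?A n) \<omega> \<partial>M) \<longlonglongrightarrow> (\<integral>\<omega>. 0 \<partial>M :: real)"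
  proof (rule integral_dominated_convergence[where w = "\<lambda>_. 1"])
    show "AE \<omega> in M. (\<lambda>n. indicator (?A n) \<omega> :: real) \<longlonglongrightarrow> 0"
      using lim
    proof eventually_elim
      case (elim \<omega>)
      have "(\<lambda>n. Y (t n) \<omega>) \<longlonglongrightarrow> Z \<omega>" by (rule filterlim_compose[OF elim t])
      then have "\<forall>\<^sub>F n in sequentially. dist (Y (t n) \<omega>) (Z \<omega>) < \<epsilon>" using \<epsilon> by (rule tendstoD)
      then have "\<forall>\<^sub>F n in sequentially. indicator (?A n) \<omega> = (0 :: real)"
        by eventually_elim (auto simp: dist_real_def indicator_def)
      then show ?case by (rule tendsto_eventually)
    qed
  qed (auto simp: indicator_def)
  then show "(\<lambda>n. prob (?A n)) \<longlonglongrightarrow> 0" by simp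
qed

text \<open>With \<open>b = m * a = m + \<delta>\<close>, passing from \<open>k\<close> to
  \<open>k + 1\<close> multiplies the Gamma functions above and below by \<open>k + b\<close> and
  \<open>k + b + a + 2\<close>, which is the recursion; the prefactor fixes the value at 0.\<close>

lemma degree_recursion_Gamma:
  fixes m :: nat and \<delta> :: real
  assumes m: "1 \<le> m" and \<delta>: "- real m < \<delta>"
  shows "degree_recursion m (1 + \<delta> / real m) (\<lambda>k. (2 + \<delta> / real m)
      * (Gamma (2 + \<delta> / real m + real m + \<delta>) / Gamma (real m + \<delta>))
      * (Gamma (real k + real m + \<delta>) / Gamma (real k + real m + \<delta> + 3 + \<delta> / real m)))"
proof -
  define a where "a = 1 + \<delta> / real m"
  define b where "b = real m + \<delta>"
  have a: "0 < a" using m \<delta> by (simp add: a_def field_simps)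
  have b: "0 < b" using \<delta> by (simp add: b_def)
  have ma: "real m * a = b" using m by (simp add: a_def b_def field_simps)
  define p where "p k = (1 + a) * (Gamma (1 + a + b) / Gamma b) * (Gamma (real k + b) / Gamma (real k + b + (1 + a) + 1))" for k :: nat
  have G: "Gamma (z + 1) = z * Gamma z" if z: "0 < z" for z :: real
  proof -
    have "z \<notin> \<int>\<^sub>\<le>\<^sub>0" using z nonpos_Ints_nonpos[of z] by auto
    then show ?thesis by (rule Gamma_plus1)
  qed
  have G_pos: "0 < Gamma z" if "0 < z" for z :: real using that by (rule Gamma_real_pos)
  have "degree_recursion m a p"
  proof
    have "p 0 = (1 + a) / (1 + a + b)"
    proof -
      have e: "1 + a + b = b + (1 + a)" "real 0 + b = b" by simp_all
      have g: "Gamma (b + (1 + a) + 1) = (b + (1 + a)) * Gamma (b + (1 + a))" using a b by (intro G) simp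
      have "Gamma b \<noteq> 0" "Gamma (b + (1 + a)) \<noteq> 0"
        using a b by (intro G_pos[THEN less_imp_neq, symmetric]; simp)+
      moreover have "u * (v / w) * (w / (y * v)) = u / y" if "w \<noteq> 0" "v \<noteq> 0" for u v w y :: real
        using that by simp
      ultimately show ?thesis unfolding p_def e g by blast
    qed
    then show "p 0 * (1 + a + real m * a) = 1 + a" using a b by (simp add: ma)
    fix k
    let ?z = "real k + b"
    have z: "0 < ?z" "0 < ?z + (1 + a) + 1" using a b by (auto intro: add_nonneg_pos)
    have 1: "Gamma (real (Suc k) + b) = ?z * Gamma ?z"
      using G[OF z(1)] by (simp add: ac_simps)
    have 2: "Gamma (real (Suc k) + b + (1 + a) + 1) = (?z + (1 + a) + 1) * Gamma (?z + (1 + a) + 1)"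
      using G[OF z(2)] by (simp add: ac_simps)
    have "u * (v * g / (y * h)) = u * (g / h) * (v / y)" for u v g y h :: real
      by (simp add: ac_simps)
    then have "p (Suc k) = p k * (?z / (?z + (1 + a) + 1))" unfolding p_def 1 2 by blast
    moreover have "1 + a + (real (Suc k) + real m * a) = ?z + (1 + a) + 1" unfolding ma by simp
    moreover have "P * (z / y) * y = z * P" if "0 < y" for P z y :: real using that by simp
    ultimately show "p (Suc k) * (1 + a + (real (Suc k) + real m * a)) = (real k + real m * a) * p k"
      using z(2) unfolding ma by metis
  qed (use m a in auto)
  moreover have "p = (\<lambda>k. (2 + \<delta> / real m)
      * (Gamma (2 + \<delta> / real m + real m + \<delta>) / Gamma (real m + \<delta>))
      * (Gamma (real k + real m + \<delta>) / Gamma (real k + real m + \<delta> + 3 + \<delta> / real m)))"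
  proof
    fix k
    have e: "1 + a = 2 + \<delta> / real m" "2 + \<delta> / real m + b = 2 + \<delta> / real m + real m + \<delta>"
      "real k + b = real k + real m + \<delta>"
      "real k + real m + \<delta> + (2 + \<delta> / real m) + 1 = real k + real m + \<delta> + 3 + \<delta> / real m"
      by (simp_all add: a_def b_def)
    show "p k = (2 + \<delta> / real m)
      * (Gamma (2 + \<delta> / real m + real m + \<delta>) / Gamma (real m + \<delta>))
      * (Gamma (real k + real m + \<delta>) / Gamma (real k + real m + \<delta> + 3 + \<delta> / real m))"
      unfolding p_def e unfolding b_def ..
  qed
  ultimately show ?thesis by (simp add: a_def)
qed

theorem corollary1p4:
  fixes m :: nat and \<delta> :: real
    and N :: "'b measure" and \<xi> :: "'b \<Rightarrow> nat \<Rightarrow> real"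
    and M :: "'a measure" and X :: "nat list \<Rightarrow> 'a \<Rightarrow> nat \<Rightarrow> real"
  assumes "m \<ge> 2" and "\<delta> > - real m"
    and "prob_space N" and "embedding_birth_process N (\<lambda>k. real k + 1 + \<delta> / real m) \<xi>"
    and "prob_space M" and "iid_copies M X N \<xi>"
  shows "has_PA_law m \<delta> M (\<lambda>\<omega>. CBP_sequence m (\<lambda>u. X u \<omega>)) \<and>
    supercritical N \<xi> \<and> malthusian N \<xi> \<and> lipschitz_condition N \<xi> \<and>
    (let \<alpha> = malthusian_parameter N \<xi>;
         \<mu> = enn2real (malthusian_mu N \<xi>);
         p = (\<lambda>k. (2 + \<delta> / real m)
                * (Gamma (2 + \<delta> / real m + real m + \<delta>) / Gamma (real m + \<delta>))
                * (Gamma (real k + real m + \<delta>)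
                     / Gamma (real k + real m + \<delta> + 3 + \<delta> / real m)))
     in \<exists>\<Theta>\<in>borel_measurable M.
          (AE \<omega> in M. ((\<lambda>t. \<mu> * \<alpha> * exp (- \<alpha> * t) * real (population (\<lambda>u. X u \<omega>) t))
             \<longlongrightarrow> \<Theta> \<omega>) at_top) \<and>
          (AE \<omega> in M. ((\<lambda>t. real m * exp (- \<alpha> * t) * real (num_vertices m (\<lambda>u. X u \<omega>) t))
             \<longlongrightarrow> 1 / (\<mu> * \<alpha>) * \<Theta> \<omega>) at_top) \<and>
          (\<forall>k. tendsto_in_probability M
             (\<lambda>t \<omega>. real m * exp (- \<alpha> * t) * real (num_vertices_deg m (\<lambda>u. X u \<omega>) k t))
             (\<lambda>\<omega>. 1 / (\<mu> * \<alpha>) * p k * \<Theta> \<omega>) at_top) \<and>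
          (\<forall>k. tendsto_in_probability M
             (\<lambda>t \<omega>. real (num_vertices_deg m (\<lambda>u. X u \<omega>) k t)
                      / real (num_vertices m (\<lambda>u. X u \<omega>) t))
             (\<lambda>_. p k) at_top))"
proof -
  define a where "a = 1 + \<delta> / real m"
  have m: "1 \<le> m" using assms(1) by simp
  have a: "0 < a" using m assms(2) by (simp add: a_def field_simps)
  obtain E where E: "prob_space.indep_vars N (\<lambda>_. borel) E UNIV"
      "\<And>k. distributed N lborel (E k) (exponential_density (real k + a))"
      "\<And>\<omega> k. \<omega> \<in> space N \<Longrightarrow> \<xi> \<omega> k = (\<Sum>i\<le>k. E i \<omega>)"
    using assms(4) unfolding embedding_birth_process_def a_def by (auto simp: add.assoc)
  interpret branching a N \<xi> M X E
    by (rule branching.intro) (fact a assms E)+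
  define \<alpha> where "\<alpha> = malthusian_parameter N \<xi>"
  define \<mu> where "\<mu> = enn2real (malthusian_mu N \<xi>)"
  define p where "p = (\<lambda>k :: nat. (2 + \<delta> / real m)
      * (Gamma (2 + \<delta> / real m + real m + \<delta>) / Gamma (real m + \<delta>))
      * (Gamma (real k + real m + \<delta>) / Gamma (real k + real m + \<delta> + 3 + \<delta> / real m)))"
  have \<alpha>: "\<alpha> = 1 + a" unfolding \<alpha>_def by (rule malthusian_parameter_\<xi>)
  have \<mu>: "0 < \<mu>"
    using malthusian_mu_pos malthusian_mu_finite by (simp add: \<mu>_def enn2real_positive_iff less_top)
  have p: "degree_recursion m a p"
    unfolding a_def p_def by (rule degree_recursion_Gamma[OF m assms(2)])
  \<comment> \<open>Integer times determine the limit and make \<open>V\<close> measurable, as the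
    \<open>lim\<close> of a sequence of measurable functions.\<close>
  define V where "V \<omega> = lim (\<lambda>n. exp (- \<alpha> * real n) * real (population (x \<omega>) (real n)))" for \<omega>
  \<comment> \<open>Scaled to be the limit that defines \<open>\<Theta>\<close> in the statement;
    division by \<open>\<mu> * \<alpha>\<close> gives back \<open>V\<close>.\<close>
  define \<Theta> where "\<Theta> \<omega> = \<mu> * \<alpha> * V \<omega>" for \<omega>
  have \<mu>\<alpha>: "1 / (\<mu> * \<alpha>) * \<Theta> \<omega> = V \<omega>" for \<omega> using \<mu> a by (simp add: \<Theta>_def \<alpha>)
  have count[measurable]: "(\<lambda>\<omega>. real (population (x \<omega>) t)) \<in> borel_measurable M"
    "(\<lambda>\<omega>. real (num_vertices m (x \<omega>) t)) \<in> borel_measurable M"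
    "(\<lambda>\<omega>. real (num_vertices_deg m (x \<omega>) k t)) \<in> borel_measurable M" for k t
    using population_measurable num_vertices_measurable num_vertices_deg_measurable
    by (auto intro!: measurable_compose[where g = real])
  have V[measurable]: "V \<in> borel_measurable M"
    unfolding V_def[abs_def] by measurable
  have pop: "AE \<omega> in M. ((\<lambda>t. exp (- \<alpha> * t) * real (population (x \<omega>) t)) \<longlongrightarrow> V \<omega>) at_top"
    using AE_population_limit
  proof eventually_elim
    case (elim \<omega>)
    then obtain L where L: "((\<lambda>t. exp (- \<alpha> * t) * real (population (x \<omega>) t)) \<longlongrightarrow> L) at_top"
      unfolding \<alpha> by blast
    then have "V \<omega> = L"
      unfolding V_def by (intro limI filterlim_compose[OF L filterlim_real_sequentially])
    then show ?case using L by simp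
  qed
  have vert: "AE \<omega> in M. ((\<lambda>t. real m * exp (- \<alpha> * t) * real (num_vertices m (x \<omega>) t)) \<longlongrightarrow> V \<omega>) at_top"
    using pop AE_num_vertices_population[OF m] AE_regular
  proof eventually_elim
    case (elim \<omega>)
    show ?case
    proof (rule Lim_transform_eventually)
      show "((\<lambda>t. real m * real (num_vertices m (x \<omega>) t) / real (population (x \<omega>) t)
          * (exp (- \<alpha> * t) * real (population (x \<omega>) t))) \<longlongrightarrow> V \<omega>) at_top"
        using tendsto_mult[OF elim(2,1)] by simp
      show "\<forall>\<^sub>F t in at_top. real m * real (num_vertices m (x \<omega>) t) / real (population (x \<omega>) t)
          * (exp (- \<alpha> * t) * real (population (x \<omega>) t)) = real m * exp (- \<alpha> * t) * real (num_vertices m (x \<omega>) t)"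
        using eventually_ge_at_top[of 0]
      proof eventually_elim
        case (elim t)
        then have "1 \<le> population (x \<omega>) t" by (rule regular_births.population_pos[OF \<open>regular_births (x \<omega>)\<close>])
        then show ?case by simp
      qed
    qed
  qed
  have deg: "AE \<omega> in M. ((\<lambda>t. real m * exp (- \<alpha> * t) * real (num_vertices_deg m (x \<omega>) k t)) \<longlongrightarrow> p k * V \<omega>) at_top" for k
    using vert AE_num_vertices_deg[OF p, of k] AE_regular
  proof eventually_elim
    case (elim \<omega>)
    show ?case
    proof (rule Lim_transform_eventually[OF tendsto_mult[OF elim(2,1)]])
      show "\<forall>\<^sub>F t in at_top. real (num_vertices_deg m (x \<omega>) k t) / real (num_vertices m (x \<omega>) t)
          * (real m * exp (- \<alpha> * t) * real (num_vertices m (x \<omega>) t))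
          = real m * exp (- \<alpha> * t) * real (num_vertices_deg m (x \<omega>) k t)"
        using eventually_ge_at_top[of 0]
      proof eventually_elim
        case (elim t)
        note r = \<open>regular_births (x \<omega>)\<close>
        have "population (x \<omega>) t = Suc (population (x \<omega>) t - 1)"
          using regular_births.population_pos[OF r elim] by simp
        then have "num_vertices m (x \<omega>) t \<noteq> 0"
          using regular_births.num_vertices_hist[OF r m elim] by fastforce
        then show ?case by simp
      qed
    qed
  qed
  have 1: "AE \<omega> in M. ((\<lambda>t. \<mu> * \<alpha> * exp (- \<alpha> * t) * real (population (x \<omega>) t)) \<longlongrightarrow> \<Theta> \<omega>) at_top"
    using pop
  proof eventually_elim
    case (elim \<omega>)
    from tendsto_mult_left[OF this, of "\<mu> * \<alpha>"] show ?case by (simp add: \<Theta>_def mult.assoc)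
  qed
  have 3: "tendsto_in_probability M (\<lambda>t \<omega>. real m * exp (- \<alpha> * t) * real (num_vertices_deg m (x \<omega>) k t))
      (\<lambda>\<omega>. 1 / (\<mu> * \<alpha>) * p k * \<Theta> \<omega>) at_top" for k
  proof -
    have "1 / (\<mu> * \<alpha>) * p k * \<Theta> \<omega> = p k * V \<omega>" for \<omega>
      unfolding \<mu>\<alpha>[symmetric] by simp
    then show ?thesis using deg[of k] by (intro M.AE_tendsto_imp_in_probability) auto
  qed
  have 4: "tendsto_in_probability M
      (\<lambda>t \<omega>. real (num_vertices_deg m (x \<omega>) k t) / real (num_vertices m (x \<omega>) t)) (\<lambda>_. p k) at_top" for k
    using AE_num_vertices_deg[OF p, of k] by (intro M.AE_tendsto_imp_in_probability) auto
  have "\<Theta> \<in> borel_measurable M" unfolding \<Theta>_def[abs_def] by measurable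
  then have "\<exists>\<Theta>\<in>borel_measurable M.
          (AE \<omega> in M. ((\<lambda>t. \<mu> * \<alpha> * exp (- \<alpha> * t) * real (population (x \<omega>) t)) \<longlongrightarrow> \<Theta> \<omega>) at_top) \<and>
          (AE \<omega> in M. ((\<lambda>t. real m * exp (- \<alpha> * t) * real (num_vertices m (x \<omega>) t))
             \<longlongrightarrow> 1 / (\<mu> * \<alpha>) * \<Theta> \<omega>) at_top) \<and>
          (\<forall>k. tendsto_in_probability M
             (\<lambda>t \<omega>. real m * exp (- \<alpha> * t) * real (num_vertices_deg m (x \<omega>) k t))
             (\<lambda>\<omega>. 1 / (\<mu> * \<alpha>) * p k * \<Theta> \<omega>) at_top) \<and>
          (\<forall>k. tendsto_in_probability M
             (\<lambda>t \<omega>. real (num_vertices_deg m (x \<omega>) k t) / real (num_vertices m (x \<omega>) t))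
             (\<lambda>_. p k) at_top)"
    using 1 vert 3 4 unfolding \<mu>\<alpha> by (intro bexI[of _ \<Theta>] conjI allI) (simp_all only: \<mu>\<alpha>)
  then show ?thesis
    using has_PA_law_CBP[OF m a_def] supercritical_\<xi> malthusian_\<xi> lipschitz_condition_\<xi>
    unfolding Let_def \<alpha>_def[symmetric] \<mu>_def[symmetric] p_def[symmetric] by blast
qed

end
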